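(* Let $k$ be an algebraically closed field of characteristic zero and let $p,q,d$ be positive integers. Let $G=\mathrm{Sp}_{2p}(k)\times\mathrm{Sp}_{2q}(k)$ act on $V(2p,2q,d)=M_{2p\times 2q}(k)^d$ by $$(A,B)\cdot(M_1,\dots,M_d)=(AM_1B^{-1},\dots,AM_dB^{-1}).$$ Then the $k$-algebra of invariants $k[V(2p,2q,d)]^{G}$ is generated by the polynomial functions $$(M_1,\dots,M_d)\longmapsto \mathrm{Tr}(M_{n_1m_1}M_{n_2m_2}\cdots M_{n_lm_l}),\qquad M_{ij}=M_i^tT_pM_jT_q,$$ where $l\ge 1$ and $n_i,m_i\in\{1,\dots,d\}$ for all $i\in\{1,\dots,l\}$.
   Context: For a positive integer $r$, $T_r$ is the $2r\times 2r$ block-diagonal matrix $\mathrm{diag}(\mu,\mu,\dots,\mu)$ with $\mu=\begin{pmatrix}0&1\\-1&0\end{pmatrix}$, and $\mathrm{Sp}_{2r}(k)=\{A\in\mathrm{GL}_{2r}(k): A^tT_rA=T_r\}$. $M_{a\times b}(k)$ is the space of $a\times b$ matrices over $k$, and $k[W]$ denotes the algebra of polynomial functions on a finite-dimensional vector space $W$. *)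

theory Defs
  imports
    "HOL-Library.FuncSet"
    "HOL-Computational_Algebra.Polynomial"
    "Jordan_Normal_Form.Matrix"
    "Jordan_Normal_Form.Gauss_Jordan_Elimination"
begin

definition symp_form :: "nat \<Rightarrow> 'a :: field mat" where
  "symp_form r = diag_block_mat (replicate r (mat_of_rows_list 2 [[0, 1], [-1, 0]]))"

definition Sp :: "nat \<Rightarrow> 'a :: field mat set" where
  "Sp r = {A \<in> carrier_mat (2 * r) (2 * r).
     invertible_mat A \<and> transpose_mat A * symp_form r * A = symp_form r}"

(* A tuple (M_1, ..., M_d) is a function on {1..d}, equal to undefined outside {1..d}. *)
definition mat_tuples :: "nat \<Rightarrow> nat \<Rightarrow> nat \<Rightarrow> (nat \<Rightarrow> 'a mat) set" where
  "mat_tuples m n d = {1..d} \<rightarrow>\<^sub>E carrier_mat m n"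

(* mat_inverse returns an option; it is Some of the two-sided inverse for every invertible B. *)
definition tuple_action ::
  "nat \<Rightarrow> 'a :: field mat \<times> 'a mat \<Rightarrow> (nat \<Rightarrow> 'a mat) \<Rightarrow> nat \<Rightarrow> 'a mat" where
  "tuple_action d = (\<lambda>(A, B) M. \<lambda>i\<in>{1..d}. A * M i * the (mat_inverse B))"

(* The unital k-algebra generated by S inside the algebra of all functions X \<rightarrow> k;
   a function on X is represented by its extension by undefined. *)
inductive_set generated_algebra :: "'x set \<Rightarrow> ('x \<Rightarrow> 'a :: field) set \<Rightarrow> ('x \<Rightarrow> 'a) set"
  for X :: "'x set" and S :: "('x \<Rightarrow> 'a) set" where
  generator: "f \<in> S \<Longrightarrow> restrict f X \<in> generated_algebra X S"
| const: "(\<lambda>x\<in>X. c) \<in> generated_algebra X S"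
| add: "f \<in> generated_algebra X S \<Longrightarrow> g \<in> generated_algebra X S
    \<Longrightarrow> (\<lambda>x\<in>X. f x + g x) \<in> generated_algebra X S"
| mult: "f \<in> generated_algebra X S \<Longrightarrow> g \<in> generated_algebra X S
    \<Longrightarrow> (\<lambda>x\<in>X. f x * g x) \<in> generated_algebra X S"

definition polynomial_functions ::
  "nat \<Rightarrow> nat \<Rightarrow> nat \<Rightarrow> ((nat \<Rightarrow> 'a :: field mat) \<Rightarrow> 'a) set" where
  "polynomial_functions m n d = generated_algebra (mat_tuples m n d)
     {\<lambda>M. M i $$ (a, b) | i a b. i \<in> {1..d} \<and> a < m \<and> b < n}"

definition symp_invariants ::
  "nat \<Rightarrow> nat \<Rightarrow> nat \<Rightarrow> ((nat \<Rightarrow> 'a :: field mat) \<Rightarrow> 'a) set" where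
  "symp_invariants p q d = {f \<in> polynomial_functions (2 * p) (2 * q) d.
     \<forall>g \<in> Sp p \<times> Sp q. \<forall>M \<in> mat_tuples (2 * p) (2 * q) d. f (tuple_action d g M) = f M}"

definition pair_mat :: "nat \<Rightarrow> nat \<Rightarrow> (nat \<Rightarrow> 'a :: field mat) \<Rightarrow> nat \<Rightarrow> nat \<Rightarrow> 'a mat" where
  "pair_mat p q M i j = transpose_mat (M i) * symp_form p * M j * symp_form q"

definition mat_trace :: "'a :: comm_monoid_add mat \<Rightarrow> 'a" where
  "mat_trace A = sum_list (diag_mat A)"

(* The list w = [(n_1, m_1), ..., (n_l, m_l)] encodes the indices of the word. *)
definition trace_function ::
  "nat \<Rightarrow> nat \<Rightarrow> (nat \<times> nat) list \<Rightarrow> (nat \<Rightarrow> 'a :: field mat) \<Rightarrow> 'a" where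
  "trace_function p q w M =
     mat_trace (foldr (\<lambda>(n, m) P. pair_mat p q M n m * P) w (1\<^sub>m (2 * q)))"

end

(* Polarisation reduces the theorem to multilinear invariants, that is, to tensors with slots in
   V = k^(2p) and in W = k^(2q). Differentiating the action of transvections gives a linear identity
   for such a tensor t, and contracting this identity with the symplectic form expresses J t through
   the pairwise contractions of t, where J = n + C and C is the Casimir operator of gl_N on the n
   slots in question. Over the rationals C is positive semidefinite, so J is injective, and J
   preserves the span of the products of pairings by the symplectic form; by induction on n the
   tensor t lies in that span. Applied to V and then to W, this writes every multilinear invariant
   through a perfect matching of the V-slots and one of the W-slots, and the cycles of the union of
   the two matchings are the traces. *)
theory Submission
  imports Defs "HOL-Combinatorics.Transposition" "HOL-Library.Function_Algebras"
    "Jordan_Normal_Form.Determinant"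
begin


text \<open>Complete reducibility of the symplectic group is replaced by solving a linear equation:
  the tensor is found as the preimage under J of a known element of the span of the pairings. The
  identity coming from a single slot would not do, since it relates the tensor to its swaps as well
  as to its contractions; the positivity argument applies only to the sum over all slots, swaps
  included. Positivity has no meaning over the field of the theorem, but J has integer coefficients,
  so composing with linear functionals over the rationals reduces injectivity to rational tensors.
  The two symplectic groups are treated one after the other, and the coefficients left by the first
  must still be invariant under the second. The span theorem is therefore stated for tensors with a
  parameter \<open>y\<close> and coefficients in an arbitrary subspace \<open>U\<close>. Polynomials
  need not be homogeneous. Polarisation sees the top degree only; dividing by D! isolates that part
  as an invariant, and the rest has smaller degree.\<close>

section \<open>The Casimir operator on tensors\<close>

text \<open>The tensors on the finite set \<open>A\<close> of slots are the functions on \<open>words N A\<close>.\<close>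

definition words :: "nat \<Rightarrow> nat set \<Rightarrow> (nat \<Rightarrow> nat) set" where
  "words N A = A \<rightarrow>\<^sub>E {..<N}"

lemma finite_words [simp]: "finite A \<Longrightarrow> finite (words N A)"
  by (simp add: words_def finite_PiE)

lemma words_empty [simp]: "words N {} = {\<lambda>_. undefined}"
  by (simp add: words_def)

lemma words_upd [simp]: "x \<in> words N A \<Longrightarrow> a \<in> A \<Longrightarrow> u < N \<Longrightarrow> x(a := u) \<in> words N A"
  unfolding words_def PiE_def Pi_def extensional_def by auto

lemma words_less [simp]: "x \<in> words N A \<Longrightarrow> a \<in> A \<Longrightarrow> x a < N"
  unfolding words_def by auto

lemma comp_transpose_upd: "x \<circ> transpose a b = x(a := x b, b := x a)"
  by (auto simp: transpose_def)

text \<open>On n slots the Casimir operator of gl_N is n N plus the sum of the swaps over ordered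
  pairs of slots; the 1 in \<open>of_nat N + 1\<close> is the additional n. The sum is grouped by
  \<open>b\<close> because contracting the invariance identity produces one such summand for each
  slot \<open>b\<close>.\<close>

definition casimir :: "nat \<Rightarrow> nat set \<Rightarrow> ((nat \<Rightarrow> nat) \<Rightarrow> 'k::field) \<Rightarrow> (nat \<Rightarrow> nat) \<Rightarrow> 'k" where
  "casimir N A f x =
     (\<Sum>b\<in>A. (of_nat N + 1) * f x + (\<Sum>a\<in>A - {b}. f (x \<circ> transpose a b)))"

lemma sum_words_upd:
  fixes f :: "(nat \<Rightarrow> nat) \<Rightarrow> 'k::comm_ring_1"
  assumes "finite A" "a \<in> A"
  shows "(\<Sum>u<N. \<Sum>x\<in>words N A. f (x(a := u))) = of_nat N * (\<Sum>x\<in>words N A. f x)"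
proof -
  have "(\<Sum>u<N. \<Sum>x\<in>words N A. f (x(a := u)))
      = (\<Sum>(u, x)\<in>{..<N} \<times> words N A. f (x(a := u)))"
    by (simp add: sum.cartesian_product)
  also have "\<dots> = (\<Sum>(u, x)\<in>{..<N} \<times> words N A. f x)"
    by (rule sum.reindex_bij_witness[of _ "\<lambda>(u, x). (x a, x(a := u))" "\<lambda>(u, x). (x a, x(a := u))"])
       (use assms in auto)
  also have "\<dots> = of_nat N * (\<Sum>x\<in>words N A. f x)"
    by (simp add: sum.cartesian_product[symmetric])
  finally show ?thesis .
qed

text \<open>The off-diagonal terms: a pair \<open>(u, x)\<close> with \<open>x a = x b\<close>
  amounts to the word \<open>z = x(a := u)\<close>, whose letter at \<open>b\<close> remembers the
  one overwritten at \<open>a\<close>. The word \<open>x(b := u)\<close> is then \<open>z\<close>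
  with the slots \<open>a\<close> and \<open>b\<close> swapped.\<close>

lemma sum_words_eq_slots:
  fixes f :: "(nat \<Rightarrow> nat) \<Rightarrow> 'k::comm_ring_1"
  assumes "finite A" "a \<in> A" "b \<in> A" "a \<noteq> b"
  shows "(\<Sum>u<N. \<Sum>x\<in>words N A. of_bool (x a = x b) * (f (x(a := u)) * f (x(b := u))))
    = (\<Sum>x\<in>words N A. f x * f (x \<circ> transpose a b))"
proof -
  have "(\<Sum>u<N. \<Sum>x\<in>words N A. of_bool (x a = x b) * (f (x(a := u)) * f (x(b := u))))
      = (\<Sum>(u, x)\<in>{..<N} \<times> words N A. of_bool (x a = x b) * (f (x(a := u)) * f (x(b := u))))"
    by (simp add: sum.cartesian_product)
  also have "\<dots> = (\<Sum>(u, x)\<in>{(u, x)\<in>{..<N} \<times> words N A. x a = x b}. f (x(a := u)) * f (x(b := u)))"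
    by (rule sum.mono_neutral_cong_right) (use assms in \<open>auto simp: of_bool_def split: if_splits\<close>)
  also have "\<dots> = (\<Sum>x\<in>words N A. f x * f (x \<circ> transpose a b))"
  proof (rule sum.reindex_bij_witness[of _ "\<lambda>z. (z a, z(a := z b))" "\<lambda>(u, x). x(a := u)"], goal_cases)
    case (1 p)
    then show ?case using assms by (auto simp: fun_eq_iff)
  next
    case (2 p)
    then show ?case using assms by auto
  next
    case (3 z)
    then show ?case using assms by auto
  next
    case (4 z)
    then show ?case using assms by auto
  next
    case (5 p)
    obtain u x where p: "p = (u, x)" by force
    with 5 have "x a = x b" by auto
    then have "x(b := u) = x(a := u) \<circ> transpose a b"
      using assms by (auto simp: fun_eq_iff transpose_def)
    then show ?case using p by simp
  qed
  finally show ?thesis .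
qed

text \<open>\<open>casimir N A f\<close> is \<open>card A\<close> times \<open>f\<close> plus the sum of \<open>E\<^sub>v\<^sub>u (E\<^sub>u\<^sub>v f)\<close> over the matrix units of \<open>gl\<^sub>N\<close>,
  and \<open>E\<^sub>v\<^sub>u\<close> is the transpose of \<open>E\<^sub>u\<^sub>v\<close>; pairing with \<open>f\<close> therefore gives a sum of squares.\<close>

lemma casimir_inj_rat:
  fixes f :: "(nat \<Rightarrow> nat) \<Rightarrow> rat"
  assumes A: "finite A" "A \<noteq> {}" and 0: "\<And>x. x \<in> words N A \<Longrightarrow> casimir N A f x = 0"
    and x: "x \<in> words N A"
  shows "f x = 0"
proof -
  define W where "W = words N A"
  have fW: "finite W" using A by (simp add: W_def)
  \<comment> \<open>\<open>E u v\<close> is the action of a matrix unit on \<open>f\<close>, summed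
    over the slots: a letter \<open>v\<close> is replaced by \<open>u\<close>. \<open>G a b\<close>
    collects the part of the squares that comes from the slots \<open>a\<close> and
    \<open>b\<close>.\<close>
  define E where "E u v x = (\<Sum>a\<in>A. of_bool (x a = v) * f (x(a := u)))" for u v x
  define G where "G a b = (\<Sum>u<N. \<Sum>x\<in>W. of_bool (x a = x b) * (f (x(a := u)) * f (x(b := u))))" for a b
  have Eq: "(\<Sum>u<N. \<Sum>v<N. \<Sum>x\<in>W. (E u v x)\<^sup>2) = (\<Sum>b\<in>A. \<Sum>a\<in>A. G a b)"
  proof -
    have 1: "(\<Sum>v<N. (E u v x)\<^sup>2)
        = (\<Sum>b\<in>A. \<Sum>a\<in>A. of_bool (x a = x b) * (f (x(a := u)) * f (x(b := u))))" if "x \<in> W" for u x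
    proof -
      have "(\<Sum>v<N. (E u v x)\<^sup>2) = (\<Sum>v<N. \<Sum>a\<in>A. \<Sum>b\<in>A.
          of_bool (x a = v) * f (x(a := u)) * (of_bool (x b = v) * f (x(b := u))))"
        unfolding E_def power2_eq_square sum_product by simp
      also have "\<dots> = (\<Sum>a\<in>A. \<Sum>b\<in>A. \<Sum>v<N.
          of_bool (x a = v) * f (x(a := u)) * (of_bool (x b = v) * f (x(b := u))))"
        by (subst sum.swap, rule sum.cong[OF refl], subst sum.swap, rule refl)
      also have "\<dots> = (\<Sum>a\<in>A. \<Sum>b\<in>A. of_bool (x a = x b) * (f (x(a := u)) * f (x(b := u))))"
      proof (intro sum.cong refl)
        fix a b assume "a \<in> A" "b \<in> A"
        then have "x a < N" using that by (simp add: W_def)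
        have "(\<Sum>v<N. of_bool (x a = v) * f (x(a := u)) * (of_bool (x b = v) * f (x(b := u))))
          = (\<Sum>v<N. if v = x a then of_bool (x a = x b) * (f (x(a := u)) * f (x(b := u))) else 0)"
          by (intro sum.cong) auto
        also have "\<dots> = of_bool (x a = x b) * (f (x(a := u)) * f (x(b := u)))"
          using \<open>x a < N\<close> by simp
        finally show "(\<Sum>v<N. of_bool (x a = v) * f (x(a := u)) * (of_bool (x b = v) * f (x(b := u))))
          = of_bool (x a = x b) * (f (x(a := u)) * f (x(b := u)))" .
      qed
      also have "\<dots> = (\<Sum>b\<in>A. \<Sum>a\<in>A. of_bool (x a = x b) * (f (x(a := u)) * f (x(b := u))))"
        by (rule sum.swap)
      finally show ?thesis .
    qed
    have "(\<Sum>u<N. \<Sum>v<N. \<Sum>x\<in>W. (E u v x)\<^sup>2) = (\<Sum>u<N. \<Sum>x\<in>W. \<Sum>v<N. (E u v x)\<^sup>2)"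
      by (rule sum.cong[OF refl], rule sum.swap)
    also have "\<dots> = (\<Sum>u<N. \<Sum>x\<in>W. \<Sum>b\<in>A. \<Sum>a\<in>A. of_bool (x a = x b) * (f (x(a := u)) * f (x(b := u))))"
      using 1 by simp
    also have "\<dots> = (\<Sum>u<N. \<Sum>b\<in>A. \<Sum>a\<in>A. \<Sum>x\<in>W. of_bool (x a = x b) * (f (x(a := u)) * f (x(b := u))))"
      by (rule sum.cong[OF refl], subst sum.swap, rule sum.cong[OF refl], subst sum.swap, rule refl)
    also have "\<dots> = (\<Sum>b\<in>A. \<Sum>a\<in>A. G a b)"
      unfolding G_def by (subst sum.swap, rule sum.cong[OF refl], subst sum.swap, rule refl)
    finally show ?thesis .
  qed
  have Gaa: "G a a = of_nat N * (\<Sum>x\<in>W. (f x)\<^sup>2)" if "a \<in> A" for a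
    using sum_words_upd[OF A(1) that, of "\<lambda>x. (f x)\<^sup>2" N]
    unfolding G_def W_def by (simp add: power2_eq_square)
  have Gab: "G a b = (\<Sum>x\<in>W. f x * f (x \<circ> transpose a b))" if "a \<in> A" "b \<in> A" "a \<noteq> b" for a b
    using sum_words_eq_slots[OF A(1) that, where N = N and f = f] unfolding G_def W_def .
  have "0 = (\<Sum>x\<in>W. f x * casimir N A f x)"
    using 0 by (simp add: W_def)
  also have "\<dots> = (\<Sum>x\<in>W. \<Sum>b\<in>A. (of_nat N + 1) * (f x)\<^sup>2 + (\<Sum>a\<in>A - {b}. f x * f (x \<circ> transpose a b)))"
    unfolding casimir_def sum_distrib_left distrib_left
    by (intro sum.cong refl arg_cong2[where f = "(+)"]) (simp add: power2_eq_square algebra_simps)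
  also have "\<dots> = (\<Sum>b\<in>A. (of_nat N + 1) * (\<Sum>x\<in>W. (f x)\<^sup>2)
      + (\<Sum>a\<in>A - {b}. \<Sum>x\<in>W. f x * f (x \<circ> transpose a b)))"
    apply (subst sum.swap)
    apply (rule sum.cong[OF refl])
    apply (subst sum.distrib)
    apply (subst (2) sum.swap)
    apply (simp add: sum_distrib_left)
    done
  \<comment> \<open>\<open>N\<close> of the \<open>N + 1\<close> copies become the diagonal term
    \<open>G b b\<close>; the copy left over makes the form strictly positive.\<close>
  also have "\<dots> = (\<Sum>b\<in>A. (\<Sum>x\<in>W. (f x)\<^sup>2) + (\<Sum>a\<in>A. G a b))"
  proof (rule sum.cong[OF refl])
    fix b assume b: "b \<in> A"
    have "(\<Sum>a\<in>A. G a b) = G b b + (\<Sum>a\<in>A - {b}. G a b)"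
      using A b by (simp add: sum.remove)
    also have "(\<Sum>a\<in>A - {b}. G a b) = (\<Sum>a\<in>A - {b}. \<Sum>x\<in>W. f x * f (x \<circ> transpose a b))"
      using Gab b by (intro sum.cong) auto
    finally show "(of_nat N + 1) * (\<Sum>x\<in>W. (f x)\<^sup>2) + (\<Sum>a\<in>A - {b}. \<Sum>x\<in>W. f x * f (x \<circ> transpose a b))
      = (\<Sum>x\<in>W. (f x)\<^sup>2) + (\<Sum>a\<in>A. G a b)"
      using Gaa[OF b] by (simp add: algebra_simps)
  qed
  also have "\<dots> = of_nat (card A) * (\<Sum>x\<in>W. (f x)\<^sup>2) + (\<Sum>u<N. \<Sum>v<N. \<Sum>x\<in>W. (E u v x)\<^sup>2)"
    by (simp add: sum.distrib Eq)
  finally have s: "of_nat (card A) * (\<Sum>x\<in>W. (f x)\<^sup>2) + (\<Sum>u<N. \<Sum>v<N. \<Sum>x\<in>W. (E u v x)\<^sup>2) = 0"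
    by simp
  have nn: "0 \<le> (\<Sum>u<N. \<Sum>v<N. \<Sum>x\<in>W. (E u v x)\<^sup>2)" "0 \<le> (\<Sum>x\<in>W. (f x)\<^sup>2)"
    by (intro sum_nonneg; simp)+
  have "(of_nat (card A) :: rat) > 0" using A by (simp add: card_gt_0_iff)
  with s nn have "(\<Sum>x\<in>W. (f x)\<^sup>2) = 0"
    by (metis add_nonneg_eq_0_iff mult_eq_0_iff mult_nonneg_nonneg less_le)
  then show ?thesis
    using fW x by (simp add: sum_nonneg_eq_0_iff W_def)
qed

text \<open>Composing with such functionals carries injectivity from rational tensors to tensors over \<open>'k\<close>.\<close>

lemma ex_rat_functional:
  fixes c :: "'k::field_char_0"
  assumes "c \<noteq> 0"
  obtains l :: "'k \<Rightarrow> rat" where "l c = 1" "\<And>x y. l (x + y) = l x + l y"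
    "\<And>r x. l (of_rat r * x) = r * l x"
proof -
  interpret vector_space_pair "\<lambda>r x. of_rat r * x :: 'k" "(*) :: rat \<Rightarrow> rat \<Rightarrow> rat"
    by unfold_locales (auto simp: algebra_simps of_rat_add of_rat_mult)
  have "vs1.independent {c}" using assms by simp
  from linear_independent_extend[OF this, of "\<lambda>_. 1"] obtain g where
    g: "Vector_Spaces.linear (\<lambda>r x. of_rat r * x) (*) g" "g c = 1" by auto
  show ?thesis
    using g that[of g] linear_add[OF g(1)] linear_scale[OF g(1)] by blast
qed

lemma casimir_inj:
  fixes f :: "(nat \<Rightarrow> nat) \<Rightarrow> 'k::field_char_0"
  assumes A: "finite A" "A \<noteq> {}" and 0: "\<And>x. x \<in> words N A \<Longrightarrow> casimir N A f x = 0"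
    and x: "x \<in> words N A"
  shows "f x = 0"
proof (rule ccontr)
  assume "f x \<noteq> 0"
  then obtain l :: "'k \<Rightarrow> rat" where l: "l (f x) = 1" "\<And>x y. l (x + y) = l x + l y"
    "\<And>r x. l (of_rat r * x) = r * l x" by (rule ex_rat_functional) blast
  have l0: "l 0 = 0" using l(2)[of 0 0] by simp
  have lsum: "l (sum h I) = (\<Sum>i\<in>I. l (h i))" for h :: "'b \<Rightarrow> 'k" and I
    by (induction I rule: infinite_finite_induct) (auto simp: l0 l)
  have lN: "l ((of_nat N + 1) * z) = (of_nat N + 1) * l z" for z
    using l(3)[of "of_nat N + 1" z] by (simp add: of_rat_add)
  have "casimir N A (\<lambda>x. l (f x)) y = l (casimir N A f y)" for y
    unfolding casimir_def by (simp add: lsum l lN)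
  then have "casimir N A (\<lambda>x. l (f x)) y = 0" if "y \<in> words N A" for y
    using 0[OF that] l0 by simp
  from casimir_inj_rat[OF A this x] l(1) show False by simp
qed

lemma casimir_add: "casimir N A (\<lambda>x. f x + g x) x = casimir N A f x + casimir N A g x"
  by (simp add: casimir_def sum.distrib algebra_simps)

lemma casimir_scale: "casimir N A (\<lambda>x. c * f x) x = c * casimir N A f x"
  by (simp add: casimir_def sum.distrib sum_distrib_left algebra_simps)

lemma casimir_diff: "casimir N A (\<lambda>x. f x - g x) x = casimir N A f x - casimir N A g x"
  using casimir_add[of N A f "\<lambda>x. (-1) * g x" x] casimir_scale[of N A "-1" g x] by simp

text \<open>An injective endomorphism of a finite-dimensional space is onto. The ambient space may
  have infinite dimension, so the argument runs with a maximal independent subset \<open>C\<close>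
  of \<open>B\<close>: its image is independent, has the same cardinality and lies in
  \<open>span C\<close>, hence spans it.\<close>

lemma (in vector_space) span_subset_image_of_inj:
  assumes fin: "finite B" and add: "\<And>x y. f (x + y) = f x + f y"
    and scale: "\<And>c x. f (scale c x) = scale c (f x)"
    and stable: "f ` B \<subseteq> span B"
    and inj: "\<And>x. x \<in> span B \<Longrightarrow> f x = 0 \<Longrightarrow> x = 0"
  shows "span B \<subseteq> f ` span B"
proof -
  interpret p: vector_space_pair scale scale ..
  have lin: "Vector_Spaces.linear scale scale f"
    by unfold_locales (auto simp: add scale)
  obtain C where C: "C \<subseteq> B" "independent C" "B \<subseteq> span C"
    using maximal_independent_subset[of B] by blast
  have finC: "finite C" using C fin finite_subset by blast
  have sCB: "span C = span B"
    using C by (metis span_mono span_span subset_antisym span_minimal subspace_span)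
  have inj': "inj_on f (span C)"
  proof (rule inj_onI)
    fix x y assume xy: "x \<in> span C" "y \<in> span C" "f x = f y"
    have "f (x - y) = 0" using xy p.linear_diff[OF lin, of x y] by simp
    then show "x = y" using inj[of "x - y"] xy sCB span_diff by fastforce
  qed
  have ind: "independent (f ` C)"
    using p.linear_independent_injective_image[OF lin C(2) inj'] .
  have card: "card (f ` C) = card C"
    using inj' by (meson card_image inj_on_subset span_superset)
  have fsub: "f ` span B \<subseteq> span B"
  proof -
    have "f ` span B = span (f ` B)" using p.linear_span_image[OF lin] by simp
    then show ?thesis using stable by (simp add: span_minimal)
  qed
  have fC: "f ` C \<subseteq> span C" using fsub sCB span_superset by blast
  have "span C \<subseteq> span (f ` C)"
  proof
    fix y assume y: "y \<in> span C"
    show "y \<in> span (f ` C)"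
    proof (rule ccontr)
      assume ny: "y \<notin> span (f ` C)"
      then have "independent (insert y (f ` C))" using ind independent_insertI by blast
      with independent_span_bound[OF finC this] y fC
      have "card (insert y (f ` C)) \<le> card C" by auto
      moreover have "y \<notin> f ` C" using ny span_superset by blast
      ultimately show False using card finC by simp
    qed
  qed
  then show ?thesis using p.linear_span_image[OF lin, of C] sCB by simp
qed


section \<open>Infinitesimal invariants are spanned by pairings\<close>

text \<open>Products of \<open>T\<close> over the pairs of a perfect matching of \<open>A\<close>.
  The matching is not kept as data, and a pair may enter in either order; for antisymmetric
  \<open>T\<close> and nonempty \<open>A\<close> both signs of a product therefore occur.\<close>

inductive pairing_form :: "(nat \<Rightarrow> nat \<Rightarrow> 'k::field) \<Rightarrow> nat set \<Rightarrow> ((nat \<Rightarrow> nat) \<Rightarrow> 'k) \<Rightarrow> bool"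
  for T :: "nat \<Rightarrow> nat \<Rightarrow> 'k" where
  empty: "pairing_form T {} (\<lambda>x. 1)"
| pair: "pairing_form T A w \<Longrightarrow> a \<notin> A \<Longrightarrow> b \<notin> A \<Longrightarrow> a \<noteq> b
    \<Longrightarrow> pairing_form T (insert a (insert b A)) (\<lambda>x. T (x a) (x b) * w x)"

lemma pairing_form_cong:
  "pairing_form T A w \<Longrightarrow> (\<And>a. a \<in> A \<Longrightarrow> x a = y a) \<Longrightarrow> w x = w y"
  by (induction rule: pairing_form.induct) auto

text \<open>Applied to a transposition \<open>h\<close>, this keeps the span of the pairings stable
  under the swaps in \<open>casimir\<close>.\<close>

lemma pairing_form_comp:
  "pairing_form T A w \<Longrightarrow> inj h \<Longrightarrow> pairing_form T (h ` A) (\<lambda>x. w (x \<circ> h))"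
proof (induction rule: pairing_form.induct)
  case empty
  then show ?case by (simp add: pairing_form.empty)
next
  case (pair A w a b)
  have "h a \<notin> h ` A" "h b \<notin> h ` A" "h a \<noteq> h b"
    using pair by (auto simp: inj_def)
  from pairing_form.pair[OF pair.IH[OF pair.prems] this] show ?case by simp
qed

text \<open>Makes the span of the pairings finite-dimensional. A pairing on \<open>A\<close> is
  determined by the pair added last and a pairing on the remaining slots; the constant 1 covers
  empty \<open>A\<close>.\<close>

lemma finite_pairing_forms:
  "finite A \<Longrightarrow> finite {w. pairing_form T A w}"
proof (induction "card A" arbitrary: A rule: less_induct)
  case less
  define S where "S = (\<lambda>(a, b, w) x. T (x a) (x b) * w x) `
    (SIGMA a:A. SIGMA b:A. {w. a \<noteq> b \<and> pairing_form T (A - {a, b}) w})"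
  have "finite {w. a \<noteq> b \<and> pairing_form T (A - {a, b}) w}" if "a \<in> A" "b \<in> A" for a b
  proof -
    have "card (A - {a, b}) < card A"
      using that less.prems by (intro psubset_card_mono) auto
    then show ?thesis using less by simp
  qed
  then have "finite S"
    unfolding S_def using less.prems by (intro finite_imageI finite_SigmaI) auto
  moreover have "{w. pairing_form T A w} \<subseteq> insert (\<lambda>x. 1) S"
  proof
    fix w assume "w \<in> {w. pairing_form T A w}"
    then have "pairing_form T A w" by simp
    then show "w \<in> insert (\<lambda>x. 1) S"
    proof cases
      case empty
      then show ?thesis by simp
    next
      case (pair A' w' a b)
      then have "A - {a, b} = A'" by auto
      then have "w \<in> S" unfolding S_def using pair
        by (intro image_eqI[of _ _ "(a, b, w')"]) auto
      then show ?thesis by simp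
    qed
  qed
  ultimately show ?case by (meson finite_insert finite_subset)
qed

text \<open>The tensor product of the span of the pairings with \<open>U\<close>, written as
  functions of a word \<open>x\<close> and a parameter \<open>y\<close>. Scalars are absorbed into
  the coefficient \<open>c\<close>.\<close>

inductive form_span :: "(nat \<Rightarrow> nat \<Rightarrow> 'k::field) \<Rightarrow> nat set \<Rightarrow> ('b \<Rightarrow> 'k) set
    \<Rightarrow> ((nat \<Rightarrow> nat) \<Rightarrow> 'b \<Rightarrow> 'k) \<Rightarrow> bool"
  for T A U where
  zero: "form_span T A U (\<lambda>x y. 0)"
| add_gen: "form_span T A U s \<Longrightarrow> pairing_form T A w \<Longrightarrow> c \<in> U
    \<Longrightarrow> form_span T A U (\<lambda>x y. w x * c y + s x y)"

lemma form_span_add: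
  "form_span T A U s \<Longrightarrow> form_span T A U s' \<Longrightarrow> form_span T A U (\<lambda>x y. s x y + s' x y)"
proof (induction rule: form_span.induct)
  case (add_gen s w c)
  then show ?case
    using form_span.add_gen[of T A U "\<lambda>x y. s x y + s' x y" w c] by (simp add: add.assoc)
qed simp

lemma form_span_sum:
  "(\<And>i. i \<in> I \<Longrightarrow> form_span T A U (s i)) \<Longrightarrow> form_span T A U (\<lambda>x y. \<Sum>i\<in>I. s i x y)"
  by (induction I rule: infinite_finite_induct)
     (auto intro: form_span.zero form_span_add)

lemma form_span_scale:
  assumes "form_span T A U s" and U: "\<And>k c. c \<in> U \<Longrightarrow> (\<lambda>y. k * c y) \<in> U"
  shows "form_span T A U (\<lambda>x y. k * s x y)"
  using assms(1)
proof (induction rule: form_span.induct)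
  case zero
  then show ?case by (simp add: form_span.zero)
next
  case (add_gen s w c)
  from form_span.add_gen[OF add_gen.IH add_gen.hyps(2) U[OF add_gen.hyps(3), of k]]
  show ?case by (simp add: algebra_simps)
qed

lemma form_span_pair:
  assumes "form_span T A U s" "a \<notin> A" "b \<notin> A" "a \<noteq> b"
  shows "form_span T (insert a (insert b A)) U (\<lambda>x y. T (x a) (x b) * s x y)"
  using assms(1)
proof (induction rule: form_span.induct)
  case zero
  then show ?case by (simp add: form_span.zero)
next
  case (add_gen s w c)
  from form_span.add_gen[OF add_gen.IH pairing_form.pair[OF add_gen.hyps(2) assms(2-4)] add_gen.hyps(3)]
  show ?case by (simp add: algebra_simps)
qed

lemma form_span_cong:
  "form_span T A U s \<Longrightarrow> (\<And>a. a \<in> A \<Longrightarrow> x a = x' a) \<Longrightarrow> s x y = s x' y"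
  by (induction rule: form_span.induct) (auto dest: pairing_form_cong[of T A _ x x'])

text \<open>Annihilation by the elements \<open>u v\<^sup>t T + v u\<^sup>t T\<close> of the symplectic Lie algebra.\<close>

definition infinitesimally_invariant ::
  "nat \<Rightarrow> (nat \<Rightarrow> nat \<Rightarrow> 'k::field) \<Rightarrow> nat set \<Rightarrow> ((nat \<Rightarrow> nat) \<Rightarrow> 'k) \<Rightarrow> bool" where
  "infinitesimally_invariant N T A f \<longleftrightarrow> (\<forall>x\<in>words N A. \<forall>u<N. \<forall>v<N.
     (\<Sum>a\<in>A. T v (x a) * f (x(a := u)) + T u (x a) * f (x(a := v))) = 0)"

definition contraction ::
  "nat \<Rightarrow> (nat \<Rightarrow> nat \<Rightarrow> 'k::field) \<Rightarrow> nat \<Rightarrow> nat \<Rightarrow> ((nat \<Rightarrow> nat) \<Rightarrow> 'k) \<Rightarrow> (nat \<Rightarrow> nat) \<Rightarrow> 'k" where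
  "contraction N T a b f x = (\<Sum>v<N. \<Sum>w<N. T v w * f (x(b := w, a := v)))"

text \<open>\<open>T_ortho\<close> says that the inverse of \<open>T\<close> is its transpose, so
  the same matrix serves for pairing and for contracting slots. \<open>T_outside\<close> makes
  pairings vanish at letters outside \<open>{..<N}\<close>, so that identities in their span can be
  checked on \<open>words N A\<close>.\<close>

locale symp_tensor =
  fixes N :: nat and T :: "nat \<Rightarrow> nat \<Rightarrow> 'k::field_char_0"
  assumes T_outside: "\<not> (i < N \<and> j < N) \<Longrightarrow> T i j = 0"
    and T_antisym: "T j i = - T i j"
    and T_ortho: "u < N \<Longrightarrow> v < N \<Longrightarrow> (\<Sum>w<N. T u w * T v w) = of_bool (u = v)"
begin

lemma T_ortho': "u < N \<Longrightarrow> v < N \<Longrightarrow> (\<Sum>w<N. T w u * T w v) = of_bool (u = v)"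
proof -
  have "T w u * T w v = T u w * T v w" for w
    using T_antisym[of w u] T_antisym[of w v] by simp
  then show "u < N \<Longrightarrow> v < N \<Longrightarrow> ?thesis" using T_ortho[of u v] by simp
qed

lemma T_ortho_left: "u < N \<Longrightarrow> v < N \<Longrightarrow> (\<Sum>w<N. T w u * T v w) = - of_bool (u = v)"
proof -
  have "T w u * T v w = - (T u w * T v w)" for w
    using T_antisym[of w u] by simp
  then show "u < N \<Longrightarrow> v < N \<Longrightarrow> ?thesis" using T_ortho[of u v] by (simp add: sum_negf)
qed

lemma pairing_form_outside:
  "pairing_form T A w \<Longrightarrow> a \<in> A \<Longrightarrow> \<not> x a < N \<Longrightarrow> w x = 0"
  by (induction rule: pairing_form.induct) (auto simp: T_outside)

text \<open>Elements of the span of the pairings satisfy the last two assumptions. These turn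
  vanishing on \<open>words N A\<close>, which is what \<open>casimir_inj\<close> gives, into being
  0 in the space of all functions.\<close>

lemma pairing_form_eqI:
  assumes "\<And>x. x \<in> words N A \<Longrightarrow> f x = 0"
    and "\<And>x a. a \<in> A \<Longrightarrow> \<not> x a < N \<Longrightarrow> f x = 0"
    and "\<And>x y. (\<And>a. a \<in> A \<Longrightarrow> x a = y a) \<Longrightarrow> f x = f y"
  shows "f x = 0"
proof (cases "\<forall>a\<in>A. x a < N")
  case True
  then have "restrict x A \<in> words N A" by (auto simp: words_def)
  with assms(1) assms(3)[of x "restrict x A"] show ?thesis by simp
qed (use assms(2) in auto)

text \<open>\<open>casimir\<close> is an injective endomorphism of the finite-dimensional span of
  the pairings, hence invertible there; \<open>c y\<close> does not involve the word and is carried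
  along.\<close>

lemma casimir_solve:
  assumes A: "finite A" "A \<noteq> {}" and w: "pairing_form T A w" and c: "c \<in> U"
    and U: "\<And>k c. c \<in> U \<Longrightarrow> (\<lambda>y. k * c y) \<in> U"
  shows "\<exists>s. form_span T A U s \<and> (\<forall>x y. casimir N A (\<lambda>x. s x y) x = w x * c y)"
proof -
  interpret fv: vector_space "\<lambda>(k::'k) (f :: (nat \<Rightarrow> nat) \<Rightarrow> 'k) x. k * f x"
    by unfold_locales (auto simp: fun_eq_iff algebra_simps)
  let ?B = "{w. pairing_form T A w}"
  have outside: "f x = 0" if "f \<in> fv.span ?B" and a: "a \<in> A" "\<not> x a < N" for f x a
    using that(1)
  proof (induction rule: fv.span_induct_alt)
    case (step k w g)
    then show ?case using pairing_form_outside[of A w a x] a by simp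
  qed simp
  have depends: "f x = f y" if "f \<in> fv.span ?B" and xy: "\<And>a. a \<in> A \<Longrightarrow> x a = y a" for f x y
    using that(1)
  proof (induction rule: fv.span_induct_alt)
    case (step k w g)
    then show ?case using pairing_form_cong[of T A w x y] xy by simp
  qed simp
  have "fv.span ?B \<subseteq> casimir N A ` fv.span ?B"
  proof (rule fv.span_subset_image_of_inj)
    show "finite ?B" using A(1) by (rule finite_pairing_forms)
    show "casimir N A (f + g) = casimir N A f + casimir N A g" for f g :: "(nat \<Rightarrow> nat) \<Rightarrow> 'k"
      using casimir_add[of N A f g] by (simp add: fun_eq_iff plus_fun_def)
    show "casimir N A (\<lambda>x. c * f x) = (\<lambda>x. c * casimir N A f x)" for c and f :: "(nat \<Rightarrow> nat) \<Rightarrow> 'k"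
      by (simp add: fun_eq_iff casimir_scale)
    show "casimir N A ` ?B \<subseteq> fv.span ?B"
    proof safe
      fix w assume w: "pairing_form T A w"
      have sw: "(\<lambda>x. w (x \<circ> transpose a b)) \<in> fv.span ?B" if "a \<in> A" "b \<in> A" for a b
      proof -
        have "transpose a b ` A = A" using that by (auto simp: image_iff transpose_def)
        then show ?thesis using pairing_form_comp[OF w bij_is_inj[OF bij_transpose], of a b]
          by (intro fv.span_base) simp
      qed
      have span_add: "(\<lambda>x. f x + g x) \<in> fv.span ?B" if "f \<in> fv.span ?B" "g \<in> fv.span ?B" for f g
        using fv.span_add[OF that] by (simp only: func_plus)
      have span_sum: "(\<lambda>x. \<Sum>i\<in>I. g i x) \<in> fv.span ?B" if "\<And>i. i \<in> I \<Longrightarrow> g i \<in> fv.span ?B"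
        for I :: "nat set" and g
        using that
      proof (induction I rule: infinite_finite_induct)
        case (insert i I)
        then show ?case using span_add[of "g i" "\<lambda>x. \<Sum>i\<in>I. g i x"] by simp
      qed (use fv.span_zero in \<open>simp_all add: func_zero\<close>)
      have "(\<lambda>x. (of_nat N + 1) * w x) \<in> fv.span ?B"
        using w by (intro fv.span_scale fv.span_base) simp
      then show "casimir N A w \<in> fv.span ?B"
        unfolding casimir_def by (intro span_sum span_add) (auto intro: sw)
    qed
    show "f = 0" if f: "f \<in> fv.span ?B" and z: "casimir N A f = 0" for f
    proof
      fix x
      have "f x = 0"
      proof (rule pairing_form_eqI[of A f x])
        have "casimir N A f y = 0" for y using z by simp
        then show "f y = 0" if "y \<in> words N A" for y
          using casimir_inj[OF A _ that] by blast
        show "f y = 0" if "a \<in> A" "\<not> y a < N" for y a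
          using outside[of f a y] f that by blast
        show "f y = f z" if "\<And>a. a \<in> A \<Longrightarrow> y a = z a" for y z
          using depends[of f y z] f that by blast
      qed
      then show "f x = 0 x" by simp
    qed
  qed
  moreover have "w \<in> fv.span ?B" using w by (simp add: fv.span_base)
  ultimately obtain r where r: "r \<in> fv.span ?B" "casimir N A r = w" by auto
  have "form_span T A U (\<lambda>x y. r x * c y)"
    using r(1)
  proof (induction rule: fv.span_induct_alt)
    case base
    then show ?case by (simp add: form_span.zero)
  next
    case (step k w' g)
    have "w' \<in> {w. pairing_form T A w}" using step by simp
    then have "form_span T A U (\<lambda>x y. w' x * (k * c y) + g x * c y)"
      using form_span.add_gen[OF step(2) _ U[OF c, of k], of w'] by blast
    moreover have "(\<lambda>x y. w' x * (k * c y) + g x * c y) = (\<lambda>x y. ((\<lambda>x. k * w' x) + g) x * c y)"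
      by (intro ext) (simp add: algebra_simps)
    ultimately show ?case by (simp only:)
  qed
  moreover have "casimir N A (\<lambda>x. r x * c y) x = w x * c y" for x y
    using casimir_scale[of N A "c y" r x] r(2) by (simp add: mult.commute)
  ultimately show ?thesis by blast
qed

lemma casimir_solve_span:
  assumes A: "finite A" "A \<noteq> {}" and s: "form_span T A U s"
    and U: "\<And>k c. c \<in> U \<Longrightarrow> (\<lambda>y. k * c y) \<in> U"
  shows "\<exists>s'. form_span T A U s' \<and> (\<forall>x y. casimir N A (\<lambda>x. s' x y) x = s x y)"
  using s
proof (induction rule: form_span.induct)
  case zero
  have "casimir N A (\<lambda>x. 0) x = 0" for x by (simp add: casimir_def)
  then show ?case using form_span.zero by fastforce
next
  case (add_gen s w c)
  then obtain s' where s': "form_span T A U s'" "\<And>x y. casimir N A (\<lambda>x. s' x y) x = s x y" by blast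
  from casimir_solve[OF A add_gen.hyps(2,3) U] obtain r where
    r: "form_span T A U r" "\<And>x y. casimir N A (\<lambda>x. r x y) x = w x * c y" by blast
  show ?case
    using form_span_add[OF r(1) s'(1)] r(2) s'(2)
    by (intro exI[of _ "\<lambda>x y. r x y + s' x y"]) (simp add: casimir_add)
qed

text \<open>This is the invariance equation at \<open>x(b := w)\<close>, multiplied by \<open>T v w\<close> and summed over \<open>v\<close> and \<open>w\<close>.\<close>

lemma casimir_eq_contractions:
  assumes A: "finite A" and f: "infinitesimally_invariant N T A f" and x: "x \<in> words N A"
  shows "casimir N A f x = - (\<Sum>b\<in>A. \<Sum>a\<in>A - {b}. T (x b) (x a) * contraction N T a b f x)"
proof -
  have "(of_nat N + 1) * f x + (\<Sum>a\<in>A - {b}. f (x \<circ> transpose a b))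
      = - (\<Sum>a\<in>A - {b}. T (x b) (x a) * contraction N T a b f x)" if b: "b \<in> A" for b
  proof -
    let ?u = "x b"
    have u: "?u < N" using x b by simp
    define g where "g v w a = T v w * (T v ((x(b := w)) a) * f (x(b := w, a := ?u))
        + T ?u ((x(b := w)) a) * f (x(b := w, a := v)))" for v w a
    have "(\<Sum>a\<in>A. T v ((x(b := w)) a) * f (x(b := w, a := ?u))
        + T ?u ((x(b := w)) a) * f (x(b := w, a := v))) = 0" if "v < N" "w < N" for v w
      using f words_upd[OF x b \<open>w < N\<close>] u that unfolding infinitesimally_invariant_def by blast
    then have "0 = (\<Sum>v<N. \<Sum>w<N. T v w * (\<Sum>a\<in>A. T v ((x(b := w)) a) * f (x(b := w, a := ?u))
        + T ?u ((x(b := w)) a) * f (x(b := w, a := v))))"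
      by (simp del: fun_upd_apply)
    also have "\<dots> = (\<Sum>v<N. \<Sum>w<N. \<Sum>a\<in>A. g v w a)"
      by (simp add: g_def sum_distrib_left)
    also have "\<dots> = (\<Sum>a\<in>A. \<Sum>v<N. \<Sum>w<N. g v w a)"
      by (subst (2) sum.swap, subst sum.swap, rule refl)
    also have "\<dots> = (\<Sum>v<N. \<Sum>w<N. g v w b) + (\<Sum>a\<in>A - {b}. \<Sum>v<N. \<Sum>w<N. g v w a)"
      using A b by (simp add: sum.remove)
    \<comment> \<open>In the slot \<open>b\<close> itself orthogonality gives 1 for each
      \<open>v\<close> in the first half and a single 1 at \<open>v = ?u\<close> in the second: this
      is the origin of \<open>N + 1\<close>.\<close>
    also have "(\<Sum>v<N. \<Sum>w<N. g v w b) = (of_nat N + 1) * f x"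
    proof -
      have "(\<Sum>v<N. \<Sum>w<N. g v w b)
        = (\<Sum>v<N. (\<Sum>w<N. T v w * T v w) * f x + (\<Sum>w<N. T v w * T ?u w) * f (x(b := v)))"
        by (simp add: g_def sum.distrib sum_distrib_left algebra_simps)
      also have "\<dots> = (\<Sum>v<N. f x + of_bool (v = ?u) * f (x(b := v)))"
        using u by (intro sum.cong) (auto simp: T_ortho)
      also have "\<dots> = of_nat N * f x + (\<Sum>v<N. if v = ?u then f (x(b := v)) else 0)"
        unfolding sum.distrib by (intro arg_cong2[where f = "(+)"] sum.cong) auto
      finally show ?thesis using u by (simp add: algebra_simps)
    qed
    \<comment> \<open>In another slot \<open>a\<close>, orthogonality forces \<open>w = x a\<close>
      in the first half, which swaps the letters of \<open>a\<close> and \<open>b\<close>; in the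
      second half \<open>T (x b) (x a)\<close> comes out as a factor and a contraction
      remains.\<close>
    also have "(\<Sum>a\<in>A - {b}. \<Sum>v<N. \<Sum>w<N. g v w a)
      = (\<Sum>a\<in>A - {b}. f (x \<circ> transpose a b) + T (x b) (x a) * contraction N T a b f x)"
    proof (rule sum.cong[OF refl])
      fix a assume "a \<in> A - {b}"
      then have a: "a \<in> A" "a \<noteq> b" by auto
      have xa: "x a < N" using x a by simp
      have "(\<Sum>v<N. \<Sum>w<N. g v w a) = (\<Sum>v<N. \<Sum>w<N. T v w * T v (x a) * f (x(b := w, a := ?u)))
          + (\<Sum>v<N. \<Sum>w<N. T v w * (T ?u (x a) * f (x(b := w, a := v))))"
        using a by (simp add: g_def sum.distrib algebra_simps)
      also have "(\<Sum>v<N. \<Sum>w<N. T v w * T v (x a) * f (x(b := w, a := ?u)))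
          = (\<Sum>w<N. (\<Sum>v<N. T v w * T v (x a)) * f (x(b := w, a := ?u)))"
        by (subst sum.swap) (simp add: sum_distrib_right)
      also have "\<dots> = (\<Sum>w<N. if w = x a then f (x(b := w, a := ?u)) else 0)"
        using xa by (intro sum.cong) (auto simp: T_ortho')
      also have "\<dots> = f (x(b := x a, a := x b))" using xa by simp
      also have "x(b := x a, a := x b) = x \<circ> transpose a b"
        using a by (auto simp: comp_transpose_upd)
      also have "(\<Sum>v<N. \<Sum>w<N. T v w * (T ?u (x a) * f (x(b := w, a := v))))
          = T (x b) (x a) * contraction N T a b f x"
        by (simp add: contraction_def sum_distrib_left algebra_simps)
      finally show "(\<Sum>v<N. \<Sum>w<N. g v w a)
        = f (x \<circ> transpose a b) + T (x b) (x a) * contraction N T a b f x" .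
    qed
    finally show ?thesis
      by (simp add: sum.distrib algebra_simps eq_neg_iff_add_eq_0)
  qed
  then show ?thesis unfolding casimir_def by (simp add: sum_negf)
qed

text \<open>Contracting with an invariant form is equivariant. At the level of the Lie algebra the
  slots \<open>a\<close> and \<open>b\<close> contribute opposite values: one sums over the first
  index of \<open>T\<close>, the other over the second, and antisymmetry makes the difference a
  sign.\<close>

lemma contraction_invariant:
  assumes A: "finite A" and f: "infinitesimally_invariant N T A f"
    and ab: "a \<in> A" "b \<in> A" "a \<noteq> b"
  shows "infinitesimally_invariant N T (A - {a, b}) (contraction N T a b f)"
  unfolding infinitesimally_invariant_def
proof (intro ballI allI impI)
  fix x u v assume x: "x \<in> words N (A - {a, b})" and u: "u < N" and v: "v < N"
  define X where "X p q = x(b := q, a := p)" for p q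
  have Xw: "X p q \<in> words N A" if "p < N" "q < N" for p q
    using x that ab unfolding X_def words_def PiE_def Pi_def extensional_def by auto
  define g where "g c p q = T p q * (T v (X p q c) * f ((X p q)(c := u)) + T u (X p q c) * f ((X p q)(c := v)))" for c p q
  have "0 = (\<Sum>p<N. \<Sum>q<N. T p q * (\<Sum>c\<in>A. T v (X p q c) * f ((X p q)(c := u))
      + T u (X p q c) * f ((X p q)(c := v))))"
    using f Xw u v unfolding infinitesimally_invariant_def
    by (intro sum.neutral[symmetric] ballI) simp
  also have "\<dots> = (\<Sum>p<N. \<Sum>q<N. \<Sum>c\<in>A. g c p q)"
    by (simp add: g_def sum_distrib_left)
  also have "\<dots> = (\<Sum>c\<in>A. \<Sum>p<N. \<Sum>q<N. g c p q)"
    by (subst (2) sum.swap, subst sum.swap, rule refl)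
  also have "\<dots> = (\<Sum>p<N. \<Sum>q<N. g a p q) + (\<Sum>p<N. \<Sum>q<N. g b p q)
      + (\<Sum>c\<in>A - {a, b}. \<Sum>p<N. \<Sum>q<N. g c p q)"
  proof -
    have "A = insert a (insert b (A - {a, b}))" using ab by auto
    then have "(\<Sum>c\<in>A. h c) = h a + h b + (\<Sum>c\<in>A - {a, b}. h c)" for h :: "nat \<Rightarrow> 'k"
      using A ab by (metis (no_types, lifting) Diff_iff add.assoc finite_Diff finite_insert insertCI insertE sum.insert)
    then show ?thesis .
  qed
  also have "(\<Sum>p<N. \<Sum>q<N. g a p q) = - f (X u v) - f (X v u)"
  proof -
    have "(\<Sum>p<N. \<Sum>q<N. g a p q) = (\<Sum>q<N. (\<Sum>p<N. T p q * T v p) * f (X u q)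
        + (\<Sum>p<N. T p q * T u p) * f (X v q))"
      by (subst sum.swap) (simp add: g_def X_def sum.distrib sum_distrib_left algebra_simps)
    also have "\<dots> = (\<Sum>q<N. (if q = v then - f (X u q) else 0) + (if q = u then - f (X v q) else 0))"
      using u v by (intro sum.cong) (auto simp: T_ortho_left)
    finally show ?thesis using u v by (simp add: sum.distrib)
  qed
  also have "(\<Sum>p<N. \<Sum>q<N. g b p q) = f (X u v) + f (X v u)"
  proof -
    have "(\<Sum>p<N. \<Sum>q<N. g b p q) = (\<Sum>p<N. (\<Sum>q<N. T p q * T v q) * f (X p u)
        + (\<Sum>q<N. T p q * T u q) * f (X p v))"
      using ab by (simp add: g_def X_def sum.distrib sum_distrib_left algebra_simps fun_upd_twist)
    also have "\<dots> = (\<Sum>p<N. (if p = v then f (X p u) else 0) + (if p = u then f (X p v) else 0))"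
      using u v by (intro sum.cong) (auto simp: T_ortho)
    finally show ?thesis using u v by (simp add: sum.distrib)
  qed
  also have "(\<Sum>c\<in>A - {a, b}. \<Sum>p<N. \<Sum>q<N. g c p q)
    = (\<Sum>c\<in>A - {a, b}. T v (x c) * contraction N T a b f (x(c := u))
        + T u (x c) * contraction N T a b f (x(c := v)))"
  proof (rule sum.cong[OF refl])
    fix c assume c: "c \<in> A - {a, b}"
    have upd: "(X p q)(c := z) = x(c := z, b := q, a := p)" for p q z
      using c by (auto simp: X_def fun_upd_twist)
    have "X p q c = x c" for p q using c by (simp add: X_def)
    then show "(\<Sum>p<N. \<Sum>q<N. g c p q) = T v (x c) * contraction N T a b f (x(c := u))
        + T u (x c) * contraction N T a b f (x(c := v))"
      unfolding g_def contraction_def upd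
      by (simp add: sum.distrib sum_distrib_left algebra_simps)
  qed
  finally show "(\<Sum>c\<in>A - {a, b}. T v (x c) * contraction N T a b f (x(c := u))
        + T u (x c) * contraction N T a b f (x(c := v))) = 0" by simp
qed

text \<open>Contracting two slots gives an invariant tensor on fewer slots with coefficients still
  in \<open>U\<close>, to which the induction applies. Odd \<open>card A\<close> is included: there
  are no pairings then, \<open>s\<close> is 0, and the theorem says that \<open>t\<close> vanishes
  on \<open>words N A\<close>.\<close>

theorem invariant_in_form_span:
  fixes t :: "(nat \<Rightarrow> nat) \<Rightarrow> 'b \<Rightarrow> 'k"
  assumes "finite A"
    and zero: "(\<lambda>y. 0) \<in> U"
    and add: "\<And>c c'. c \<in> U \<Longrightarrow> c' \<in> U \<Longrightarrow> (\<lambda>y. c y + c' y) \<in> U"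
    and scale: "\<And>k c. c \<in> U \<Longrightarrow> (\<lambda>y. k * c y) \<in> U"
    and "\<And>x. x \<in> words N A \<Longrightarrow> t x \<in> U"
    and "\<And>y. infinitesimally_invariant N T A (\<lambda>x. t x y)"
  shows "\<exists>s. form_span T A U s \<and> (\<forall>x\<in>words N A. \<forall>y. t x y = s x y)"
  using assms(1) assms(5-)
proof (induction "card A" arbitrary: A t rule: less_induct)
  case less
  note A = \<open>finite A\<close>
  show ?case
  proof (cases "A = {}")
    case True
    define s where "s = (\<lambda>(x :: nat \<Rightarrow> nat) y. 1 * t (\<lambda>_. undefined) y + (0::'k))"
    have "form_span T A U s"
      unfolding s_def using less.prems(2) True
      by (intro form_span.add_gen form_span.zero) (auto intro: pairing_form.empty)
    then show ?thesis using True by (intro exI[of _ s]) (auto simp: s_def)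
  next
    case False
    have sumU: "(\<lambda>y. \<Sum>i\<in>I. c i y) \<in> U" if "\<And>i. i \<in> I \<Longrightarrow> c i \<in> U" for I and c :: "nat \<Rightarrow> 'b \<Rightarrow> 'k"
      using that by (induction I rule: infinite_finite_induct) (auto intro: zero add)
    have "\<exists>s. form_span T (A - {a, b}) U s
        \<and> (\<forall>x\<in>words N (A - {a, b}). \<forall>y. contraction N T a b (\<lambda>x. t x y) x = s x y)"
      if ab: "a \<in> A" "b \<in> A" "a \<noteq> b" for a b
    proof (rule less.hyps)
      show "card (A - {a, b}) < card A"
        using that A by (intro psubset_card_mono) auto
      show "finite (A - {a, b})" using A by simp
      show "infinitesimally_invariant N T (A - {a, b}) (\<lambda>x. contraction N T a b (\<lambda>x. t x y) x)" for y
        using contraction_invariant[OF A less.prems(3) ab] .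
      show "(\<lambda>y. contraction N T a b (\<lambda>x. t x y) x) \<in> U" if x: "x \<in> words N (A - {a, b})" for x
      proof -
        have "x(b := w, a := v) \<in> words N A" if "v < N" "w < N" for v w
          using x that ab unfolding words_def PiE_def Pi_def extensional_def by auto
        then show ?thesis unfolding contraction_def
          using less.prems(2) by (intro sumU scale) auto
      qed
    qed
    then obtain S where S: "\<And>a b. a \<in> A \<Longrightarrow> b \<in> A \<Longrightarrow> a \<noteq> b \<Longrightarrow> form_span T (A - {a, b}) U (S a b)"
      and SE: "\<And>a b x y. a \<in> A \<Longrightarrow> b \<in> A \<Longrightarrow> a \<noteq> b \<Longrightarrow> x \<in> words N (A - {a, b})
        \<Longrightarrow> contraction N T a b (\<lambda>x. t x y) x = S a b x y"
      by metis
    \<comment> \<open>The right-hand side of \<open>casimir_eq_contractions\<close>, with the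
      contractions replaced by their expressions from the induction. It lies in the span, so it is
      \<open>casimir\<close> of some \<open>s\<close> in the span, and injectivity identifies
      \<open>t\<close> with \<open>s\<close>.\<close>
    define s0 where "s0 x y = (-1) * (\<Sum>b\<in>A. \<Sum>a\<in>A - {b}. T (x b) (x a) * S a b x y)" for x y
    have "form_span T A U s0"
      unfolding s0_def
    proof (intro form_span_scale form_span_sum scale)
      fix b a assume ba: "b \<in> A" "a \<in> A - {b}"
      then have "insert b (insert a (A - {a, b})) = A" by auto
      then show "form_span T A U (\<lambda>x y. T (x b) (x a) * S a b x y)"
        using form_span_pair[OF S[of a b], of b a] ba by auto
    qed
    from casimir_solve_span[OF A False this scale] obtain s where
      s: "form_span T A U s" "\<And>x y. casimir N A (\<lambda>x. s x y) x = s0 x y" by blast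
    have "t x y = s x y" if x: "x \<in> words N A" for x y
    proof -
      have "casimir N A (\<lambda>x. t x y) x = s0 x y" if x: "x \<in> words N A" for x
      proof -
        have "contraction N T a b (\<lambda>x. t x y) x = S a b x y" if ab: "a \<in> A" "b \<in> A" "a \<noteq> b" for a b
        proof -
          \<comment> \<open>\<open>S\<close> is known on words over \<open>A - {a, b}\<close> only;
            a contraction overwrites the letters at \<open>a\<close> and \<open>b\<close>, so
            \<open>x\<close> may be restricted.\<close>
          let ?x = "restrict x (A - {a, b})"
          have 1: "?x \<in> words N (A - {a, b})" using x by (auto simp: words_def)
          have "?x(b := w, a := v) = x(b := w, a := v)" for v w
            using x ab by (auto simp: fun_eq_iff words_def PiE_def extensional_def)
          then have "contraction N T a b (\<lambda>x. t x y) x = contraction N T a b (\<lambda>x. t x y) ?x"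
            by (simp add: contraction_def)
          also have "\<dots> = S a b ?x y" using SE[OF ab 1] .
          also have "\<dots> = S a b x y" by (rule form_span_cong[OF S[OF ab]]) simp
          finally show ?thesis .
        qed
        then show ?thesis
          unfolding casimir_eq_contractions[OF A less.prems(3) x] s0_def
          by (auto intro!: sum.cong)
      qed
      then have "casimir N A (\<lambda>x. t x y - s x y) x = 0" if "x \<in> words N A" for x
        using s(2) that by (simp add: casimir_diff)
      from casimir_inj[OF A False this x] show ?thesis by simp
    qed
    with s(1) show ?thesis by blast
  qed
qed

end


section \<open>Matrix words and traces\<close>

text \<open>Extended by 0 as \<open>T_outside\<close> demands, since entries of a matrix outside its
  dimensions are unspecified.\<close>

definition sform :: "nat \<Rightarrow> nat \<Rightarrow> nat \<Rightarrow> 'k::field" where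
  "sform r i j = (if i < 2 * r \<and> j < 2 * r then symp_form r $$ (i, j) else 0)"

lemma symp_form_carrier [simp]: "(symp_form r :: 'k::field mat) \<in> carrier_mat (2 * r) (2 * r)"
  unfolding symp_form_def carrier_mat_def
  by (simp only: mem_Collect_eq dim_diag_block_mat map_replicate sum_list_replicate)
     (simp add: mat_of_rows_list_def)

lemma symp_form_Suc:
  "(symp_form (Suc r) :: 'k::field mat) =
    four_block_mat (mat_of_rows_list 2 [[0, 1], [-1, 0]]) (0\<^sub>m 2 (2 * r)) (0\<^sub>m (2 * r) 2) (symp_form r)"
proof -
  have d: "dim_row (mat_of_rows_list 2 [[0, 1], [-1, 0]] :: 'k mat) = 2"
    "dim_col (mat_of_rows_list 2 [[0, 1], [-1, 0]] :: 'k mat) = 2"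
    by (simp_all add: mat_of_rows_list_def)
  show ?thesis
    using carrier_matD[OF symp_form_carrier[of r, where 'k = 'k]]
    unfolding symp_form_def replicate_Suc diag_block_mat.simps Let_def d
    by (simp only:)
qed

lemma symp_form_index:
  "i < 2 * r \<Longrightarrow> j < 2 * r \<Longrightarrow> (symp_form r :: 'k::field mat) $$ (i, j) =
    (if even i \<and> j = Suc i then 1 else if odd i \<and> i = Suc j then - 1 else 0)"
proof (induction r arbitrary: i j)
  case (Suc r)
  define B :: "'k mat" where "B = mat_of_rows_list 2 [[0, 1], [-1, 0]]"
  have B: "dim_row B = 2" "dim_col B = 2" "B $$ (0, 0) = 0" "B $$ (0, 1) = 1" "B $$ (1, 0) = -1" "B $$ (1, 1) = 0"
    by (simp_all add: B_def mat_of_rows_list_def)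
  have d: "dim_row (symp_form r :: 'k mat) = 2 * r" "dim_col (symp_form r :: 'k mat) = 2 * r"
    using symp_form_carrier[of r, where 'k = 'k] by (auto simp del: symp_form_carrier)
  have e: "(symp_form (Suc r) :: 'k mat) $$ (i, j) = (if i < 2 then if j < 2 then B $$ (i, j) else 0
      else if j < 2 then 0 else symp_form r $$ (i - 2, j - 2))"
    unfolding symp_form_Suc B_def[symmetric] using Suc.prems
    by (subst index_mat_four_block) (auto simp: B d)
  consider "i < 2" | "i \<ge> 2" "j < 2" | i' j' where "i = i' + 2" "j = j' + 2"
    by (metis le_add_diff_inverse2 not_less)
  then show ?case
  proof cases
    case 1
    then have "i = 0 \<or> i = 1" by auto
    moreover have "j = 0 \<or> j = 1 \<or> j \<ge> 2" by auto
    ultimately show ?thesis unfolding e using B by (elim disjE) auto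
  next
    case 2
    then have "j = 0 \<or> j = 1" by auto
    with 2 show ?thesis unfolding e by auto
  next
    case 3
    then show ?thesis unfolding e using Suc.prems Suc.IH[of i' j'] by simp
  qed
qed simp

lemma sform_eq:
  "sform r i j = (if i < 2 * r \<and> j < 2 * r then
    (if even i \<and> j = Suc i then 1 else if odd i \<and> i = Suc j then - 1 else 0) else 0)"
  by (simp add: sform_def symp_form_index)

lemma symp_tensor_sform: "symp_tensor (2 * r) (sform r :: nat \<Rightarrow> nat \<Rightarrow> 'k::field_char_0)"
proof
  show "sform r i j = (0::'k)" if "\<not> (i < 2 * r \<and> j < 2 * r)" for i j
    using that by (auto simp: sform_def)
  show "sform r j i = - (sform r i j :: 'k)" for i j
    by (auto simp: sform_eq)
  fix u v assume u: "u < 2 * r" and v: "v < 2 * r"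
  \<comment> \<open>The partner of \<open>i\<close> in its 2 by 2 block, which is the column of the
    only nonzero entry in row \<open>i\<close>.\<close>
  define s where "s i = (if even i then Suc i else i - 1)" for i :: nat
  have s_less: "s u < 2 * r" using u by (auto simp: s_def elim!: evenE)
  have sform_s: "(sform r i j :: 'k) = (if j = s i then (if even i then 1 else -1) else 0)"
    if "i < 2 * r" "j < 2 * r" for i j
    using that by (auto simp: sform_eq s_def)
  have s_inj: "s u = s v \<longleftrightarrow> u = v" 
    by (auto simp: s_def split: if_splits) (metis Suc_pred even_Suc odd_pos)+
  have "(\<Sum>w<2 * r. sform r u w * (sform r v w :: 'k))
      = (\<Sum>w<2 * r. if w = s u then (if even u then 1 else -1) * sform r v w else 0)"
    using u by (intro sum.cong) (auto simp: sform_s)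
  also have "\<dots> = (if even u then 1 else -1) * sform r v (s u)"
    using s_less by simp
  also have "\<dots> = of_bool (u = v)"
    using s_inj v s_less by (auto simp: sform_s)
  finally show "(\<Sum>w<2 * r. sform r u w * (sform r v w :: 'k)) = of_bool (u = v)" .
qed

lemma sform_antisym: "sform r i j = - (sform r j i :: 'k::field_char_0)"
  using symp_tensor.T_antisym[OF symp_tensor_sform, of r i j] by simp

section \<open>Words in the matrices as bilinear forms\<close>

definition bform :: "nat \<Rightarrow> nat \<times> nat \<Rightarrow> (nat \<Rightarrow> 'k::field mat) \<Rightarrow> nat \<Rightarrow> nat \<Rightarrow> 'k" where
  "bform p nm M u v =
    (\<Sum>x<2 * p. \<Sum>z<2 * p. M (fst nm) $$ (x, u) * sform p x z * M (snd nm) $$ (z, v))"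

text \<open>\<open>bform\<close> gives the entries of M_n^t T_p M_m, which is
  \<open>pair_mat\<close> before its last factor, and \<open>form_prod\<close> gives those of F T_q
  G. Entries are kept as functions so that contracting two slots with \<open>sform q\<close> is
  literally such a sum.\<close>

definition form_prod :: "nat \<Rightarrow> (nat \<Rightarrow> nat \<Rightarrow> 'k) \<Rightarrow> (nat \<Rightarrow> nat \<Rightarrow> 'k) \<Rightarrow> nat \<Rightarrow> nat \<Rightarrow> 'k::field" where
  "form_prod q F G u v = (\<Sum>s<2 * q. \<Sum>t<2 * q. F u s * sform q s t * G t v)"

lemma form_prod_assoc: "form_prod q (form_prod q F G) H = form_prod q F (form_prod q G H)"
proof (intro ext)
  fix u v
  have "form_prod q (form_prod q F G) H u v = (\<Sum>s<2 * q. \<Sum>t<2 * q. \<Sum>s'<2 * q. \<Sum>t'<2 * q.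
      F u s' * sform q s' t' * G t' s * sform q s t * H t v)"
    unfolding form_prod_def by (simp add: sum_distrib_right)
  also have "\<dots> = (\<Sum>s<2 * q. \<Sum>s'<2 * q. \<Sum>t'<2 * q. \<Sum>t<2 * q.
      F u s' * sform q s' t' * G t' s * sform q s t * H t v)"
    by (rule sum.cong[OF refl], subst sum.swap, rule sum.cong[OF refl], subst sum.swap, rule refl)
  also have "\<dots> = (\<Sum>s'<2 * q. \<Sum>t'<2 * q. \<Sum>s<2 * q. \<Sum>t<2 * q.
      F u s' * sform q s' t' * G t' s * sform q s t * H t v)"
    by (subst sum.swap, rule sum.cong[OF refl], subst sum.swap, rule refl)
  also have "\<dots> = form_prod q F (form_prod q G H) u v"
    unfolding form_prod_def by (simp add: sum_distrib_left mult.assoc)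
  finally show "form_prod q (form_prod q F G) H u v = form_prod q F (form_prod q G H) u v" .
qed

text \<open>For a nonempty word this is the matrix that becomes a product of the \<open>pair_mat\<close>s
  after multiplication by \<open>symp_form q\<close>.\<close>

fun wform :: "nat \<Rightarrow> nat \<Rightarrow> (nat \<times> nat) list \<Rightarrow> (nat \<Rightarrow> 'k::field mat) \<Rightarrow> nat \<Rightarrow> nat \<Rightarrow> 'k" where
  "wform p q [] M = (\<lambda>u v. 0)"
| "wform p q [x] M = bform p x M"
| "wform p q (x # y # w) M = form_prod q (bform p x M) (wform p q (y # w) M)"

lemma wform_Cons: "w \<noteq> [] \<Longrightarrow> wform p q (x # w) M = form_prod q (bform p x M) (wform p q w M)"
  by (cases w) auto

lemma wform_append:
  "w \<noteq> [] \<Longrightarrow> w' \<noteq> [] \<Longrightarrow> wform p q (w @ w') M = form_prod q (wform p q w M) (wform p q w' M)"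
proof (induction w)
  case (Cons x w)
  then show ?case
    by (cases "w = []") (simp_all add: wform_Cons form_prod_assoc)
qed simp

lemma bform_swap:
  "bform p (prod.swap x) M v u = - (bform p x M u v :: 'k::field_char_0)"
proof -
  have "bform p (prod.swap x) M v u
      = (\<Sum>z<2 * p. \<Sum>x'<2 * p. M (snd x) $$ (x', v) * sform p x' z * M (fst x) $$ (z, u))"
    unfolding bform_def by (subst sum.swap) simp
  also have "\<dots> = (\<Sum>z<2 * p. \<Sum>x'<2 * p. - (M (fst x) $$ (z, u) * sform p z x' * M (snd x) $$ (x', v)))"
    by (intro sum.cong refl) (subst sform_antisym, simp)
  finally show ?thesis by (simp add: bform_def sum_negf)
qed

lemma form_prod_swap:
  fixes F G :: "nat \<Rightarrow> nat \<Rightarrow> 'k::field_char_0"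
  shows "form_prod q F G u v = - form_prod q (\<lambda>a b. G b a) (\<lambda>a b. F b a) v u"
proof -
  have "form_prod q F G u v = (\<Sum>t<2 * q. \<Sum>s<2 * q. F u s * sform q s t * G t v)"
    unfolding form_prod_def by (rule sum.swap)
  also have "\<dots> = (\<Sum>t<2 * q. \<Sum>s<2 * q. - (G t v * sform q t s * F u s))"
    by (intro sum.cong refl) (subst sform_antisym, simp)
  finally show ?thesis by (simp add: form_prod_def sum_negf)
qed

text \<open>Reversing a word and swapping its letters transposes its matrix. A word of length l
  contains l factors T_p and l - 1 factors T_q, an odd number in all, and each of them changes sign
  under transposition.\<close>

lemma wform_swap:
  "wform p q (rev (map prod.swap w)) M v u = - (wform p q w M u v :: 'k::field_char_0)"
proof (induction w arbitrary: u v)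
  case (Cons x w)
  show ?case
  proof (cases "w = []")
    case True
    then show ?thesis by (simp add: bform_swap)
  next
    case False
    then have "wform p q (rev (map prod.swap (x # w))) M v u
      = form_prod q (wform p q (rev (map prod.swap w)) M) (bform p (prod.swap x) M) v u"
      by (simp add: wform_append)
    also have "\<dots> = form_prod q (\<lambda>a b. wform p q w M b a) (\<lambda>a b. bform p x M b a) v u"
      unfolding form_prod_def Cons.IH bform_swap by simp
    also have "\<dots> = - form_prod q (bform p x M) (wform p q w M) u v"
      using form_prod_swap[of q "bform p x M" "wform p q w M" u v] by simp
    finally show ?thesis using False by (simp add: wform_Cons)
  qed
qed simp

lemma mat_tuples_carrier [simp]: "M \<in> mat_tuples m n d \<Longrightarrow> i \<in> {1..d} \<Longrightarrow> M i \<in> carrier_mat m n"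
  by (auto simp: mat_tuples_def)

lemma mult_mat_index:
  assumes "A \<in> carrier_mat k m" "B \<in> carrier_mat m n" "i < k" "j < n"
  shows "(A * B) $$ (i, j) = (\<Sum>l<m. A $$ (i, l) * B $$ (l, j))"
  using assms by (auto simp: scalar_prod_def atLeast0LessThan intro!: sum.cong)

lemma symp_form_sform: "i < 2 * r \<Longrightarrow> j < 2 * r \<Longrightarrow> symp_form r $$ (i, j) = sform r i j"
  by (simp add: sform_def)

lemma pair_mat_carrier:
  assumes "M \<in> mat_tuples (2 * p) (2 * q) d" "n \<in> {1..d}" "m \<in> {1..d}"
  shows "pair_mat p q M n m \<in> carrier_mat (2 * q) (2 * q)"
proof -
  have "M n \<in> carrier_mat (2 * p) (2 * q)" "M m \<in> carrier_mat (2 * p) (2 * q)"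
    using assms by auto
  then show ?thesis unfolding pair_mat_def
    by (intro mult_carrier_mat[OF mult_carrier_mat[OF mult_carrier_mat[OF _ symp_form_carrier]] symp_form_carrier])
       auto
qed

lemma pair_mat_index:
  assumes M: "M \<in> mat_tuples (2 * p) (2 * q) d" "n \<in> {1..d}" "m \<in> {1..d}"
    and ij: "i < 2 * q" "j < 2 * q"
  shows "pair_mat p q M n m $$ (i, j) = (\<Sum>s<2 * q. bform p (n, m) M i s * sform q s j)"
proof -
  have c: "M n \<in> carrier_mat (2 * p) (2 * q)" "M m \<in> carrier_mat (2 * p) (2 * q)"
    using M by auto
  have 1: "transpose_mat (M n) \<in> carrier_mat (2 * q) (2 * p)" using c by simp
  have 2: "transpose_mat (M n) * symp_form p \<in> carrier_mat (2 * q) (2 * p)"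
    using 1 symp_form_carrier by (rule mult_carrier_mat)
  have 3: "transpose_mat (M n) * symp_form p * M m \<in> carrier_mat (2 * q) (2 * q)"
    using 2 c(2) by (rule mult_carrier_mat)
  have "(transpose_mat (M n) * symp_form p * M m) $$ (i, s) = bform p (n, m) M i s" if s: "s < 2 * q" for s
  proof -
    have "(transpose_mat (M n) * symp_form p * M m) $$ (i, s)
      = (\<Sum>z<2 * p. (\<Sum>x<2 * p. M n $$ (x, i) * sform p x z) * M m $$ (z, s))"
      using ij c s
      by (subst mult_mat_index[OF 2 c(2)])
         (auto simp: mult_mat_index[OF 1 symp_form_carrier] symp_form_sform intro!: sum.cong)
    also have "\<dots> = bform p (n, m) M i s"
      unfolding bform_def by (subst sum.swap) (simp add: sum_distrib_right)
    finally show ?thesis .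
  qed
  then show ?thesis
    unfolding pair_mat_def using ij
    by (subst mult_mat_index[OF 3 symp_form_carrier]) (auto simp: symp_form_sform intro!: sum.cong)
qed

text \<open>The last factor T_q, which \<open>wform\<close> leaves out, closes the word into a
  cycle. The word has to be nonempty: the empty product has trace 2q, whereas \<open>wform\<close>
  of the empty word is 0.\<close>

lemma trace_function_eq:
  assumes M: "M \<in> mat_tuples (2 * p) (2 * q) d" and w: "w \<noteq> []" "set w \<subseteq> {1..d} \<times> {1..d}"
  shows "trace_function p q w M = (\<Sum>u<2 * q. \<Sum>v<2 * q. wform p q w M u v * sform q v u)"
proof -
  define P where "P w = foldr (\<lambda>(n, m) P. pair_mat p q M n m * P) w (1\<^sub>m (2 * q))" for w
  have P: "P w \<in> carrier_mat (2 * q) (2 * q)" if "set w \<subseteq> {1..d} \<times> {1..d}" for w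
    using that by (induction w) (auto simp: P_def intro!: mult_carrier_mat pair_mat_carrier[OF M])
  have "P w $$ (i, j) = (\<Sum>s<2 * q. wform p q w M i s * sform q s j)" if "i < 2 * q" "j < 2 * q" for i j
    using w that
  proof (induction w arbitrary: i)
    case (Cons x w)
    obtain n m where x: "x = (n, m)" by force
    have nm: "n \<in> {1..d}" "m \<in> {1..d}" and sw: "set w \<subseteq> {1..d} \<times> {1..d}"
      using Cons.prems x by auto
    note pc = pair_mat_carrier[OF M nm]
    have PC: "P (x # w) = pair_mat p q M n m * P w" by (simp add: P_def x)
    show ?case
    proof (cases "w = []")
      case True
      have "P [] = 1\<^sub>m (2 * q)" by (simp add: P_def)
      then have "P (x # w) = pair_mat p q M n m" using pc PC True by simp
      then show ?thesis using Cons.prems pair_mat_index[OF M nm] by (simp add: True x)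
    next
      case False
      have "P (x # w) $$ (i, j) = (\<Sum>t<2 * q. (\<Sum>s<2 * q. bform p x M i s * sform q s t)
          * (\<Sum>r<2 * q. wform p q w M t r * sform q r j))"
        unfolding PC using Cons.prems Cons.IH[OF False sw]
        by (subst mult_mat_index[OF pc P[OF sw]]) (auto simp: pair_mat_index[OF M nm] x intro!: sum.cong)
      also have "\<dots> = (\<Sum>t<2 * q. \<Sum>r<2 * q. \<Sum>s<2 * q. bform p x M i s * sform q s t * wform p q w M t r * sform q r j)"
        by (simp add: sum_product sum_distrib_left sum_distrib_right mult.assoc)
      also have "\<dots> = (\<Sum>r<2 * q. \<Sum>s<2 * q. \<Sum>t<2 * q. bform p x M i s * sform q s t * wform p q w M t r * sform q r j)"
        by (subst sum.swap, rule sum.cong[OF refl], rule sum.swap)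
      also have "\<dots> = (\<Sum>r<2 * q. wform p q (x # w) M i r * sform q r j)"
        unfolding wform_Cons[OF False] form_prod_def by (simp add: sum_distrib_right)
      finally show ?thesis .
    qed
  qed simp
  moreover have "trace_function p q w M = (\<Sum>u<2 * q. P w $$ (u, u))"
    using P[OF w(2)] unfolding trace_function_def mat_trace_def P_def[symmetric] diag_mat_def
    by (simp add: interv_sum_list_conv_sum_set_nat atLeast0LessThan)
  ultimately show ?thesis by simp
qed

section \<open>Polynomials in the traces, and contraction of words\<close>

text \<open>Functions whose restrictions to \<open>X\<close> lie in the generated algebra.\<close>

definition algebra_on :: "'x set \<Rightarrow> ('x \<Rightarrow> 'k::field) set \<Rightarrow> ('x \<Rightarrow> 'k) set" where
  "algebra_on X S = {g. restrict g X \<in> generated_algebra X S}"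

lemma algebra_on_cong:
  assumes "g \<in> algebra_on X S" "\<And>M. M \<in> X \<Longrightarrow> g M = h M"
  shows "h \<in> algebra_on X S"
proof -
  have "restrict h X = restrict g X"
    using assms(2) by (auto simp: fun_eq_iff restrict_def)
  then show ?thesis using assms(1) by (simp add: algebra_on_def)
qed

lemma algebra_on_generator: "g \<in> S \<Longrightarrow> g \<in> algebra_on X S"
  by (simp add: algebra_on_def generated_algebra.generator)

lemma algebra_on_const: "(\<lambda>M. c) \<in> algebra_on X S"
  by (simp add: algebra_on_def generated_algebra.const)

lemma algebra_on_add:
  assumes "g \<in> algebra_on X S" "h \<in> algebra_on X S"
  shows "(\<lambda>M. g M + h M) \<in> algebra_on X S"
proof -
  have "(\<lambda>M\<in>X. g M + h M) = (\<lambda>M\<in>X. restrict g X M + restrict h X M)"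
    by (auto simp: fun_eq_iff)
  then show ?thesis using assms generated_algebra.add unfolding algebra_on_def by fastforce
qed

lemma algebra_on_mult:
  assumes "g \<in> algebra_on X S" "h \<in> algebra_on X S"
  shows "(\<lambda>M. g M * h M) \<in> algebra_on X S"
proof -
  have "(\<lambda>M\<in>X. g M * h M) = (\<lambda>M\<in>X. restrict g X M * restrict h X M)"
    by (auto simp: fun_eq_iff)
  then show ?thesis using assms generated_algebra.mult unfolding algebra_on_def by fastforce
qed

lemma algebra_on_sum:
  "(\<And>i. i \<in> I \<Longrightarrow> g i \<in> algebra_on X S) \<Longrightarrow> (\<lambda>M. \<Sum>i\<in>I. g i M) \<in> algebra_on X S"
  by (induction I rule: infinite_finite_induct)
     (auto intro: algebra_on_const algebra_on_add)

abbreviation trace_algebra :: "nat \<Rightarrow> nat \<Rightarrow> nat \<Rightarrow> ((nat \<Rightarrow> 'k::field mat) \<Rightarrow> 'k) set" where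
  "trace_algebra p q d \<equiv> algebra_on (mat_tuples (2 * p) (2 * q) d)
     {trace_function p q w | w. w \<noteq> [] \<and> set w \<subseteq> {1..d} \<times> {1..d}}"

lemma trace_function_in_trace_algebra:
  "w \<noteq> [] \<Longrightarrow> set w \<subseteq> {1..d} \<times> {1..d} \<Longrightarrow> trace_function p q w \<in> trace_algebra p q d"
  by (rule algebra_on_generator) blast

lemma wform_trace_in_trace_algebra:
  assumes "w \<noteq> []" "set w \<subseteq> {1..d} \<times> {1..d}"
  shows "(\<lambda>M. \<Sum>s<2 * q. \<Sum>t<2 * q. sform q s t * wform p q w M s t)
    \<in> (trace_algebra p q d :: ((nat \<Rightarrow> 'k::field_char_0 mat) \<Rightarrow> 'k) set)"
proof (rule algebra_on_cong)
  \<comment> \<open>Here \<open>sform q\<close> is taken at \<open>(s, t)\<close>, in the trace at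
    the reversed pair; antisymmetry accounts for the sign.\<close>
  show "(\<lambda>M. (- 1) * trace_function p q w M) \<in>
      (trace_algebra p q d :: ((nat \<Rightarrow> 'k::field_char_0 mat) \<Rightarrow> 'k) set)"
    using assms by (intro algebra_on_mult algebra_on_const trace_function_in_trace_algebra)
  fix M :: "nat \<Rightarrow> 'k mat" assume M: "M \<in> mat_tuples (2 * p) (2 * q) d"
  have "wform p q w M u v * sform q v u = - (sform q u v * wform p q w M u v)" for u v
    using sform_antisym[of q v u, where 'k = 'k] by simp
  then show "(- 1) * trace_function p q w M = (\<Sum>s<2 * q. \<Sum>t<2 * q. sform q s t * wform p q w M s t)"
    by (simp add: trace_function_eq[OF M assms] sum_negf)
qed

text \<open>Products of a trace polynomial and of one matrix entry for each pair of a perfect matching of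
  the slots; contracting two slots either merges two pairs or closes a cycle into a trace.\<close>

inductive word_form :: "nat \<Rightarrow> nat \<Rightarrow> nat \<Rightarrow> nat set
    \<Rightarrow> ((nat \<Rightarrow> 'k::field mat) \<Rightarrow> (nat \<Rightarrow> nat) \<Rightarrow> 'k) \<Rightarrow> bool" for p q d where
  empty: "g \<in> trace_algebra p q d \<Longrightarrow> word_form p q d {} (\<lambda>M y. g M)"
| pair: "word_form p q d A F \<Longrightarrow> a \<notin> A \<Longrightarrow> b \<notin> A \<Longrightarrow> a \<noteq> b \<Longrightarrow> w \<noteq> []
    \<Longrightarrow> set w \<subseteq> {1..d} \<times> {1..d}
    \<Longrightarrow> word_form p q d (insert a (insert b A)) (\<lambda>M y. wform p q w M (y a) (y b) * F M y)"

lemma word_form_cong: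
  "word_form p q d A F \<Longrightarrow> (\<And>a. a \<in> A \<Longrightarrow> y a = y' a) \<Longrightarrow> F M y = F M y'"
  by (induction rule: word_form.induct) auto

lemma word_form_scale:
  "word_form p q d A F \<Longrightarrow> g \<in> trace_algebra p q d \<Longrightarrow> word_form p q d A (\<lambda>M y. g M * F M y)"
proof (induction rule: word_form.induct)
  case (empty h)
  from word_form.empty[OF algebra_on_mult[OF empty(2,1)]] show ?case .
next
  case (pair A F a b w)
  from word_form.pair[OF pair.IH[OF pair.prems] pair.hyps(2-6)] show ?case
    by (simp add: mult.left_commute)
qed

text \<open>Orients the pair of \<open>c\<close> so that \<open>c\<close> is its first end. If
  \<open>c\<close> is the second end, the word is reversed, and the sign from
  \<open>wform_swap\<close> goes into the remaining factor.\<close>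

lemma word_form_extract:
  assumes "word_form p q d A F" "c \<in> A"
  shows "\<exists>a w F'. a \<in> A \<and> a \<noteq> c \<and> w \<noteq> [] \<and> set w \<subseteq> {1..d} \<times> {1..d}
    \<and> word_form p q d (A - {a, c}) F'
    \<and> F = (\<lambda>M y. wform p q w M (y c) (y a) * F' M y :: 'k::field_char_0)"
  using assms
proof (induction rule: word_form.induct)
  case (pair A F a b w)
  consider "c = a" | "c = b" | "c \<in> A" using pair.prems by auto
  then show ?case
  proof cases
    case 1
    have "insert a (insert b A) - {b, c} = A" using 1 pair.hyps by auto
    then show ?thesis using pair.hyps 1
      by (intro exI[of _ b] exI[of _ w] exI[of _ F]) simp
  next
    case 2
    let ?w = "rev (map prod.swap w)"
    have "insert a (insert b A) - {a, c} = A" using 2 pair.hyps by auto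
    moreover have "word_form p q d A (\<lambda>M y. (- 1) * F M y)"
      using pair.hyps(1) algebra_on_const by (rule word_form_scale)
    moreover have "set ?w \<subseteq> {1..d} \<times> {1..d}" using pair.hyps(6) by auto
    ultimately show ?thesis using pair.hyps 2
      by (intro exI[of _ a] exI[of _ ?w] exI[of _ "\<lambda>M y. (- 1) * F M y"]) (simp add: wform_swap)
  next
    case 3
    from pair.IH[OF 3] obtain a' w' F' where IH: "a' \<in> A" "a' \<noteq> c" "w' \<noteq> []"
      "set w' \<subseteq> {1..d} \<times> {1..d}" "word_form p q d (A - {a', c}) F'"
      "F = (\<lambda>M y. wform p q w' M (y c) (y a') * F' M y)" by blast
    have "word_form p q d (insert a (insert b (A - {a', c}))) (\<lambda>M y. wform p q w M (y a) (y b) * F' M y)"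
      using pair.hyps by (intro word_form.pair IH) auto
    moreover have "insert a (insert b (A - {a', c})) = insert a (insert b A) - {a', c}"
      using pair.hyps IH 3 by auto
    ultimately show ?thesis using IH
      by (intro exI[of _ a'] exI[of _ w'] exI[of _ "\<lambda>M y. wform p q w M (y a) (y b) * F' M y"])
         (simp add: mult.left_commute)
  qed
qed simp

lemma word_form_contract:
  fixes F :: "(nat \<Rightarrow> 'k::field_char_0 mat) \<Rightarrow> (nat \<Rightarrow> nat) \<Rightarrow> 'k"
  assumes F: "word_form p q d A F" and c: "c \<in> A" and e: "e \<in> A" and ce: "c \<noteq> e"
  shows "word_form p q d (A - {c, e})
    (\<lambda>M y. \<Sum>s<2 * q. \<Sum>t<2 * q. sform q s t * F M (y(c := s, e := t)))"
proof -
  from word_form_extract[OF F c] obtain a w F' where F': "a \<in> A" "a \<noteq> c" "w \<noteq> []"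
    "set w \<subseteq> {1..d} \<times> {1..d}" "word_form p q d (A - {a, c}) F'"
    "F = (\<lambda>M y. wform p q w M (y c) (y a) * F' M y)" by blast
  show ?thesis
  proof (cases "a = e")
    case True
    have "F' M (y(c := s, e := t)) = F' M y" for M y s t
      by (rule word_form_cong[OF F'(5)]) (simp add: True)
    then have "(\<lambda>M y. \<Sum>s<2 * q. \<Sum>t<2 * q. sform q s t * F M (y(c := s, e := t)))
      = (\<lambda>M y. (\<Sum>s<2 * q. \<Sum>t<2 * q. sform q s t * wform p q w M s t) * F' M y)"
      using ce True by (intro ext) (simp add: F'(6) sum_distrib_right mult.assoc)
    moreover have "A - {c, e} = A - {a, c}" using True by auto
    ultimately show ?thesis
      using word_form_scale[OF F'(5) wform_trace_in_trace_algebra[OF F'(3,4)]] by simp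
  next
    case False
    with e ce have e': "e \<in> A - {a, c}" by simp
    from word_form_extract[OF F'(5) e'] obtain b w' F'' where F'': "b \<in> A - {a, c}" "b \<noteq> e" "w' \<noteq> []"
      "set w' \<subseteq> {1..d} \<times> {1..d}" "word_form p q d (A - {a, c} - {b, e}) F''"
      "F' = (\<lambda>M y. wform p q w' M (y e) (y b) * F'' M y)" by blast
    \<comment> \<open>The words of \<open>c\<close> and \<open>e\<close> both start at a contracted
      slot. Reversing the first makes it end at \<open>c\<close>, where \<open>sform q\<close> joins
      it to the second; the factor -1 undoes the sign of the reversal.\<close>
    let ?w = "rev (map prod.swap w)"
    define G where "G = (\<lambda>M y. wform p q (?w @ w') M (y a) (y b) * ((- 1) * F'' M y))"
    have "word_form p q d (insert a (insert b (A - {a, c} - {b, e}))) G"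
      unfolding G_def using F'(1-4) F''(1-4)
      by (intro word_form.pair word_form_scale[OF F''(5)] algebra_on_const) auto
    moreover have "insert a (insert b (A - {a, c} - {b, e})) = A - {c, e}"
      using F'(1,2) F''(1,2) False by auto
    moreover have "G = (\<lambda>M y. \<Sum>s<2 * q. \<Sum>t<2 * q. sform q s t * F M (y(c := s, e := t)))"
    proof (intro ext)
      fix M y
      have 1: "F'' M (y(c := s, e := t)) = F'' M y" for s t
        by (rule word_form_cong[OF F''(5)]) simp
      have 2: "F M (y(c := s, e := t)) = wform p q w M s (y a) * (wform p q w' M t (y b) * F'' M y)" for s t
        using F'(1,2) F''(1,2) False ce by (simp add: F'(6) F''(6) 1)
      have "G M y = (\<Sum>s<2 * q. \<Sum>t<2 * q. wform p q ?w M (y a) s * sform q s t * wform p q w' M t (y b)) * ((- 1) * F'' M y)"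
        unfolding G_def using F'(3) F''(3) by (simp add: wform_append form_prod_def)
      also have "\<dots> = (\<Sum>s<2 * q. \<Sum>t<2 * q. sform q s t * F M (y(c := s, e := t)))"
        unfolding wform_swap 2 sum_distrib_right by (intro sum.cong refl) simp
      finally show "G M y = (\<Sum>s<2 * q. \<Sum>t<2 * q. sform q s t * F M (y(c := s, e := t)))" .
    qed
    ultimately show ?thesis by simp
  qed
qed

section \<open>Summation against the two matchings\<close>

lemma sum_words_insert:
  fixes h :: "(nat \<Rightarrow> nat) \<Rightarrow> 'k::comm_monoid_add"
  assumes "finite A" "a \<notin> A"
  shows "(\<Sum>y\<in>words N (insert a A). h y) = (\<Sum>y\<in>words N A. \<Sum>s<N. h (y(a := s)))"
proof -
  have "words N (insert a A) = (\<lambda>(s, y). y(a := s)) ` ({..<N} \<times> words N A)"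
    by (simp add: words_def PiE_insert_eq)
  moreover have "inj_on (\<lambda>(s, y). y(a := s)) ({..<N} \<times> words N A)"
    unfolding words_def using inj_combinator[OF assms(2), of "\<lambda>_. {..<N}"] by (simp add: inj_on_def)
  ultimately have "(\<Sum>y\<in>words N (insert a A). h y) = (\<Sum>(s, y)\<in>{..<N} \<times> words N A. h (y(a := s)))"
    by (simp add: sum.reindex case_prod_unfold)
  then show ?thesis
    by (subst sum.swap) (simp add: sum.cartesian_product)
qed

lemma sum_words_insert2:
  assumes "finite A" "a \<notin> A" "b \<notin> A" "a \<noteq> b"
  shows "(\<Sum>y\<in>words N (insert a (insert b A)). h y)
    = (\<Sum>y\<in>words N A. \<Sum>s<N. \<Sum>t<N. h (y(a := s, b := t)))"
proof -
  have "(\<Sum>y\<in>words N (insert b (insert a A)). h y)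
    = (\<Sum>y\<in>words N A. \<Sum>s<N. \<Sum>t<N. h (y(a := s, b := t)))"
    using assms by (simp add: sum_words_insert)
  then show ?thesis by (simp add: insert_commute)
qed

lemma pairing_form_finite: "pairing_form T A w \<Longrightarrow> finite A"
  by (induction rule: pairing_form.induct) auto

text \<open>Each pair of the matching contracts two slots of the word form; once all slots are used
  up, an element of the trace algebra is left.\<close>

lemma sum_pairing_word_form:
  fixes F :: "(nat \<Rightarrow> 'k::field_char_0 mat) \<Rightarrow> (nat \<Rightarrow> nat) \<Rightarrow> 'k"
  assumes "pairing_form (sform q) A w" "word_form p q d A F"
  shows "(\<lambda>M. \<Sum>y\<in>words (2 * q) A. w y * F M y) \<in> trace_algebra p q d"
  using assms
proof (induction arbitrary: F rule: pairing_form.induct)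
  case empty
  from empty show ?case by cases (simp_all add: insert_not_empty)
next
  case (pair A w a b)
  let ?F = "\<lambda>M y. \<Sum>s<2 * q. \<Sum>t<2 * q. sform q s t * F M (y(a := s, b := t))"
  have "insert a (insert b A) - {a, b} = A" using pair.hyps by auto
  moreover have "word_form p q d (insert a (insert b A) - {a, b}) ?F"
    by (rule word_form_contract[OF pair.prems]) (use pair.hyps in auto)
  ultimately have "word_form p q d A ?F" by (simp only:)
  from pair.IH[OF this] show ?case
  proof (rule algebra_on_cong)
    fix M
    have "w (y(a := s, b := t)) = w y" for y s t
      using pair.hyps by (intro pairing_form_cong[OF pair.hyps(1)]) auto
    then show "(\<Sum>y\<in>words (2 * q) A. w y * ?F M y)
      = (\<Sum>y\<in>words (2 * q) (insert a (insert b A)). sform q (y a) (y b) * w y * F M y)"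
      using pair.hyps pairing_form_finite[OF pair.hyps(1)]
      by (simp add: sum_words_insert2 sum_distrib_left mult_ac)
  qed
qed

text \<open>Summing over the V-letters of a pair \<open>a\<close>, \<open>b\<close> turns two matrix
  entries into the one-letter word \<open>(i a, i b)\<close> between the W-slots \<open>a\<close>
  and \<open>b\<close>. The matching of the V-slots thus becomes a word form in the W-slots.\<close>

lemma sum_pairing_entries:
  fixes w :: "(nat \<Rightarrow> nat) \<Rightarrow> 'k::field_char_0"
  assumes "pairing_form (sform p) A w" "i ` A \<subseteq> {1..d}"
  shows "word_form p q d A (\<lambda>M y. \<Sum>x\<in>words (2 * p) A. w x * (\<Prod>k\<in>A. M (i k) $$ (x k, y k)))"
  using assms
proof (induction rule: pairing_form.induct)
  case empty
  show ?case using word_form.empty[OF algebra_on_const] by simp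
next
  case (pair A w a b)
  note fin = pairing_form_finite[OF pair.hyps(1)]
  let ?G = "\<lambda>M y. \<Sum>x\<in>words (2 * p) A. w x * (\<Prod>k\<in>A. M (i k) $$ (x k, y k))"
  have "word_form p q d (insert a (insert b A)) (\<lambda>M y. wform p q [(i a, i b)] M (y a) (y b) * ?G M y)"
    using pair by (intro word_form.pair) auto
  moreover have "(\<lambda>M y. wform p q [(i a, i b)] M (y a) (y b) * ?G M y)
    = (\<lambda>M y. \<Sum>x\<in>words (2 * p) (insert a (insert b A)). sform p (x a) (x b) * w x
        * (\<Prod>k\<in>insert a (insert b A). M (i k) $$ (x k, y k)))"
  proof (intro ext)
    fix M :: "nat \<Rightarrow> 'k mat" and y
    have 1: "w (x(a := s, b := t)) = w x" for x s t
      using pair.hyps by (intro pairing_form_cong[OF pair.hyps(1)]) auto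
    have 2: "(\<Prod>k\<in>A. M (i k) $$ ((x(a := s, b := t)) k, y k)) = (\<Prod>k\<in>A. M (i k) $$ (x k, y k))" for x s t
      using pair.hyps by (intro prod.cong) auto
    have "(\<Sum>x\<in>words (2 * p) (insert a (insert b A)). sform p (x a) (x b) * w x
        * (\<Prod>k\<in>insert a (insert b A). M (i k) $$ (x k, y k)))
      = (\<Sum>x\<in>words (2 * p) A. \<Sum>s<2 * p. \<Sum>t<2 * p.
         (M (i a) $$ (s, y a) * sform p s t * M (i b) $$ (t, y b)) * (w x * (\<Prod>k\<in>A. M (i k) $$ (x k, y k))))"
      using pair.hyps fin
      by (simp add: sum_words_insert2 1 2 del: fun_upd_apply) (simp add: mult_ac)
    also have "\<dots> = wform p q [(i a, i b)] M (y a) (y b) * ?G M y"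
      by (simp add: bform_def sum_distrib_left sum_distrib_right)
    finally show "wform p q [(i a, i b)] M (y a) (y b) * ?G M y
      = (\<Sum>x\<in>words (2 * p) (insert a (insert b A)). sform p (x a) (x b) * w x
        * (\<Prod>k\<in>insert a (insert b A). M (i k) $$ (x k, y k)))" by simp
  qed
  ultimately show ?case by simp
qed


section \<open>From invariant tensors to traces\<close>

lemma infinitesimally_invariant_zero: "infinitesimally_invariant N T A (\<lambda>x. 0)"
  by (simp add: infinitesimally_invariant_def)

lemma infinitesimally_invariant_add:
  assumes "infinitesimally_invariant N T A f" "infinitesimally_invariant N T A g"
  shows "infinitesimally_invariant N T A (\<lambda>x. f x + g x)"
  unfolding infinitesimally_invariant_def
proof (intro ballI allI impI)
  fix x u v assume *: "x \<in> words N A" "u < N" "v < N"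
  have "(\<Sum>a\<in>A. T v (x a) * (f (x(a := u)) + g (x(a := u))) + T u (x a) * (f (x(a := v)) + g (x(a := v))))
    = (\<Sum>a\<in>A. T v (x a) * f (x(a := u)) + T u (x a) * f (x(a := v)))
    + (\<Sum>a\<in>A. T v (x a) * g (x(a := u)) + T u (x a) * g (x(a := v)))"
    unfolding sum.distrib[symmetric] by (intro sum.cong refl) (simp add: algebra_simps del: fun_upd_apply)
  then show "(\<Sum>a\<in>A. T v (x a) * (f (x(a := u)) + g (x(a := u)))
      + T u (x a) * (f (x(a := v)) + g (x(a := v)))) = 0"
    using assms * unfolding infinitesimally_invariant_def by simp
qed

lemma infinitesimally_invariant_scale:
  assumes "infinitesimally_invariant N T A f"
  shows "infinitesimally_invariant N T A (\<lambda>x. k * f x)"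
  unfolding infinitesimally_invariant_def
proof (intro ballI allI impI)
  fix x u v assume *: "x \<in> words N A" "u < N" "v < N"
  have "(\<Sum>a\<in>A. T v (x a) * (k * f (x(a := u))) + T u (x a) * (k * f (x(a := v))))
    = k * (\<Sum>a\<in>A. T v (x a) * f (x(a := u)) + T u (x a) * f (x(a := v)))"
    unfolding sum_distrib_left by (intro sum.cong refl) (simp add: algebra_simps del: fun_upd_apply)
  then show "(\<Sum>a\<in>A. T v (x a) * (k * f (x(a := u))) + T u (x a) * (k * f (x(a := v)))) = 0"
    using assms * unfolding infinitesimally_invariant_def by simp
qed

text \<open>The span theorem is used twice: over V with the W-word as parameter and \<open>U\<close>
  the invariant tensors over W, and then over W for every coefficient \<open>c\<close> in
  \<open>U\<close>.\<close>

theorem sum_invariant_in_trace_algebra: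
  fixes t :: "(nat \<Rightarrow> nat) \<Rightarrow> (nat \<Rightarrow> nat) \<Rightarrow> 'k::field_char_0"
  assumes A: "finite A" and i: "i ` A \<subseteq> {1..d}"
    and inv1: "\<And>y. y \<in> words (2 * q) A \<Longrightarrow> infinitesimally_invariant (2 * p) (sform p) A (\<lambda>x. t x y)"
    and inv2: "\<And>x. x \<in> words (2 * p) A \<Longrightarrow> infinitesimally_invariant (2 * q) (sform q) A (t x)"
  shows "(\<lambda>M. \<Sum>x\<in>words (2 * p) A. \<Sum>y\<in>words (2 * q) A. t x y * (\<Prod>k\<in>A. M (i k) $$ (x k, y k)))
    \<in> trace_algebra p q d"
proof -
  interpret V: symp_tensor "2 * p" "sform p :: nat \<Rightarrow> nat \<Rightarrow> 'k" by (rule symp_tensor_sform)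
  interpret W: symp_tensor "2 * q" "sform q :: nat \<Rightarrow> nat \<Rightarrow> 'k" by (rule symp_tensor_sform)
  define U where "U = {c :: (nat \<Rightarrow> nat) \<Rightarrow> 'k. infinitesimally_invariant (2 * q) (sform q) A c}"
  \<comment> \<open>Invariance in \<open>x\<close> is assumed for words \<open>y\<close> only,
    whereas the span theorem asks for it at every \<open>y\<close>; cutting \<open>t\<close> off by
    0 bridges the difference.\<close>
  define t' where "t' x y = (if y \<in> words (2 * q) A then t x y else 0)" for x y
  have "\<exists>s. form_span (sform p) A U s \<and> (\<forall>x\<in>words (2 * p) A. \<forall>y. t' x y = s x y)"
  proof (rule V.invariant_in_form_span[OF A])
    show "(\<lambda>y. 0) \<in> U" by (simp add: U_def infinitesimally_invariant_zero)
    show "(\<lambda>y. c y + c' y) \<in> U" if "c \<in> U" "c' \<in> U" for c c'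
      using that by (simp add: U_def infinitesimally_invariant_add)
    show "(\<lambda>y. k * c y) \<in> U" if "c \<in> U" for k c
      using that by (simp add: U_def infinitesimally_invariant_scale)
    show "t' x \<in> U" if "x \<in> words (2 * p) A" for x
    proof -
      have "(\<Sum>a\<in>A. sform q v (y a) * t' x (y(a := u)) + sform q u (y a) * t' x (y(a := v))) = 0"
        if y: "y \<in> words (2 * q) A" and uv: "u < 2 * q" "v < 2 * q" for y u v
      proof -
        have "(\<Sum>a\<in>A. sform q v (y a) * t' x (y(a := u)) + sform q u (y a) * t' x (y(a := v)))
          = (\<Sum>a\<in>A. sform q v (y a) * t x (y(a := u)) + sform q u (y a) * t x (y(a := v)))"
          using words_upd[OF y] uv by (intro sum.cong refl) (simp add: t'_def del: fun_upd_apply)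
        also have "\<dots> = 0"
          using inv2[OF \<open>x \<in> words (2 * p) A\<close>] y uv unfolding infinitesimally_invariant_def by blast
        finally show ?thesis .
      qed
      then show ?thesis unfolding U_def infinitesimally_invariant_def by blast
    qed
    show "infinitesimally_invariant (2 * p) (sform p) A (\<lambda>x. t' x y)" for y
      using inv1[of y] infinitesimally_invariant_zero
      by (cases "y \<in> words (2 * q) A") (simp_all add: t'_def)
  qed
  then obtain s where s: "form_span (sform p) A U s"
    "\<And>x y. x \<in> words (2 * p) A \<Longrightarrow> t' x y = s x y" by blast
  have ts: "t x y = s x y" if "x \<in> words (2 * p) A" "y \<in> words (2 * q) A" for x y
    using s(2)[OF that(1), of y] that(2) by (simp add: t'_def)
  have inner: "(\<lambda>M. \<Sum>y\<in>words (2 * q) A. c y * F M y) \<in> trace_algebra p q d"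
    if c: "c \<in> U" and F: "word_form p q d A F" for c and F :: "(nat \<Rightarrow> 'k mat) \<Rightarrow> (nat \<Rightarrow> nat) \<Rightarrow> 'k"
  proof -
    \<comment> \<open>The coefficients are now mere scalars, which functions on \<open>unit\<close>
      express.\<close>
    have "\<exists>s'. form_span (sform q) A (UNIV :: (unit \<Rightarrow> 'k) set) s'
        \<and> (\<forall>y\<in>words (2 * q) A. \<forall>z::unit. (\<lambda>y z. c y) y z = s' y z)"
      by (rule W.invariant_in_form_span[OF A]) (use c in \<open>auto simp: U_def\<close>)
    then obtain s' where s': "form_span (sform q) A (UNIV :: (unit \<Rightarrow> 'k) set) s'"
      "\<And>y. y \<in> words (2 * q) A \<Longrightarrow> c y = s' y ()" by blast
    have "(\<lambda>M. \<Sum>y\<in>words (2 * q) A. s' y () * F M y) \<in> trace_algebra p q d"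
      using s'(1)
    proof (induction rule: form_span.induct)
      case zero
      show ?case using algebra_on_const[of 0] by simp
    next
      case (add_gen s w b)
      have "(\<lambda>M. b () * (\<Sum>y\<in>words (2 * q) A. w y * F M y)
          + (\<Sum>y\<in>words (2 * q) A. s y () * F M y)) \<in> trace_algebra p q d"
        by (intro algebra_on_add algebra_on_mult algebra_on_const add_gen.IH
            sum_pairing_word_form[OF add_gen.hyps(2) F])
      then show ?case
        by (rule algebra_on_cong) (simp add: sum.distrib sum_distrib_left algebra_simps)
    qed
    then show ?thesis by (rule algebra_on_cong) (simp add: s'(2))
  qed
  have "(\<lambda>M. \<Sum>x\<in>words (2 * p) A. \<Sum>y\<in>words (2 * q) A. s x y * (\<Prod>k\<in>A. M (i k) $$ (x k, y k)))
    \<in> trace_algebra p q d"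
    using s(1)
  proof (induction rule: form_span.induct)
    case zero
    show ?case using algebra_on_const[of 0] by simp
  next
    case (add_gen s w c)
    let ?P = "\<lambda>M x y. (\<Prod>k\<in>A. M (i k) $$ (x k, y k))"
    have "(\<lambda>M. (\<Sum>y\<in>words (2 * q) A. c y * (\<Sum>x\<in>words (2 * p) A. w x * ?P M x y))
        + (\<Sum>x\<in>words (2 * p) A. \<Sum>y\<in>words (2 * q) A. s x y * ?P M x y)) \<in> trace_algebra p q d"
      by (intro algebra_on_add inner add_gen.IH add_gen.hyps(3) sum_pairing_entries[OF add_gen.hyps(2) i])
    moreover have "(\<Sum>y\<in>words (2 * q) A. c y * (\<Sum>x\<in>words (2 * p) A. w x * ?P M x y))
        = (\<Sum>x\<in>words (2 * p) A. \<Sum>y\<in>words (2 * q) A. w x * c y * ?P M x y)" for M :: "nat \<Rightarrow> 'k mat"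
      unfolding sum_distrib_left by (subst sum.swap) (simp add: mult_ac)
    ultimately show ?case by (simp add: distrib_right sum.distrib)
  qed
  then show ?thesis by (rule algebra_on_cong) (simp add: ts)
qed

text \<open>The derivative of a product over the slots leaves Kronecker deltas in all slots but one;
  only the words \<open>x(a := u)\<close> survive them.\<close>

lemma sum_words_agree_off:
  fixes g :: "(nat \<Rightarrow> nat) \<Rightarrow> 'k::comm_ring_1"
  assumes A: "finite A" "a \<in> A" and x: "x \<in> words N A"
  shows "(\<Sum>x'\<in>words N A. (\<Prod>k\<in>A - {a}. of_bool (x' k = x k)) * g x') = (\<Sum>u<N. g (x(a := u)))"
proof -
  have "(\<Sum>x'\<in>words N A. (\<Prod>k\<in>A - {a}. of_bool (x' k = x k)) * g x')
    = (\<Sum>x'\<in>(\<lambda>u. x(a := u)) ` {..<N}. g x')"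
  proof (rule sum.mono_neutral_cong_right)
    show "(\<lambda>u. x(a := u)) ` {..<N} \<subseteq> words N A" using A x by auto
    show "\<forall>x'\<in>words N A - (\<lambda>u. x(a := u)) ` {..<N}. (\<Prod>k\<in>A - {a}. of_bool (x' k = x k)) * g x' = 0"
    proof
      fix x' assume x': "x' \<in> words N A - (\<lambda>u. x(a := u)) ` {..<N}"
      then have "x' \<noteq> x(a := x' a)" using A(2) by auto
      then obtain k where k: "x' k \<noteq> (x(a := x' a)) k" by blast
      then have "k \<noteq> a" "x' k \<noteq> x k" by (auto split: if_splits)
      moreover from this have "k \<in> A"
        using x x' unfolding words_def PiE_def extensional_def by auto
      ultimately have "(\<Prod>k\<in>A - {a}. of_bool (x' k = x k)) = (0::'k)"
        using A by (intro prod_zero) auto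
      then show "(\<Prod>k\<in>A - {a}. of_bool (x' k = x k)) * g x' = 0" by simp
    qed
    show "(\<Prod>k\<in>A - {a}. of_bool (x' k = x k)) * g x' = g x'"
      if "x' \<in> (\<lambda>u. x(a := u)) ` {..<N}" for x'
    proof -
      have "(\<Prod>k\<in>A - {a}. of_bool (x' k = x k)) = (1::'k)"
        using that by (intro prod.neutral) (auto split: if_splits)
      then show ?thesis by simp
    qed
  qed (use A in simp)
  also have "\<dots> = (\<Sum>u<N. g (x(a := u)))"
    by (subst sum.reindex) (auto intro!: inj_onI dest: fun_cong[of _ _ a])
  finally show ?thesis .
qed

section \<open>Transvections and polarisation\<close>

text \<open>The entries of \<open>1 + s v v\<^sup>t T\<close>.\<close>

definition transvection :: "nat \<Rightarrow> (nat \<Rightarrow> nat \<Rightarrow> 'k::field) \<Rightarrow> (nat \<Rightarrow> 'k) \<Rightarrow> 'k \<Rightarrow> nat \<Rightarrow> nat \<Rightarrow> 'k" where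
  "transvection N T v s i j = of_bool (i = j) + s * (v i * (\<Sum>w<N. v w * T w j))"

text \<open>For fixed \<open>v\<close> the invariance is an identity of polynomials in
  \<open>s\<close> that holds at every point of an infinite field, so its formal derivative at 0 can
  be taken. The result is quadratic in the vector \<open>v\<close>, and polarising it gives the
  symmetric identity sought.\<close>

lemma infinitesimally_invariant_if_transvection_invariant:
  fixes f :: "(nat \<Rightarrow> nat) \<Rightarrow> 'k::field_char_0"
  assumes A: "finite A"
    and inv: "\<And>v s x. x \<in> words N A \<Longrightarrow>
      (\<Sum>x'\<in>words N A. f x' * (\<Prod>k\<in>A. transvection N T v s (x' k) (x k))) = f x"
  shows "infinitesimally_invariant N T A f"
  unfolding infinitesimally_invariant_def
proof (intro ballI allI impI)
  fix x u0 w0 assume x: "x \<in> words N A" and u0: "u0 < N" and w0: "w0 < N"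
  define S where "S u w = (\<Sum>a\<in>A. T w (x a) * f (x(a := u)))" for u w
  have quad: "(\<Sum>u<N. \<Sum>w<N. v u * v w * S u w) = 0" for v :: "nat \<Rightarrow> 'k"
  proof -
    define tau where "tau j = (\<Sum>w<N. v w * T w j)" for j
    define P where "P = (\<Sum>x'\<in>words N A. Polynomial.smult (f x') (\<Prod>k\<in>A. [: of_bool (x' k = x k), v (x' k) * tau (x k) :]))"
    have "poly P s = poly [: f x :] s" for s
      using inv[OF x, of v s]
      by (simp add: P_def poly_sum poly_prod transvection_def tau_def)
    then have "P = [: f x :]" by (simp add: poly_eq_poly_eq_iff[symmetric] fun_eq_iff)
    then have "pderiv P = 0" by (simp add: pderiv_pCons)
    then have "0 = poly (pderiv P) 0" by simp
    also have "\<dots> = (\<Sum>x'\<in>words N A. \<Sum>a\<in>A.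
        (\<Prod>k\<in>A - {a}. of_bool (x' k = x k)) * (f x' * (v (x' a) * tau (x a))))"
      by (simp add: P_def higher_pderiv_sum[of 1, simplified] pderiv_smult pderiv_prod pderiv_pCons poly_sum poly_prod
          sum_distrib_left mult_ac)
    also have "\<dots> = (\<Sum>a\<in>A. \<Sum>x'\<in>words N A.
        (\<Prod>k\<in>A - {a}. of_bool (x' k = x k)) * (f x' * (v (x' a) * tau (x a))))"
      by (rule sum.swap)
    also have "\<dots> = (\<Sum>a\<in>A. \<Sum>u<N. f (x(a := u)) * (v u * tau (x a)))"
      using sum_words_agree_off[OF A _ x, where g = "\<lambda>x'. f x' * (v (x' a) * tau (x a))" for a]
      by (intro sum.cong refl) simp
    also have "\<dots> = (\<Sum>a\<in>A. \<Sum>u<N. \<Sum>w<N. v u * v w * (T w (x a) * f (x(a := u))))"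
      unfolding tau_def sum_distrib_left by (intro sum.cong refl) (simp add: mult_ac del: fun_upd_apply)
    also have "\<dots> = (\<Sum>u<N. \<Sum>w<N. \<Sum>a\<in>A. v u * v w * (T w (x a) * f (x(a := u))))"
      by (subst sum.swap, rule sum.cong[OF refl], rule sum.swap)
    finally show ?thesis by (simp add: S_def sum_distrib_left)
  qed
  have ev: "(\<Sum>u<N. \<Sum>w<N. (if u = b then 1 else 0) * (if w = c then 1 else 0) * S u w) = S b c"
    if "b < N" "c < N" for b c
  proof -
    have "(\<Sum>u<N. \<Sum>w<N. (if u = b then 1 else 0) * (if w = c then 1 else 0) * S u w)
      = (\<Sum>u<N. \<Sum>w<N. if w = c then (if u = b then S u w else 0) else 0)"
      by (intro sum.cong refl) auto
    also have "\<dots> = S b c" using that by simp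
    finally show ?thesis .
  qed
  let ?e = "\<lambda>b u. (if u = b then 1 else 0 :: 'k)"
  \<comment> \<open>Evaluation at a sum of two basis vectors: the mixed terms are the wanted
    identity, and the pure ones vanish by \<open>quad\<close> at a single basis vector.\<close>
  have "0 = (\<Sum>u<N. \<Sum>w<N. (?e u0 u + ?e w0 u) * (?e u0 w + ?e w0 w) * S u w)"
    using quad[of "\<lambda>u. ?e u0 u + ?e w0 u"] by simp
  also have "\<dots> = (\<Sum>u<N. \<Sum>w<N. ?e u0 u * ?e u0 w * S u w) + (\<Sum>u<N. \<Sum>w<N. ?e u0 u * ?e w0 w * S u w)
     + (\<Sum>u<N. \<Sum>w<N. ?e w0 u * ?e u0 w * S u w) + (\<Sum>u<N. \<Sum>w<N. ?e w0 u * ?e w0 w * S u w)"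
    unfolding sum.distrib[symmetric] by (intro sum.cong refl) (simp only: algebra_simps)
  also have "\<dots> = S u0 u0 + S u0 w0 + S w0 u0 + S w0 w0"
    using u0 w0 by (simp only: ev)
  also have "S u0 u0 = 0" using quad[of "?e u0"] ev[OF u0 u0] by simp
  also have "S w0 w0 = 0" using quad[of "?e w0"] ev[OF w0 w0] by simp
  finally show "(\<Sum>a\<in>A. T w0 (x a) * f (x(a := u0)) + T u0 (x a) * f (x(a := w0))) = 0"
    by (simp add: S_def sum.distrib)
qed

text \<open>Inclusion-exclusion on the image. When the product is expanded, a map \<open>g\<close>
  occurs for every \<open>S\<close> containing its image, and the signed count of these
  \<open>S\<close> is 1 if \<open>g\<close> is onto and 0 otherwise. For \<open>l < D\<close> both
  sides are therefore 0.\<close>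

lemma sum_signed_prod_eq_surjections:
  fixes h :: "nat \<Rightarrow> nat \<Rightarrow> 'k::comm_ring_1"
  shows "(\<Sum>S\<in>Pow {..<D}. (- 1) ^ (D - card S) * (\<Prod>k<l. \<Sum>j\<in>S. h k j))
    = (\<Sum>g | g \<in> words D {..<l} \<and> g ` {..<l} = {..<D}. \<Prod>k<l. h k (g k))"
proof -
  have 1: "(\<Prod>k<l. \<Sum>j\<in>S. h k j) = (\<Sum>g\<in>words D {..<l}. of_bool (g ` {..<l} \<subseteq> S) * (\<Prod>k<l. h k (g k)))"
    if S: "S \<subseteq> {..<D}" for S
  proof -
    have fS: "finite S" using S finite_subset by blast
    have "(\<Prod>k<l. \<Sum>j\<in>S. h k j) = (\<Sum>g\<in>{..<l} \<rightarrow>\<^sub>E S. \<Prod>k<l. h k (g k))"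
      using fS by (intro prod_sum_PiE) auto
    also have "\<dots> = (\<Sum>g\<in>words D {..<l}. of_bool (g ` {..<l} \<subseteq> S) * (\<Prod>k<l. h k (g k)))"
      using S by (intro sum.mono_neutral_cong_left) (auto simp: words_def intro!: finite_PiE)
    finally show ?thesis .
  qed
  have 2: "(\<Sum>S\<in>Pow {..<D}. (- 1) ^ (D - card S) * of_bool (g ` {..<l} \<subseteq> S))
      = (of_bool (g ` {..<l} = {..<D}) :: 'k)" if g: "g \<in> words D {..<l}" for g
  proof -
    have gD: "g ` {..<l} \<subseteq> {..<D}" using g by (auto simp: words_def)
    let ?b = "\<lambda>j. of_bool (j \<notin> g ` {..<l}) :: 'k"
    \<comment> \<open>The factor \<open>1 - ?b j\<close> is 0 exactly when \<open>g\<close> misses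
      \<open>j\<close>; expanding the product gives the signed count.\<close>
    have "(\<Prod>j<D. 1 - ?b j)
      = (\<Sum>S\<in>Pow {..<D}. (- 1) ^ (card {..<D} - card S) * (\<Prod>j\<in>S. 1) * (\<Prod>j\<in>{..<D} - S. ?b j))"
      by (rule prod_diff_conv_sum') simp
    also have "\<dots> = (\<Sum>S\<in>Pow {..<D}. (- 1) ^ (D - card S) * of_bool (g ` {..<l} \<subseteq> S))"
    proof (intro sum.cong refl)
      fix S assume S: "S \<in> Pow {..<D}"
      have "(\<Prod>j\<in>{..<D} - S. ?b j) = of_bool (g ` {..<l} \<subseteq> S)"
      proof (cases "g ` {..<l} \<subseteq> S")
        case True
        then show ?thesis by (auto intro!: prod.neutral)
      next
        case False
        then obtain j where "j \<in> g ` {..<l}" "j \<notin> S" by blast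
        with gD have "(\<Prod>j\<in>{..<D} - S. ?b j) = 0" by (intro prod_zero) auto
        then show ?thesis using False by simp
      qed
      then show "(- 1) ^ (card {..<D} - card S) * (\<Prod>j\<in>S. 1) * (\<Prod>j\<in>{..<D} - S. ?b j)
        = (- 1) ^ (D - card S) * of_bool (g ` {..<l} \<subseteq> S)" by simp
    qed
    also have "(\<Prod>j<D. 1 - ?b j) = of_bool (g ` {..<l} = {..<D})"
    proof (cases "g ` {..<l} = {..<D}")
      case True
      then show ?thesis by (auto intro!: prod.neutral)
    next
      case False
      then obtain j where "j < D" "j \<notin> g ` {..<l}" using gD by blast
      then have "(\<Prod>j<D. 1 - ?b j) = 0" by (intro prod_zero) auto
      then show ?thesis using False by simp
    qed
    finally show ?thesis by simp
  qed
  have "(\<Sum>S\<in>Pow {..<D}. (- 1) ^ (D - card S) * (\<Prod>k<l. \<Sum>j\<in>S. h k j))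
    = (\<Sum>S\<in>Pow {..<D}. \<Sum>g\<in>words D {..<l}. (- 1) ^ (D - card S) * of_bool (g ` {..<l} \<subseteq> S) * (\<Prod>k<l. h k (g k)))"
  proof (rule sum.cong[OF refl])
    fix S assume "S \<in> Pow {..<D}"
    then have "S \<subseteq> {..<D}" by simp
    from 1[OF this] show "(- 1) ^ (D - card S) * (\<Prod>k<l. \<Sum>j\<in>S. h k j)
      = (\<Sum>g\<in>words D {..<l}. (- 1) ^ (D - card S) * of_bool (g ` {..<l} \<subseteq> S) * (\<Prod>k<l. h k (g k)))"
      by (simp only: sum_distrib_left mult.assoc)
  qed
  also have "\<dots> = (\<Sum>g\<in>words D {..<l}. of_bool (g ` {..<l} = {..<D}) * (\<Prod>k<l. h k (g k)))"
    by (subst sum.swap, rule sum.cong[OF refl]) (simp only: 2 sum_distrib_right[symmetric])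
  also have "\<dots> = (\<Sum>g | g \<in> words D {..<l} \<and> g ` {..<l} = {..<D}. \<Prod>k<l. h k (g k))"
    by (rule sum.mono_neutral_cong_right) auto
  finally show ?thesis .
qed


section \<open>The symplectic groups and their action\<close>

lemma symp_form_transpose_mult:
  "transpose_mat (symp_form r) * symp_form r = (1\<^sub>m (2 * r) :: 'k::field_char_0 mat)"
proof (rule eq_matI)
  note c = symp_form_carrier[of r, where 'k = 'k]
  have ct: "transpose_mat (symp_form r :: 'k mat) \<in> carrier_mat (2 * r) (2 * r)" using c by simp
  show "(transpose_mat (symp_form r) * symp_form r) $$ (i, j) = (1\<^sub>m (2 * r) :: 'k mat) $$ (i, j)"
    if "i < dim_row (1\<^sub>m (2 * r) :: 'k mat)" "j < dim_col (1\<^sub>m (2 * r) :: 'k mat)" for i j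
  proof -
    have ij: "i < 2 * r" "j < 2 * r" using that by auto
    have "(transpose_mat (symp_form r) * symp_form r :: 'k mat) $$ (i, j)
      = (\<Sum>w<2 * r. sform r w i * sform r w j)"
      using ij by (subst mult_mat_index[OF ct c]) (auto simp: symp_form_sform carrier_matD[OF c] intro!: sum.cong)
    also have "\<dots> = of_bool (i = j)" by (rule symp_tensor.T_ortho'[OF symp_tensor_sform ij])
    finally show ?thesis using ij by simp
  qed
qed (simp_all add: carrier_matD[OF symp_form_carrier])

lemma symp_form_mult_transpose:
  "symp_form r * transpose_mat (symp_form r) = (1\<^sub>m (2 * r) :: 'k::field_char_0 mat)"
  by (rule mat_mult_left_right_inverse[OF _ _ symp_form_transpose_mult]) simp_all

text \<open>As T^t T = 1, the equation A^t T A = T says that T^t A^t T is a left inverse of A. This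
  explicit inverse yields the \<open>invertible_mat\<close> part in \<open>SpI\<close>.\<close>

lemma preserves_symp_form_inverse:
  fixes A :: "'k::field_char_0 mat"
  assumes A: "A \<in> carrier_mat (2 * r) (2 * r)"
    and eq: "transpose_mat A * symp_form r * A = symp_form r"
  defines "B \<equiv> transpose_mat (symp_form r) * (transpose_mat A * symp_form r)"
  shows "B \<in> carrier_mat (2 * r) (2 * r)" "B * A = 1\<^sub>m (2 * r)" "A * B = 1\<^sub>m (2 * r)"
proof -
  let ?S = "symp_form r :: 'k mat"
  have St: "transpose_mat ?S \<in> carrier_mat (2 * r) (2 * r)" by simp
  have AtS: "transpose_mat A * ?S \<in> carrier_mat (2 * r) (2 * r)"
    using A by (intro mult_carrier_mat[of _ _ "2 * r"]) auto
  show B: "B \<in> carrier_mat (2 * r) (2 * r)"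
    unfolding B_def using St AtS by (rule mult_carrier_mat)
  show BA: "B * A = 1\<^sub>m (2 * r)"
    unfolding B_def assoc_mult_mat[OF St AtS A] eq by (rule symp_form_transpose_mult)
  show "A * B = 1\<^sub>m (2 * r)" by (rule mat_mult_left_right_inverse[OF B A BA])
qed

lemma SpI:
  fixes A :: "'k::field_char_0 mat"
  assumes A: "A \<in> carrier_mat (2 * r) (2 * r)"
    and eq: "transpose_mat A * symp_form r * A = symp_form r"
  shows "A \<in> Sp r"
  using preserves_symp_form_inverse[OF assms] A eq
  unfolding Sp_def invertible_mat_def inverts_mat_def
  by (auto intro!: exI[of _ "transpose_mat (symp_form r) * (transpose_mat A * symp_form r)"])

lemma SpD:
  assumes "A \<in> Sp r"
  shows "A \<in> carrier_mat (2 * r) (2 * r)" "transpose_mat A * symp_form r * A = symp_form r"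
  using assms by (auto simp: Sp_def)

text \<open>From A T^t A^t T = 1 by cancelling T on the right and transposing. This gives closure
  under transposition and lets an inverse be moved past the form.\<close>

lemma Sp_mult_transpose:
  fixes A :: "'k::field_char_0 mat"
  assumes "A \<in> Sp r"
  shows "A * symp_form r * transpose_mat A = symp_form r"
proof -
  let ?S = "symp_form r :: 'k mat" and ?n = "2 * r"
  note A = SpD(1)[OF assms]
  have S: "?S \<in> carrier_mat ?n ?n" and St: "transpose_mat ?S \<in> carrier_mat ?n ?n"
    and At: "transpose_mat A \<in> carrier_mat ?n ?n" using A by auto
  have AtS: "transpose_mat A * ?S \<in> carrier_mat ?n ?n" by (rule mult_carrier_mat[OF At S])
  have ASt: "A * transpose_mat ?S \<in> carrier_mat ?n ?n" by (rule mult_carrier_mat[OF A St])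
  have AStAt: "A * transpose_mat ?S * transpose_mat A \<in> carrier_mat ?n ?n"
    by (rule mult_carrier_mat[OF ASt At])
  have "A * transpose_mat ?S * transpose_mat A = A * transpose_mat ?S * transpose_mat A * (?S * transpose_mat ?S)"
    by (simp only: symp_form_mult_transpose right_mult_one_mat[OF AStAt])
  also have "\<dots> = A * transpose_mat ?S * transpose_mat A * ?S * transpose_mat ?S"
    by (rule assoc_mult_mat[OF AStAt S St, symmetric])
  also have "A * transpose_mat ?S * transpose_mat A * ?S = A * (transpose_mat ?S * (transpose_mat A * ?S))"
    unfolding assoc_mult_mat[OF ASt At S] by (rule assoc_mult_mat[OF A St AtS])
  also have "\<dots> = 1\<^sub>m ?n" by (rule preserves_symp_form_inverse(3)[OF SpD[OF assms]])
  finally have 1: "A * transpose_mat ?S * transpose_mat A = transpose_mat ?S"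
    by (simp only: left_mult_one_mat[OF St])
  have "transpose_mat (A * transpose_mat ?S * transpose_mat A) = A * ?S * transpose_mat A"
    unfolding transpose_mult[OF ASt At] transpose_mult[OF A St]
    using assoc_mult_mat[OF A S At] by simp
  then show ?thesis unfolding 1 by simp
qed

lemma Sp_transpose: "A \<in> Sp r \<Longrightarrow> transpose_mat A \<in> (Sp r :: 'k::field_char_0 mat set)"
  using Sp_mult_transpose[of A r] SpD(1)[of A r] by (intro SpI) auto

lemma one_in_Sp: "1\<^sub>m (2 * r) \<in> (Sp r :: 'k::field_char_0 mat set)"
  by (intro SpI)
     (simp_all only: transpose_one left_mult_one_mat[OF symp_form_carrier]
       right_mult_one_mat[OF symp_form_carrier] one_carrier_mat)

lemma mat_inverse_eqI:
  fixes B C :: "'k::field mat"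
  assumes B: "B \<in> carrier_mat n n" and C: "C \<in> carrier_mat n n" and BC: "B * C = 1\<^sub>m n"
  shows "mat_inverse B = Some C"
proof -
  have CB: "C * B = 1\<^sub>m n" by (rule mat_mult_left_right_inverse[OF B C BC])
  show ?thesis
  proof (cases "mat_inverse B")
    case None
    then have "B \<notin> Units (ring_mat TYPE('k) n ())" by (rule mat_inverse(1)[OF B])
    moreover have "B \<in> Units (ring_mat TYPE('k) n ())"
      using B C BC CB by (auto simp: Units_def ring_mat_def)
    ultimately show ?thesis by simp
  next
    case (Some D)
    then have D: "B * D = 1\<^sub>m n" "D * B = 1\<^sub>m n" "D \<in> carrier_mat n n"
      using mat_inverse(2)[OF B] by auto
    have "D = C * B * D" using D(3) by (simp add: CB)
    also have "\<dots> = C" using assoc_mult_mat[OF C B D(3)] C by (simp add: D(1))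
    finally show ?thesis using Some by simp
  qed
qed

text \<open>The last property moves the inverse of \<open>B\<close> past the form at the end of
  \<open>pair_mat\<close>.\<close>

lemma Sp_inverse:
  fixes B :: "'k::field_char_0 mat"
  assumes "B \<in> Sp r"
  obtains C where "C \<in> carrier_mat (2 * r) (2 * r)" "mat_inverse B = Some C"
    "B * C = 1\<^sub>m (2 * r)" "C * B = 1\<^sub>m (2 * r)"
    "C * symp_form r = symp_form r * transpose_mat B"
proof -
  let ?S = "symp_form r :: 'k mat"
  note B = SpD[OF assms]
  define C where "C = transpose_mat ?S * (transpose_mat B * ?S)"
  note C = preserves_symp_form_inverse[OF B, folded C_def]
  have S: "?S \<in> carrier_mat (2 * r) (2 * r)" by simp
  have BS: "B * ?S \<in> carrier_mat (2 * r) (2 * r)" by (rule mult_carrier_mat[OF B(1) S])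
  have Bt: "transpose_mat B \<in> carrier_mat (2 * r) (2 * r)" using B(1) by simp
  have SBt: "?S * transpose_mat B \<in> carrier_mat (2 * r) (2 * r)" by (rule mult_carrier_mat[OF S Bt])
  have "C * ?S = C * (B * ?S * transpose_mat B)" by (simp only: Sp_mult_transpose[OF assms])
  also have "\<dots> = C * (B * (?S * transpose_mat B))" by (simp only: assoc_mult_mat[OF B(1) S Bt])
  also have "\<dots> = C * B * (?S * transpose_mat B)" by (rule assoc_mult_mat[OF C(1) B(1) SBt, symmetric])
  also have "\<dots> = ?S * transpose_mat B" by (simp only: C(2) left_mult_one_mat[OF SBt])
  finally show ?thesis using that[OF C(1) mat_inverse_eqI[OF B(1) C(1,3)] C(3,2)] by blast
qed

lemma tuple_action_closed:
  assumes A: "A \<in> carrier_mat m m" and B: "mat_inverse B = Some C" and C: "C \<in> carrier_mat n n"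
    and M: "M \<in> mat_tuples m n d"
  shows "tuple_action d (A, B) M \<in> mat_tuples m n d"
proof -
  have "A * M i * C \<in> carrier_mat m n" if "i \<in> {1..d}" for i
    by (rule mult_carrier_mat[OF mult_carrier_mat[OF A mat_tuples_carrier[OF M that]] C])
  then show ?thesis by (auto simp: tuple_action_def mat_tuples_def B)
qed

lemma tuple_action_index:
  assumes A: "A \<in> carrier_mat m m" and B: "mat_inverse B = Some C" and C: "C \<in> carrier_mat n n"
    and M: "M \<in> mat_tuples m n d" and i: "i \<in> {1..d}" and ab: "a < m" "b < n"
  shows "tuple_action d (A, B) M i $$ (a, b)
    = (\<Sum>x<m. \<Sum>y<n. A $$ (a, x) * M i $$ (x, y) * C $$ (y, b))"
proof -
  note Mi = mat_tuples_carrier[OF M i]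
  have "tuple_action d (A, B) M i $$ (a, b) = (\<Sum>y<n. (\<Sum>x<m. A $$ (a, x) * M i $$ (x, y)) * C $$ (y, b))"
    using i ab unfolding tuple_action_def
    by (simp add: B mult_mat_index[OF mult_carrier_mat[OF A Mi] C] mult_mat_index[OF A Mi] del: index_mult_mat)
  then show ?thesis by (subst sum.swap) (simp add: sum_distrib_right)
qed

section \<open>Invariance of the trace functions\<close>

lemma mat_trace_eq: "A \<in> carrier_mat n n \<Longrightarrow> mat_trace A = (\<Sum>i<n. A $$ (i, i))"
  unfolding mat_trace_def diag_mat_def
  by (simp add: interv_sum_list_conv_sum_set_nat atLeast0LessThan)

lemma mat_trace_mult_comm:
  fixes A B :: "'k::field mat"
  assumes A: "A \<in> carrier_mat n n" and B: "B \<in> carrier_mat n n"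
  shows "mat_trace (A * B) = mat_trace (B * A)"
proof -
  have "mat_trace (A * B) = (\<Sum>i<n. \<Sum>l<n. A $$ (i, l) * B $$ (l, i))"
    using mult_mat_index[OF A B] by (simp add: mat_trace_eq[OF mult_carrier_mat[OF A B]] del: index_mult_mat)
  also have "\<dots> = (\<Sum>l<n. \<Sum>i<n. B $$ (l, i) * A $$ (i, l))"
    by (subst sum.swap) (simp add: mult.commute)
  also have "\<dots> = mat_trace (B * A)"
    using mult_mat_index[OF B A] by (simp add: mat_trace_eq[OF mult_carrier_mat[OF B A]] del: index_mult_mat)
  finally show ?thesis .
qed

text \<open>\<open>A\<close> cancels by A^t T_p A = T_p, and C T_q = T_q B^t leaves a conjugation,
  because C is the inverse of B. Products of such matrices are conjugated in the same way, so their
  traces do not change.\<close>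

lemma pair_mat_tuple_action:
  fixes M :: "nat \<Rightarrow> 'k::field_char_0 mat"
  assumes A: "A \<in> Sp p" and B: "B \<in> Sp q"
    and C: "C \<in> carrier_mat (2 * q) (2 * q)" "mat_inverse B = Some C" "C * symp_form q = symp_form q * transpose_mat B"
    and M: "M \<in> mat_tuples (2 * p) (2 * q) d" and nm: "n \<in> {1..d}" "m \<in> {1..d}"
  shows "pair_mat p q (tuple_action d (A, B) M) n m
    = transpose_mat C * pair_mat p q M n m * transpose_mat B"
proof -
  let ?a = "2 * p" and ?b = "2 * q"
  define X where "X = M n" 
  define Y where "Y = M m"
  let ?S = "symp_form p :: 'k mat" and ?R = "symp_form q :: 'k mat"
  have c: "A \<in> carrier_mat ?a ?a" "B \<in> carrier_mat ?b ?b" "X \<in> carrier_mat ?a ?b" "Y \<in> carrier_mat ?a ?b"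
    "?S \<in> carrier_mat ?a ?a" "?R \<in> carrier_mat ?b ?b"
    using SpD(1)[OF A] SpD(1)[OF B] M nm by (auto simp: X_def Y_def)
  note c = this C(1)
  have ct: "transpose_mat A \<in> carrier_mat ?a ?a" "transpose_mat B \<in> carrier_mat ?b ?b"
    "transpose_mat X \<in> carrier_mat ?b ?a" "transpose_mat C \<in> carrier_mat ?b ?b"
    using c by auto
  have AX: "A * X \<in> carrier_mat ?a ?b" by (rule mult_carrier_mat[OF c(1,3)])
  have YC: "Y * C \<in> carrier_mat ?a ?b" by (rule mult_carrier_mat[OF c(4,7)])
  have XA: "transpose_mat X * transpose_mat A \<in> carrier_mat ?b ?a" by (rule mult_carrier_mat[OF ct(3,1)])
  have SA: "?S * A \<in> carrier_mat ?a ?a" by (rule mult_carrier_mat[OF c(5,1)])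
  have AYC: "A * (Y * C) \<in> carrier_mat ?a ?b" by (rule mult_carrier_mat[OF c(1) YC])
  have SAYC: "?S * (A * (Y * C)) \<in> carrier_mat ?a ?b" by (rule mult_carrier_mat[OF c(5) AYC])
  have ASAYC: "transpose_mat A * (?S * (A * (Y * C))) \<in> carrier_mat ?a ?b" by (rule mult_carrier_mat[OF ct(1) SAYC])
  have XS: "transpose_mat X * ?S \<in> carrier_mat ?b ?a" by (rule mult_carrier_mat[OF ct(3) c(5)])
  have XSY: "transpose_mat X * ?S * Y \<in> carrier_mat ?b ?b" by (rule mult_carrier_mat[OF XS c(4)])
  have CX: "transpose_mat C * transpose_mat X \<in> carrier_mat ?b ?a" by (rule mult_carrier_mat[OF ct(4,3)])
  have CXA: "transpose_mat C * (transpose_mat X * transpose_mat A) \<in> carrier_mat ?b ?a"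
    by (rule mult_carrier_mat[OF ct(4) XA])
  have inv: "transpose_mat A * (?S * (A * (Y * C))) = ?S * (Y * C)"
  proof -
    have "transpose_mat A * (?S * (A * (Y * C))) = transpose_mat A * (?S * A * (Y * C))"
      by (simp only: assoc_mult_mat[OF c(5,1) YC])
    also have "\<dots> = transpose_mat A * (?S * A) * (Y * C)"
      by (rule assoc_mult_mat[OF ct(1) SA YC, symmetric])
    also have "transpose_mat A * (?S * A) = ?S"
      using SpD(2)[OF A] assoc_mult_mat[OF ct(1) c(5) c(1)] by simp
    finally show ?thesis .
  qed
  have "pair_mat p q (tuple_action d (A, B) M) n m
      = transpose_mat (A * X * C) * ?S * (A * Y * C) * ?R"
    using nm by (simp add: pair_mat_def tuple_action_def C(2) X_def Y_def)
  also have "transpose_mat (A * X * C) = transpose_mat C * (transpose_mat X * transpose_mat A)"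
    by (simp only: transpose_mult[OF AX c(7)] transpose_mult[OF c(1,3)])
  also have "A * Y * C = A * (Y * C)" by (rule assoc_mult_mat[OF c(1,4,7)])
  also have "transpose_mat C * (transpose_mat X * transpose_mat A) * ?S * (A * (Y * C))
      = transpose_mat C * (transpose_mat X * (transpose_mat A * (?S * (A * (Y * C)))))"
    by (simp only: assoc_mult_mat[OF CXA c(5) AYC] assoc_mult_mat[OF ct(4) XA SAYC] assoc_mult_mat[OF ct(3,1) SAYC])
  also have "\<dots> = transpose_mat C * (transpose_mat X * (?S * (Y * C)))" by (simp only: inv)
  also have "transpose_mat X * (?S * (Y * C)) = transpose_mat X * ?S * Y * C"
    by (simp only: assoc_mult_mat[OF XS c(4,7)] assoc_mult_mat[OF ct(3) c(5) YC])
  also have "transpose_mat C * (transpose_mat X * ?S * Y * C) * ?R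
      = transpose_mat C * (transpose_mat X * ?S * Y * C * ?R)"
    by (rule assoc_mult_mat[OF ct(4) mult_carrier_mat[OF XSY c(7)] c(6)])
  also have "transpose_mat X * ?S * Y * C * ?R = transpose_mat X * ?S * Y * (?R * transpose_mat B)"
    by (simp only: assoc_mult_mat[OF XSY c(7,6)] C(3))
  also have "\<dots> = transpose_mat X * ?S * Y * ?R * transpose_mat B"
    by (rule assoc_mult_mat[OF XSY c(6) ct(2), symmetric])
  also have "transpose_mat C * (transpose_mat X * ?S * Y * ?R * transpose_mat B)
     = transpose_mat C * (transpose_mat X * ?S * Y * ?R) * transpose_mat B"
    by (rule assoc_mult_mat[OF ct(4) mult_carrier_mat[OF XSY c(6)] ct(2), symmetric])
  finally show ?thesis by (simp add: pair_mat_def X_def Y_def)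
qed

lemma trace_function_tuple_action:
  fixes M :: "nat \<Rightarrow> 'k::field_char_0 mat"
  assumes A: "A \<in> Sp p" and B: "B \<in> Sp q"
    and M: "M \<in> mat_tuples (2 * p) (2 * q) d" and w: "set w \<subseteq> {1..d} \<times> {1..d}"
  shows "trace_function p q w (tuple_action d (A, B) M) = trace_function p q w M"
proof -
  let ?n = "2 * q"
  obtain C where C: "C \<in> carrier_mat ?n ?n" "mat_inverse B = Some C"
    "B * C = 1\<^sub>m ?n" "C * B = 1\<^sub>m ?n" "C * symp_form q = symp_form q * transpose_mat B"
    using Sp_inverse[OF B] by metis
  have Bc: "B \<in> carrier_mat ?n ?n" using SpD(1)[OF B] .
  have Bt: "transpose_mat B \<in> carrier_mat ?n ?n" and Ct: "transpose_mat C \<in> carrier_mat ?n ?n"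
    using Bc C by auto
  have BtCt: "transpose_mat B * transpose_mat C = 1\<^sub>m ?n"
    using transpose_mult[OF C(1) Bc] C(4) by simp
  have CtBt: "transpose_mat C * transpose_mat B = 1\<^sub>m ?n"
    using transpose_mult[OF Bc C(1)] C(3) by simp
  define P where "P M w = foldr (\<lambda>(n, m) P. pair_mat p q M n m * P) w (1\<^sub>m ?n)" for M :: "nat \<Rightarrow> 'k mat" and w
  have PC: "P M w \<in> carrier_mat ?n ?n" if "set w \<subseteq> {1..d} \<times> {1..d}" for w
    using that by (induction w) (auto simp: P_def intro!: mult_carrier_mat pair_mat_carrier[OF M])
  have P: "P (tuple_action d (A, B) M) w = transpose_mat C * P M w * transpose_mat B"
    using w
  proof (induction w)
    case Nil
    then show ?case using Ct CtBt by (simp add: P_def)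
  next
    case (Cons x w)
    obtain n m where x: "x = (n, m)" by force
    have nm: "n \<in> {1..d}" "m \<in> {1..d}" and sw: "set w \<subseteq> {1..d} \<times> {1..d}"
      using Cons.prems x by auto
    let ?Q = "pair_mat p q M n m" and ?P = "P M w"
    note Q = pair_mat_carrier[OF M nm] and Pw = PC[OF sw]
    have CQ: "transpose_mat C * ?Q \<in> carrier_mat ?n ?n" by (rule mult_carrier_mat[OF Ct Q])
    have CP: "transpose_mat C * ?P \<in> carrier_mat ?n ?n" by (rule mult_carrier_mat[OF Ct Pw])
    have PB: "?P * transpose_mat B \<in> carrier_mat ?n ?n" by (rule mult_carrier_mat[OF Pw Bt])
    have CPB: "transpose_mat C * (?P * transpose_mat B) \<in> carrier_mat ?n ?n" by (rule mult_carrier_mat[OF Ct PB])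
    have "P (tuple_action d (A, B) M) (x # w)
      = transpose_mat C * ?Q * transpose_mat B * (transpose_mat C * ?P * transpose_mat B)"
      using Cons.IH[OF sw] pair_mat_tuple_action[OF A B C(1,2,5) M nm] by (simp add: P_def x)
    also have "\<dots> = transpose_mat C * ?Q * (transpose_mat B * (transpose_mat C * (?P * transpose_mat B)))"
      by (simp only: assoc_mult_mat[OF Ct Pw Bt] assoc_mult_mat[OF CQ Bt CPB])
    also have "transpose_mat B * (transpose_mat C * (?P * transpose_mat B)) = ?P * transpose_mat B"
      by (simp only: assoc_mult_mat[OF Bt Ct PB, symmetric] BtCt left_mult_one_mat[OF PB])
    also have "transpose_mat C * ?Q * (?P * transpose_mat B) = transpose_mat C * (?Q * ?P) * transpose_mat B"
      by (simp only: assoc_mult_mat[OF CQ Pw Bt, symmetric] assoc_mult_mat[OF Ct Q Pw])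
    finally show ?case by (simp add: P_def x)
  qed
  have PB: "P M w * transpose_mat B \<in> carrier_mat ?n ?n" by (rule mult_carrier_mat[OF PC[OF w] Bt])
  have "trace_function p q w (tuple_action d (A, B) M) = mat_trace (transpose_mat C * (P M w * transpose_mat B))"
    unfolding trace_function_def P_def[symmetric] P assoc_mult_mat[OF Ct PC[OF w] Bt] ..
  also have "\<dots> = mat_trace (P M w * transpose_mat B * transpose_mat C)"
    by (rule mat_trace_mult_comm[OF Ct PB])
  also have "P M w * transpose_mat B * transpose_mat C = P M w"
    unfolding assoc_mult_mat[OF PC[OF w] Bt Ct] BtCt using PC[OF w] by simp
  finally show ?thesis by (simp add: trace_function_def P_def)
qed

abbreviation coordinates :: "nat \<Rightarrow> nat \<Rightarrow> nat \<Rightarrow> ((nat \<Rightarrow> 'k mat) \<Rightarrow> 'k) set" where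
  "coordinates m n d \<equiv> {\<lambda>M. M i $$ (a, b) | i a b. i \<in> {1..d} \<and> a < m \<and> b < n}"

lemma coordinate_polynomial:
  "i \<in> {1..d} \<Longrightarrow> a < m \<Longrightarrow> b < n \<Longrightarrow> (\<lambda>M. M i $$ (a, b)) \<in> algebra_on X (coordinates m n d)"
  by (rule algebra_on_generator) blast

lemma wform_polynomial:
  assumes "set w \<subseteq> {1..d} \<times> {1..d}" "u < 2 * q" "v < 2 * q"
  shows "(\<lambda>M. wform p q w M u v) \<in> algebra_on (mat_tuples (2 * p) (2 * q) d)
    (coordinates (2 * p) (2 * q) d :: ((nat \<Rightarrow> 'k::field mat) \<Rightarrow> 'k) set)"
  using assms
proof (induction w arbitrary: u)
  case Nil
  show ?case by (simp add: algebra_on_const)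
next
  case (Cons x w)
  have b: "(\<lambda>M. bform p x M u v) \<in> algebra_on (mat_tuples (2 * p) (2 * q) d)
    (coordinates (2 * p) (2 * q) d :: ((nat \<Rightarrow> 'k mat) \<Rightarrow> 'k) set)" if "u < 2 * q" "v < 2 * q" for u v
    unfolding bform_def
    by (intro algebra_on_sum algebra_on_mult algebra_on_const coordinate_polynomial)
       (use Cons.prems that in auto)
  show ?case
  proof (cases "w = []")
    case True
    then show ?thesis using b Cons.prems by simp
  next
    case False
    show ?thesis
      unfolding wform_Cons[OF False] form_prod_def
      by (intro algebra_on_sum algebra_on_mult algebra_on_const b Cons.IH) (use Cons.prems in auto)
  qed
qed

lemma trace_function_polynomial:
  assumes "w \<noteq> []" "set w \<subseteq> {1..d} \<times> {1..d}"
  shows "trace_function p q w \<in> algebra_on (mat_tuples (2 * p) (2 * q) d)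
    (coordinates (2 * p) (2 * q) d :: ((nat \<Rightarrow> 'k::field mat) \<Rightarrow> 'k) set)"
proof (rule algebra_on_cong)
  show "(\<lambda>M. \<Sum>u<2 * q. \<Sum>v<2 * q. wform p q w M u v * sform q v u) \<in> algebra_on (mat_tuples (2 * p) (2 * q) d)
    (coordinates (2 * p) (2 * q) d :: ((nat \<Rightarrow> 'k::field mat) \<Rightarrow> 'k) set)"
    by (intro algebra_on_sum algebra_on_mult algebra_on_const wform_polynomial assms) auto
qed (simp add: trace_function_eq[OF _ assms])

lemma tuple_action_Sp_closed:
  fixes M :: "nat \<Rightarrow> 'k::field_char_0 mat"
  assumes "A \<in> Sp p" "B \<in> Sp q" "M \<in> mat_tuples (2 * p) (2 * q) d"
  shows "tuple_action d (A, B) M \<in> mat_tuples (2 * p) (2 * q) d"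
  using Sp_inverse[OF assms(2)] tuple_action_closed[OF SpD(1)[OF assms(1)] _ _ assms(3)] by metis

theorem trace_algebra_subset_invariants:
  "generated_algebra (mat_tuples (2 * p) (2 * q) d)
     {trace_function p q w | w. w \<noteq> [] \<and> set w \<subseteq> {1..d} \<times> {1..d}}
   \<subseteq> (symp_invariants p q d :: ((nat \<Rightarrow> 'k::field_char_0 mat) \<Rightarrow> 'k) set)"
proof
  fix f :: "(nat \<Rightarrow> 'k mat) \<Rightarrow> 'k"
  let ?X = "mat_tuples (2 * p) (2 * q) d"
  assume "f \<in> generated_algebra ?X {trace_function p q w | w. w \<noteq> [] \<and> set w \<subseteq> {1..d} \<times> {1..d}}"
  then have "f \<in> polynomial_functions (2 * p) (2 * q) d
    \<and> (\<forall>A\<in>Sp p. \<forall>B\<in>Sp q. \<forall>M\<in>?X. f (tuple_action d (A, B) M) = f M)"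
  proof (induction rule: generated_algebra.induct)
    case (generator g)
    then obtain w where w: "g = trace_function p q w" "w \<noteq> []" "set w \<subseteq> {1..d} \<times> {1..d}" by blast
    show ?case
    proof
      show "restrict g ?X \<in> polynomial_functions (2 * p) (2 * q) d"
        using trace_function_polynomial[OF w(2,3), of p q]
        unfolding algebra_on_def polynomial_functions_def w(1) by blast
    qed (use w in \<open>simp add: tuple_action_Sp_closed trace_function_tuple_action\<close>)
  next
    case (const c)
    then show ?case unfolding polynomial_functions_def
      by (intro conjI generated_algebra.const) (simp_all add: tuple_action_Sp_closed)
  next
    case (add f g)
    then show ?case unfolding polynomial_functions_def
      by (intro conjI generated_algebra.add) (simp_all add: tuple_action_Sp_closed)
  next
    case (mult f g)
    then show ?case unfolding polynomial_functions_def
      by (intro conjI generated_algebra.mult) (simp_all add: tuple_action_Sp_closed)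
  qed
  then show "f \<in> symp_invariants p q d" by (auto simp: symp_invariants_def)
qed


section \<open>Transvections as symplectic matrices\<close>

definition transvection_mat :: "nat \<Rightarrow> (nat \<Rightarrow> 'k::field) \<Rightarrow> 'k \<Rightarrow> 'k mat" where
  "transvection_mat r v s = mat (2 * r) (2 * r) (\<lambda>(i, j). transvection (2 * r) (sform r) v s i j)"

lemma transvection_mat_carrier [simp]: "transvection_mat r v s \<in> carrier_mat (2 * r) (2 * r)"
  by (simp add: transvection_mat_def)

lemma transvection_mat_index:
  "i < 2 * r \<Longrightarrow> j < 2 * r \<Longrightarrow> transvection_mat r v s $$ (i, j)
    = of_bool (i = j) + s * (v i * (\<Sum>w<2 * r. v w * sform r w j))"
  by (simp add: transvection_mat_def transvection_def)

lemma sform_isotropic: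
  fixes v :: "nat \<Rightarrow> 'k::field_char_0"
  shows "(\<Sum>z<2 * r. (\<Sum>w<2 * r. v w * sform r w z) * v z) = 0"
proof -
  let ?I = "\<Sum>z<2 * r. \<Sum>w<2 * r. v w * sform r w z * v z"
  have "?I = (\<Sum>z<2 * r. \<Sum>w<2 * r. - (v z * sform r z w * v w))"
    by (intro sum.cong refl) (subst sform_antisym, simp)
  also have "\<dots> = - ?I" by (subst sum.swap) (simp add: sum_negf)
  finally have "?I = 0" by simp
  then show ?thesis by (simp add: sum_distrib_right)
qed

lemma sum_of_bool_mult:
  fixes f :: "nat \<Rightarrow> 'k::comm_ring_1"
  assumes "i < n"
  shows "(\<Sum>z<n. of_bool (z = i) * f z) = f i" "(\<Sum>z<n. of_bool (i = z) * f z) = f i"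
    "(\<Sum>z<n. f z * of_bool (z = i)) = f i" "(\<Sum>z<n. f z * of_bool (i = z)) = f i"
proof -
  have "(\<Sum>z<n. of_bool (z = i) * f z) = (\<Sum>z<n. if z = i then f z else 0)"
    by (intro sum.cong) auto
  then show 1: "(\<Sum>z<n. of_bool (z = i) * f z) = f i" using assms by simp
  have e: "(i = z) = (z = i)" for z by auto
  show "(\<Sum>z<n. of_bool (i = z) * f z) = f i"
    "(\<Sum>z<n. f z * of_bool (z = i)) = f i" "(\<Sum>z<n. f z * of_bool (i = z)) = f i"
    by (simp_all only: e mult.commute[of "f _"] 1)
qed

text \<open>In A^t T A the terms linear in \<open>s\<close> cancel by antisymmetry of T, and the
  quadratic one contains v^t T v = 0.\<close>

lemma transvection_mat_in_Sp: "transvection_mat r v s \<in> (Sp r :: 'k::field_char_0 mat set)"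
proof (rule SpI)
  let ?A = "transvection_mat r v s :: 'k mat" and ?T = "sform r :: nat \<Rightarrow> nat \<Rightarrow> 'k" and ?S = "symp_form r :: 'k mat"
  define tau where "tau j = (\<Sum>w<2 * r. v w * ?T w j)" for j
  have At: "transpose_mat ?A \<in> carrier_mat (2 * r) (2 * r)" by simp
  have AtS: "transpose_mat ?A * ?S \<in> carrier_mat (2 * r) (2 * r)"
    by (rule mult_carrier_mat[OF At symp_form_carrier])
  have Ai: "?A $$ (i, j) = of_bool (i = j) + s * (v i * tau j)" if "i < 2 * r" "j < 2 * r" for i j
    using that by (simp add: transvection_mat_index tau_def)
  have "(transpose_mat ?A * ?S * ?A) $$ (i, j) = ?S $$ (i, j)" if ij: "i < 2 * r" "j < 2 * r" for i j
  proof -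
    have 1: "(transpose_mat ?A * ?S) $$ (i, z) = ?T i z + s * tau i * tau z" if z: "z < 2 * r" for z
    proof -
      have "(transpose_mat ?A * ?S) $$ (i, z) = (\<Sum>x<2 * r. ?A $$ (x, i) * ?T x z)"
        unfolding mult_mat_index[OF At symp_form_carrier ij(1) z]
        by (intro sum.cong refl)
           (use ij z carrier_matD[OF transvection_mat_carrier[of r v s]] in \<open>auto simp: symp_form_sform\<close>)
      also have "\<dots> = (\<Sum>x<2 * r. of_bool (x = i) * ?T x z + s * tau i * (v x * ?T x z))"
        using ij by (intro sum.cong refl) (simp add: Ai algebra_simps)
      also have "\<dots> = ?T i z + s * tau i * tau z"
        using ij by (simp only: sum.distrib sum_of_bool_mult sum_distrib_left[symmetric] tau_def)
      finally show ?thesis .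
    qed
    have "(transpose_mat ?A * ?S * ?A) $$ (i, j) = (\<Sum>z<2 * r. (?T i z + s * tau i * tau z) * ?A $$ (z, j))"
      unfolding mult_mat_index[OF AtS transvection_mat_carrier ij] by (intro sum.cong refl) (simp add: 1)
    also have "\<dots> = (\<Sum>z<2 * r. of_bool (z = j) * (?T i z + s * tau i * tau z)
        + (s * tau j * (?T i z * v z) + s * s * tau i * tau j * (tau z * v z)))"
      using ij by (intro sum.cong refl) (simp add: Ai algebra_simps)
    also have "\<dots> = (?T i j + s * tau i * tau j)
        + (s * tau j * (\<Sum>z<2 * r. ?T i z * v z) + s * s * tau i * tau j * (\<Sum>z<2 * r. tau z * v z))"
      using ij by (simp only: sum.distrib sum_of_bool_mult sum_distrib_left[symmetric])
    also have "(\<Sum>z<2 * r. ?T i z * v z) = - tau i"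
      unfolding tau_def sum_negf[symmetric] by (intro sum.cong refl) (subst sform_antisym, simp)
    also have "(\<Sum>z<2 * r. tau z * v z) = 0"
      unfolding tau_def by (rule sform_isotropic)
    finally show ?thesis using ij by (simp add: symp_form_sform algebra_simps)
  qed
  then show "transpose_mat ?A * ?S * ?A = ?S"
    using carrier_matD[OF symp_form_carrier[of r, where 'k = 'k]] carrier_matD[OF transvection_mat_carrier[of r v s]]
    by (intro eq_matI) auto
qed simp

text \<open>The quadratic term again contains v^t T v = 0. An explicit inverse is wanted because the
  second group acts through \<open>mat_inverse\<close>.\<close>

lemma transvection_mat_inverse:
  "transvection_mat r v s * transvection_mat r v (- s) = (1\<^sub>m (2 * r) :: 'k::field_char_0 mat)"
proof -
  let ?A = "transvection_mat r v s :: 'k mat" and ?B = "transvection_mat r v (- s) :: 'k mat"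
  define tau where "tau j = (\<Sum>w<2 * r. v w * sform r w j)" for j
  have Ai: "transvection_mat r v c $$ (i, j) = of_bool (i = j) + c * (v i * tau j)"
    if "i < 2 * r" "j < 2 * r" for i j and c :: 'k
    using that by (simp add: transvection_mat_index tau_def)
  have "(?A * ?B) $$ (i, j) = of_bool (i = j)" if ij: "i < 2 * r" "j < 2 * r" for i j
  proof -
    have "(?A * ?B) $$ (i, j) = (\<Sum>x<2 * r. of_bool (i = x) * (of_bool (x = j) - s * (v x * tau j))
        + (s * v i * (tau x * of_bool (x = j)) - s * s * v i * tau j * (tau x * v x)))"
      unfolding mult_mat_index[OF transvection_mat_carrier transvection_mat_carrier ij]
      using ij by (intro sum.cong refl) (simp add: Ai algebra_simps)
    also have "\<dots> = (of_bool (i = j) - s * (v i * tau j))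
        + (s * v i * tau j - s * s * v i * tau j * (\<Sum>x<2 * r. tau x * v x))"
      using ij by (simp only: sum.distrib sum_subtractf sum_of_bool_mult sum_distrib_left[symmetric])
    also have "(\<Sum>x<2 * r. tau x * v x) = 0"
      unfolding tau_def by (rule sform_isotropic)
    finally show ?thesis by simp
  qed
  then show ?thesis
    using carrier_matD[OF transvection_mat_carrier[of r v s]] carrier_matD[OF transvection_mat_carrier[of r v "- s"]]
    by (intro eq_matI) auto
qed

section \<open>Polynomial functions as tensors\<close>

definition coord :: "(nat \<Rightarrow> 'k mat) \<Rightarrow> nat \<times> nat \<times> nat \<Rightarrow> 'k" where
  "coord M e = M (fst e) $$ (fst (snd e), snd (snd e))"

abbreviation coord_set :: "nat \<Rightarrow> nat \<Rightarrow> nat \<Rightarrow> (nat \<times> nat \<times> nat) set" where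
  "coord_set m n d \<equiv> {1..d} \<times> {..<m} \<times> {..<n}"

text \<open>A polynomial is a list of terms, each a coefficient with the list of its coordinate
  factors. The length of that list is the degree, and its positions are the arguments to be
  polarised. As \<open>h\<close> assigns values to coordinates, terms can be evaluated at sums of
  vectors.\<close>

definition eval_terms :: "('k::field \<times> 'e list) list \<Rightarrow> ('e \<Rightarrow> 'k) \<Rightarrow> 'k" where
  "eval_terms ts h = (\<Sum>(c, es)\<leftarrow>ts. c * prod_list (map h es))"

lemma eval_terms_simps [simp]:
  "eval_terms [] h = 0"
  "eval_terms ((c, es) # ts) h = c * prod_list (map h es) + eval_terms ts h"
  "eval_terms (ts @ ts') h = eval_terms ts h + eval_terms ts' h"
  by (simp_all add: eval_terms_def)

lemma eval_terms_cong:
  "(\<And>c es e. (c, es) \<in> set ts \<Longrightarrow> e \<in> set es \<Longrightarrow> h e = h' e) \<Longrightarrow> eval_terms ts h = eval_terms ts h'"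
proof (induction ts)
  case (Cons t ts)
  obtain c es where t: "t = (c, es)" by force
  have "map h es = map h' es" using Cons.prems[of c es] t by simp
  moreover have "eval_terms ts h = eval_terms ts h'"
    by (rule Cons.IH) (rule Cons.prems, rule list.set_intros(2))
  ultimately show ?case by (simp only: t eval_terms_simps)
qed simp

lemma eval_terms_mult:
  "eval_terms (concat (map (\<lambda>(c, es). map (\<lambda>(c', es'). (c * c', es @ es')) ts') ts)) h
    = eval_terms ts h * eval_terms ts' h"
proof (induction ts)
  case (Cons t ts)
  obtain c es where t: "t = (c, es)" by force
  have "eval_terms (map (\<lambda>(c', es'). (c * c', es @ es')) ts') h
      = c * prod_list (map h es) * eval_terms ts' h"
    by (induction ts') (auto simp: algebra_simps)
  then show ?case using Cons t by (simp add: algebra_simps)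
qed simp

lemma polynomial_function_eq_eval_terms:
  fixes f :: "(nat \<Rightarrow> 'k::field mat) \<Rightarrow> 'k"
  assumes "f \<in> polynomial_functions m n d"
  shows "\<exists>ts. (\<forall>(c, es)\<in>set ts. set es \<subseteq> coord_set m n d)
    \<and> f = (\<lambda>M\<in>mat_tuples m n d. eval_terms ts (coord M))"
  using assms unfolding polynomial_functions_def
proof (induction rule: generated_algebra.induct)
  case (generator f)
  then obtain i a b where "f = (\<lambda>M. M i $$ (a, b))" "i \<in> {1..d}" "a < m" "b < n" by blast
  then show ?case by (intro exI[of _ "[(1, [(i, a, b)])]"]) (simp add: coord_def)
next
  case (const c)
  then show ?case by (intro exI[of _ "[(c, [])]"]) simp
next
  case (add f g)
  then obtain ts ts' where t: "\<forall>(c, es)\<in>set ts. set es \<subseteq> coord_set m n d"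
      "f = (\<lambda>M\<in>mat_tuples m n d. eval_terms ts (coord M))"
    and t': "\<forall>(c, es)\<in>set ts'. set es \<subseteq> coord_set m n d"
      "g = (\<lambda>M\<in>mat_tuples m n d. eval_terms ts' (coord M))" by blast
  show ?case
  proof (intro exI conjI)
    show "\<forall>(c, es)\<in>set (ts @ ts'). set es \<subseteq> coord_set m n d" using t(1) t'(1) by auto
    show "(\<lambda>M\<in>mat_tuples m n d. f M + g M) = (\<lambda>M\<in>mat_tuples m n d. eval_terms (ts @ ts') (coord M))"
      by (rule restrict_ext) (simp add: t(2) t'(2))
  qed
next
  case (mult f g)
  then obtain ts ts' where t: "\<forall>(c, es)\<in>set ts. set es \<subseteq> coord_set m n d"
      "f = (\<lambda>M\<in>mat_tuples m n d. eval_terms ts (coord M))"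
    and t': "\<forall>(c, es)\<in>set ts'. set es \<subseteq> coord_set m n d"
      "g = (\<lambda>M\<in>mat_tuples m n d. eval_terms ts' (coord M))" by blast
  let ?ts = "concat (map (\<lambda>(c, es). map (\<lambda>(c', es'). (c * c', es @ es')) ts') ts)"
  show ?case
  proof (intro exI conjI)
    show "\<forall>(c, es)\<in>set ?ts. set es \<subseteq> coord_set m n d" using t(1) t'(1) by fastforce
    show "(\<lambda>M\<in>mat_tuples m n d. f M * g M) = (\<lambda>M\<in>mat_tuples m n d. eval_terms ?ts (coord M))"
      by (rule restrict_ext) (simp add: t(2) t'(2) eval_terms_mult)
  qed
qed

section \<open>Full polarisation\<close>

definition perms :: "nat \<Rightarrow> (nat \<Rightarrow> nat) set" where
  "perms D = {g \<in> words D {..<D}. g ` {..<D} = {..<D}}"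

lemma finite_perms [simp]: "finite (perms D)"
  by (simp add: perms_def)

text \<open>The full polarisation of the part of degree \<open>D\<close>, evaluated at the vectors \<open>h 0, \<dots>, h (D - 1)\<close>.\<close>

definition polar :: "nat \<Rightarrow> ('k::field \<times> 'e list) list \<Rightarrow> (nat \<Rightarrow> 'e \<Rightarrow> 'k) \<Rightarrow> 'k" where
  "polar D ts h = (\<Sum>(c, es)\<leftarrow>filter (\<lambda>(c, es). length es = D) ts.
     c * (\<Sum>g\<in>perms D. \<Prod>k<D. h (g k) (es ! k)))"

lemma prod_list_map_nth: "prod_list (map h es) = (\<Prod>k<length es. h (es ! k))"
  by (simp add: prod.list_conv_set_nth atLeast0LessThan)

lemma polar_cong:
  assumes "\<And>c es e k. (c, es) \<in> set ts \<Longrightarrow> e \<in> set es \<Longrightarrow> k < D \<Longrightarrow> h k e = h' k e"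
  shows "polar D ts h = polar D ts h'"
proof -
  have "(\<Sum>g\<in>perms D. \<Prod>k<D. h (g k) (es ! k)) = (\<Sum>g\<in>perms D. \<Prod>k<D. h' (g k) (es ! k))"
    if "(c, es) \<in> set ts" "length es = D" for c es
  proof (intro sum.cong prod.cong refl)
    fix g k assume "g \<in> perms D" "k \<in> {..<D}"
    then show "h (g k) (es ! k) = h' (g k) (es ! k)"
      using assms[OF that(1), of "es ! k" "g k"] that(2) words_less[of g D "{..<D}" k]
      by (simp add: perms_def)
  qed
  then show ?thesis unfolding polar_def
    by (intro arg_cong[where f = sum_list] map_cong refl) auto
qed

text \<open>By inclusion-exclusion a term of degree below \<open>D\<close> contributes 0 and one of
  degree \<open>D\<close> its sum over permutations. The left-hand side involves the polynomial only
  through its values, so invariance passes to \<open>polar\<close>.\<close>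

lemma sum_eval_terms_eq_polar:
  assumes "\<And>c es. (c, es) \<in> set ts \<Longrightarrow> length es \<le> D"
  shows "(\<Sum>S\<in>Pow {..<D}. (- 1) ^ (D - card S) * eval_terms ts (\<lambda>e. \<Sum>j\<in>S. h j e)) = polar D ts h"
  using assms
proof (induction ts)
  case (Cons t ts)
  obtain c es where t: "t = (c, es)" by force
  let ?l = "length es"
  have "(\<Sum>S\<in>Pow {..<D}. (- 1) ^ (D - card S) * prod_list (map (\<lambda>e. \<Sum>j\<in>S. h j e) es))
    = (\<Sum>g | g \<in> words D {..<?l} \<and> g ` {..<?l} = {..<D}. \<Prod>k<?l. h (g k) (es ! k))"
    unfolding prod_list_map_nth by (rule sum_signed_prod_eq_surjections)
  also have "\<dots> = (if ?l = D then (\<Sum>g\<in>perms D. \<Prod>k<D. h (g k) (es ! k)) else 0)"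
  proof (cases "?l = D")
    case True
    then show ?thesis by (simp add: perms_def)
  next
    case False
    then have "?l < D" using Cons.prems[of c es] t by simp
    then have "g ` {..<?l} \<noteq> {..<D}" for g :: "nat \<Rightarrow> nat"
      using card_image_le[of "{..<?l}" g] by auto
    then show ?thesis using False by simp
  qed
  finally have "(\<Sum>S\<in>Pow {..<D}. (- 1) ^ (D - card S) * (c * prod_list (map (\<lambda>e. \<Sum>j\<in>S. h j e) es)))
    = c * (if ?l = D then (\<Sum>g\<in>perms D. \<Prod>k<D. h (g k) (es ! k)) else 0)"
    by (simp only: mult.left_commute[of _ c] sum_distrib_left[symmetric])
  moreover have "(\<Sum>S\<in>Pow {..<D}. (- 1) ^ (D - card S) * eval_terms ts (\<lambda>e. \<Sum>j\<in>S. h j e)) = polar D ts h"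
    by (rule Cons.IH) (rule Cons.prems, rule list.set_intros(2))
  ultimately show ?case
    by (simp add: t distrib_left sum.distrib polar_def)
qed (simp add: polar_def)

text \<open>Multilinearity: \<open>polar\<close> is determined by its values at basis vectors, the
  vector in argument \<open>j\<close> being the indicator of the coordinate
  \<open>z j\<close>.\<close>

lemma polar_expand:
  fixes h :: "nat \<Rightarrow> 'e \<Rightarrow> 'k::field"
  assumes Z: "finite Z" and ts: "\<And>c es. (c, es) \<in> set ts \<Longrightarrow> set es \<subseteq> Z"
  shows "polar D ts h
    = (\<Sum>z\<in>{..<D} \<rightarrow>\<^sub>E Z. polar D ts (\<lambda>j e. of_bool (e = z j)) * (\<Prod>j<D. h j (z j)))"
proof -
  let ?W = "{..<D} \<rightarrow>\<^sub>E Z"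
  have fW: "finite ?W" using Z by (simp add: finite_PiE)
  have 1: "(\<Prod>k<D. h (g k) (es ! k)) = (\<Sum>z\<in>?W. (\<Prod>k<D. of_bool (es ! k = z (g k))) * (\<Prod>j<D. h j (z j)))"
    if es: "set es \<subseteq> Z" "length es = D" and g: "g \<in> perms D" for es g
  proof -
    have bij: "bij_betw g {..<D} {..<D}"
      using g by (simp add: perms_def bij_betw_def eq_card_imp_inj_on)
    \<comment> \<open>The only choice of basis vectors at which the monomial \<open>es\<close>, with
      arguments permuted by \<open>g\<close>, does not vanish.\<close>
    define z0 where "z0 = (\<lambda>j\<in>{..<D}. es ! inv_into {..<D} g j)"
    have z0g: "z0 (g k) = es ! k" if "k < D" for k
      using that bij by (auto simp: z0_def bij_betw_def inv_into_f_f)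
    have z0W: "z0 \<in> ?W"
    proof -
      have "inv_into {..<D} g j < D" if "j < D" for j
        using that bij inv_into_into[of j g "{..<D}"] by (auto simp: bij_betw_def)
      then show ?thesis using es nth_mem unfolding z0_def by (auto intro!: subsetD[OF es(1)])
    qed
    have "(\<Prod>k<D. of_bool (es ! k = z (g k))) = (of_bool (z = z0) :: 'k)" if z: "z \<in> ?W" for z
    proof (cases "z = z0")
      case True
      then show ?thesis by (auto intro!: prod.neutral simp: z0g)
    next
      case False
      then obtain j where "j < D" "z j \<noteq> z0 j"
        using z z0W by (metis PiE_ext lessThan_iff)
      then obtain k where "k < D" "z (g k) \<noteq> z0 (g k)"
        using bij by (metis bij_betw_imp_surj_on imageE lessThan_iff)
      then have "(\<Prod>k<D. of_bool (es ! k = z (g k))) = (0 :: 'k)"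
        by (intro prod_zero) (auto simp: z0g intro!: bexI[of _ k])
      then show ?thesis using False by simp
    qed
    then have "(\<Sum>z\<in>?W. (\<Prod>k<D. of_bool (es ! k = z (g k))) * (\<Prod>j<D. h j (z j)))
      = (\<Sum>z\<in>?W. if z = z0 then (\<Prod>j<D. h j (z j)) else 0)"
      by (intro sum.cong) auto
    also have "\<dots> = (\<Prod>j<D. h j (z0 j))" using fW z0W by simp
    also have "\<dots> = (\<Prod>k<D. h (g k) (z0 (g k)))"
      by (rule prod.reindex_bij_betw[OF bij, symmetric])
    also have "\<dots> = (\<Prod>k<D. h (g k) (es ! k))" by (simp add: z0g)
    finally show ?thesis by simp
  qed
  show ?thesis
    using ts
  proof (induction ts)
    case (Cons t ts)
    obtain c es where t: "t = (c, es)" by force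
    have IH: "polar D ts h = (\<Sum>z\<in>?W. polar D ts (\<lambda>j e. of_bool (e = z j)) * (\<Prod>j<D. h j (z j)))"
      using Cons by auto
    show ?case
    proof (cases "length es = D")
      case True
      have es: "set es \<subseteq> Z" using Cons.prems[of c es] t by simp
      have "c * (\<Sum>g\<in>perms D. \<Prod>k<D. h (g k) (es ! k))
        = c * (\<Sum>g\<in>perms D. \<Sum>z\<in>?W. (\<Prod>k<D. of_bool (es ! k = z (g k))) * (\<Prod>j<D. h j (z j)))"
        using 1[OF es True] by simp
      also have "\<dots> = (\<Sum>z\<in>?W. c * (\<Sum>g\<in>perms D. \<Prod>k<D. of_bool (es ! k = z (g k))) * (\<Prod>j<D. h j (z j)))"
        by (subst sum.swap) (simp only: sum_distrib_left sum_distrib_right mult.assoc)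
      finally show ?thesis
        using IH True by (simp add: polar_def t sum.distrib distrib_right)
    next
      case False
      then show ?thesis using IH by (simp add: polar_def t)
    qed
  qed (simp add: polar_def)
qed

text \<open>The factor is D!, invertible in characteristic 0: equal arguments recover the part of
  degree \<open>D\<close>.\<close>

lemma polar_diag:
  "polar D ts (\<lambda>j. h) = of_nat (card (perms D)) * eval_terms (filter (\<lambda>(c, es). length es = D) ts) h"
  by (induction ts) (auto simp: polar_def prod_list_map_nth algebra_simps)

lemma card_perms_pos: "card (perms D) > 0"
proof -
  have "restrict id {..<D} \<in> perms D" by (auto simp: perms_def words_def)
  then show ?thesis by (auto simp: card_gt_0_iff)
qed


section \<open>The group action on polarised polynomials\<close>

definition tuple_sum :: "nat \<Rightarrow> nat \<Rightarrow> nat \<Rightarrow> 'j set \<Rightarrow> ('j \<Rightarrow> nat \<Rightarrow> 'k::field mat) \<Rightarrow> nat \<Rightarrow> 'k mat" where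
  "tuple_sum m n d S Ms = (\<lambda>i\<in>{1..d}. mat m n (\<lambda>(a, b). \<Sum>k\<in>S. Ms k i $$ (a, b)))"

lemma tuple_sum_closed: "tuple_sum m n d S Ms \<in> mat_tuples m n d"
  by (auto simp: tuple_sum_def mat_tuples_def)

lemma coord_tuple_sum:
  "e \<in> coord_set m n d \<Longrightarrow> coord (tuple_sum m n d S Ms) e = (\<Sum>k\<in>S. coord (Ms k) e)"
  by (auto simp: tuple_sum_def coord_def)

definition unit_tuple :: "nat \<Rightarrow> nat \<Rightarrow> nat \<Rightarrow> nat \<times> nat \<times> nat \<Rightarrow> nat \<Rightarrow> 'k::field mat" where
  "unit_tuple m n d z = (\<lambda>i\<in>{1..d}. mat m n (\<lambda>(a, b). of_bool ((i, a, b) = z)))"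

lemma unit_tuple_closed: "unit_tuple m n d z \<in> mat_tuples m n d"
  by (auto simp: unit_tuple_def mat_tuples_def)

lemma coord_unit_tuple: "e \<in> coord_set m n d \<Longrightarrow> coord (unit_tuple m n d z) e = of_bool (e = z)"
  by (auto simp: unit_tuple_def coord_def)

lemma coord_tuple_action:
  fixes M :: "nat \<Rightarrow> 'k::field mat"
  assumes A: "A \<in> carrier_mat m m" and B: "mat_inverse B = Some C" and C: "C \<in> carrier_mat n n"
    and M: "M \<in> mat_tuples m n d" and e: "(i, a, b) \<in> coord_set m n d"
  shows "coord (tuple_action d (A, B) M) (i, a, b)
    = (\<Sum>x<m. \<Sum>y<n. A $$ (a, x) * coord M (i, x, y) * C $$ (y, b))"
  using tuple_action_index[OF A B C M, of i a b] e by (simp add: coord_def)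

lemma coord_tuple_action_sum:
  fixes Ms :: "nat \<Rightarrow> nat \<Rightarrow> 'k::field mat"
  assumes A: "A \<in> carrier_mat m m" and B: "mat_inverse B = Some C" and C: "C \<in> carrier_mat n n"
    and Ms: "\<And>k. Ms k \<in> mat_tuples m n d" and e: "e \<in> coord_set m n d"
  shows "coord (tuple_action d (A, B) (tuple_sum m n d S Ms)) e
    = (\<Sum>k\<in>S. coord (tuple_action d (A, B) (Ms k)) e)"
proof -
  obtain i a b where ie: "e = (i, a, b)" by (metis prod_cases3)
  have "coord (tuple_action d (A, B) (tuple_sum m n d S Ms)) e
    = (\<Sum>x<m. \<Sum>y<n. A $$ (a, x) * (\<Sum>k\<in>S. coord (Ms k) (i, x, y)) * C $$ (y, b))"
    unfolding ie coord_tuple_action[OF A B C tuple_sum_closed e[unfolded ie]]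
    using e ie by (intro sum.cong refl) (auto simp: coord_tuple_sum)
  also have "\<dots> = (\<Sum>x<m. \<Sum>y<n. \<Sum>k\<in>S. A $$ (a, x) * coord (Ms k) (i, x, y) * C $$ (y, b))"
    by (simp only: sum_distrib_left sum_distrib_right)
  also have "\<dots> = (\<Sum>x<m. \<Sum>k\<in>S. \<Sum>y<n. A $$ (a, x) * coord (Ms k) (i, x, y) * C $$ (y, b))"
    by (rule sum.cong[OF refl], rule sum.swap)
  also have "\<dots> = (\<Sum>k\<in>S. \<Sum>x<m. \<Sum>y<n. A $$ (a, x) * coord (Ms k) (i, x, y) * C $$ (y, b))"
    by (rule sum.swap)
  also have "\<dots> = (\<Sum>k\<in>S. coord (tuple_action d (A, B) (Ms k)) e)"
    unfolding ie coord_tuple_action[OF A B C Ms e[unfolded ie]] ..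
  finally show ?thesis .
qed

definition terms_over :: "('k \<times> 'e list) list \<Rightarrow> 'e set \<Rightarrow> bool" where
  "terms_over ts Z \<longleftrightarrow> (\<forall>(c, es)\<in>set ts. set es \<subseteq> Z)"

lemma terms_overD: "terms_over ts Z \<Longrightarrow> (c, es) \<in> set ts \<Longrightarrow> e \<in> set es \<Longrightarrow> e \<in> Z"
  by (auto simp: terms_over_def)

definition invariant_terms :: "nat \<Rightarrow> nat \<Rightarrow> nat \<Rightarrow> ('k::field \<times> (nat \<times> nat \<times> nat) list) list \<Rightarrow> bool" where
  "invariant_terms p q d ts \<longleftrightarrow> (\<forall>A\<in>Sp p. \<forall>B\<in>Sp q. \<forall>M\<in>mat_tuples (2 * p) (2 * q) d.
     eval_terms ts (coord (tuple_action d (A, B) M)) = eval_terms ts (coord M))"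

text \<open>\<open>polar\<close> is a signed sum of values of the polynomial at partial sums of the
  arguments. The action is linear, so it commutes with these sums, and each value is
  invariant.\<close>

lemma polar_tuple_action:
  fixes ts :: "('k::field_char_0 \<times> (nat \<times> nat \<times> nat) list) list"
  assumes ts: "terms_over ts (coord_set (2 * p) (2 * q) d)"
    and D: "\<And>c es. (c, es) \<in> set ts \<Longrightarrow> length es \<le> D"
    and inv: "invariant_terms p q d ts"
    and A: "A \<in> Sp p" and B: "B \<in> Sp q"
    and Ms: "\<And>k. Ms k \<in> mat_tuples (2 * p) (2 * q) d"
  shows "polar D ts (\<lambda>j. coord (tuple_action d (A, B) (Ms j))) = polar D ts (\<lambda>j. coord (Ms j))"
proof -
  let ?s = "\<lambda>S. tuple_sum (2 * p) (2 * q) d S Ms"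
  obtain C where C: "C \<in> carrier_mat (2 * q) (2 * q)" "mat_inverse B = Some C"
    using Sp_inverse[OF B] by metis
  have "polar D ts (\<lambda>j. coord (tuple_action d (A, B) (Ms j)))
    = (\<Sum>S\<in>Pow {..<D}. (- 1) ^ (D - card S) * eval_terms ts (\<lambda>e. \<Sum>j\<in>S. coord (tuple_action d (A, B) (Ms j)) e))"
    using sum_eval_terms_eq_polar[of ts D "\<lambda>j. coord (tuple_action d (A, B) (Ms j))"] D by simp
  also have "\<dots> = (\<Sum>S\<in>Pow {..<D}. (- 1) ^ (D - card S) * eval_terms ts (\<lambda>e. \<Sum>j\<in>S. coord (Ms j) e))"
  proof (intro sum.cong refl arg_cong2[where f = "(*)"])
    fix S
    have "eval_terms ts (\<lambda>e. \<Sum>j\<in>S. coord (tuple_action d (A, B) (Ms j)) e)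
      = eval_terms ts (coord (tuple_action d (A, B) (?s S)))"
      by (rule eval_terms_cong)
         (rule coord_tuple_action_sum[OF SpD(1)[OF A] C(2,1) Ms terms_overD[OF ts], symmetric])
    also have "\<dots> = eval_terms ts (coord (?s S))"
      using inv A B tuple_sum_closed unfolding invariant_terms_def by blast
    also have "\<dots> = eval_terms ts (\<lambda>e. \<Sum>j\<in>S. coord (Ms j) e)"
      by (rule eval_terms_cong) (rule coord_tuple_sum[OF terms_overD[OF ts]])
    finally show "eval_terms ts (\<lambda>e. \<Sum>j\<in>S. coord (tuple_action d (A, B) (Ms j)) e)
      = eval_terms ts (\<lambda>e. \<Sum>j\<in>S. coord (Ms j) e)" .
  qed
  also have "\<dots> = polar D ts (\<lambda>j. coord (Ms j))"
    using sum_eval_terms_eq_polar[of ts D "\<lambda>j. coord (Ms j)"] D by simp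
  finally show ?thesis .
qed

lemma sum_PiE_Times:
  assumes "finite A"
  shows "(\<Sum>z\<in>A \<rightarrow>\<^sub>E B \<times> C. F z) = (\<Sum>x\<in>A \<rightarrow>\<^sub>E B. \<Sum>y\<in>A \<rightarrow>\<^sub>E C. F (\<lambda>j\<in>A. (x j, y j)))"
proof -
  have "(\<Sum>x\<in>A \<rightarrow>\<^sub>E B. \<Sum>y\<in>A \<rightarrow>\<^sub>E C. F (\<lambda>j\<in>A. (x j, y j)))
    = (\<Sum>xy\<in>(A \<rightarrow>\<^sub>E B) \<times> (A \<rightarrow>\<^sub>E C). F (\<lambda>j\<in>A. (fst xy j, snd xy j)))"
    by (simp add: sum.cartesian_product case_prod_unfold)
  also have "\<dots> = (\<Sum>z\<in>A \<rightarrow>\<^sub>E B \<times> C. F z)"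
  proof (rule sum.reindex_bij_witness[of _ "\<lambda>z. (\<lambda>j\<in>A. fst (z j), \<lambda>j\<in>A. snd (z j))"
        "\<lambda>xy. \<lambda>j\<in>A. (fst xy j, snd xy j)"], goal_cases)
    case (1 xy)
    then have "fst xy \<in> A \<rightarrow>\<^sub>E B" "snd xy \<in> A \<rightarrow>\<^sub>E C" by auto
    then have "(\<lambda>j\<in>A. fst xy j) = fst xy" "(\<lambda>j\<in>A. snd xy j) = snd xy"
      by (simp_all add: PiE_restrict)
    then show ?case by (simp add: prod_eq_iff cong: restrict_cong)
  next
    case (2 xy)
    then show ?case by auto
  next
    case (3 z)
    then have "(\<lambda>j\<in>A. z j) = z" by (simp add: PiE_restrict)
    then show ?case by (simp cong: restrict_cong)
  next
    case (4 z)
    then have "z j \<in> B \<times> C" if "j \<in> A" for j using that by auto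
    then show ?case by (auto simp: mem_Times_iff)
  next
    case (5 xy)
    then show ?case by simp
  qed
  finally show ?thesis by simp
qed

text \<open>The coefficients of the multilinear form \<open>polar D ts\<close>: slot
  \<open>j\<close> carries the matrix index \<open>i j\<close>, the V-index \<open>x j\<close> and
  the W-index \<open>y j\<close>.\<close>

definition tensor :: "nat \<Rightarrow> ('k::field \<times> (nat \<times> nat \<times> nat) list) list
    \<Rightarrow> (nat \<Rightarrow> nat) \<Rightarrow> (nat \<Rightarrow> nat) \<Rightarrow> (nat \<Rightarrow> nat) \<Rightarrow> 'k" where
  "tensor D ts i x y = polar D ts (\<lambda>j e. of_bool (e = (i j, x j, y j)))"

lemma polar_eq_sum_tensor:
  fixes h :: "nat \<Rightarrow> nat \<times> nat \<times> nat \<Rightarrow> 'k::field"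
  assumes "terms_over ts (coord_set m n d)"
  shows "polar D ts h = (\<Sum>i\<in>{..<D} \<rightarrow>\<^sub>E {1..d}. \<Sum>x\<in>words m {..<D}. \<Sum>y\<in>words n {..<D}.
     tensor D ts i x y * (\<Prod>j<D. h j (i j, x j, y j)))"
proof -
  have fin: "finite (coord_set m n d)" by simp
  have sub: "set es \<subseteq> coord_set m n d" if "(c, es) \<in> set ts" for c es
    using assms that by (auto simp: terms_over_def)
  have "polar D ts h = (\<Sum>z\<in>{..<D} \<rightarrow>\<^sub>E coord_set m n d.
      polar D ts (\<lambda>j e. of_bool (e = z j)) * (\<Prod>j<D. h j (z j)))"
    by (rule polar_expand[OF fin]) (rule sub)
  also have "\<dots> = (\<Sum>i\<in>{..<D} \<rightarrow>\<^sub>E {1..d}. \<Sum>x\<in>{..<D} \<rightarrow>\<^sub>E {..<m}. \<Sum>y\<in>{..<D} \<rightarrow>\<^sub>E {..<n}.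
     (\<lambda>z. polar D ts (\<lambda>j e. of_bool (e = z j)) * (\<Prod>j<D. h j (z j)))
       (\<lambda>j\<in>{..<D}. (i j, (\<lambda>j\<in>{..<D}. (x j, y j)) j)))"
    by (simp only: sum_PiE_Times finite_lessThan)
  also have "\<dots> = (\<Sum>i\<in>{..<D} \<rightarrow>\<^sub>E {1..d}. \<Sum>x\<in>words m {..<D}. \<Sum>y\<in>words n {..<D}.
     tensor D ts i x y * (\<Prod>j<D. h j (i j, x j, y j)))"
    unfolding words_def tensor_def
    by (intro sum.cong refl arg_cong2[where f = "(*)"] prod.cong polar_cong) auto
  finally show ?thesis .
qed

lemma prod_of_bool_eq:
  assumes "finite A" "f \<in> A \<rightarrow>\<^sub>E B" "g \<in> A \<rightarrow>\<^sub>E B"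
  shows "(\<Prod>j\<in>A. of_bool (f j = g j)) = (of_bool (f = g) :: 'k::comm_semiring_1)"
proof (cases "f = g")
  case False
  then obtain j where "j \<in> A" "f j \<noteq> g j" using assms by (metis PiE_ext)
  then have "(\<Prod>j\<in>A. of_bool (f j = g j)) = (0::'k)"
    using assms(1) by (intro prod_zero) auto
  then show ?thesis using False by simp
qed simp

lemma sum_of_bool_eq:
  fixes F :: "'x \<Rightarrow> 'k::comm_semiring_1"
  assumes "finite X" "a \<in> X"
  shows "(\<Sum>x\<in>X. of_bool (x = a) * F x) = F a"
proof -
  have "(\<Sum>x\<in>X. of_bool (x = a) * F x) = (\<Sum>x\<in>X. if x = a then F x else 0)"
    by (intro sum.cong) auto
  then show ?thesis using assms by simp
qed

text \<open>\<open>polar\<close> is evaluated at elementary matrices. The group turns the one in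
  slot \<open>j\<close> into the matrix with entries \<open>A $$ (a, x j) * C $$ (y j, b)\<close>,
  still at position \<open>i j\<close> of the tuple. Expanding in elementary matrices again gives
  the sum, with \<open>i\<close> unchanged.\<close>

lemma tensor_invariant:
  fixes ts :: "('k::field_char_0 \<times> (nat \<times> nat \<times> nat) list) list"
  assumes ts: "terms_over ts (coord_set (2 * p) (2 * q) d)"
    and D: "\<And>c es. (c, es) \<in> set ts \<Longrightarrow> length es \<le> D"
    and inv: "invariant_terms p q d ts"
    and A: "A \<in> Sp p" and B: "B \<in> Sp q"
    and C: "C \<in> carrier_mat (2 * q) (2 * q)" "B * C = 1\<^sub>m (2 * q)"
    and i: "i \<in> {..<D} \<rightarrow>\<^sub>E {1..d}" and x: "x \<in> words (2 * p) {..<D}" and y: "y \<in> words (2 * q) {..<D}"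
  shows "tensor D ts i x y = (\<Sum>x'\<in>words (2 * p) {..<D}. \<Sum>y'\<in>words (2 * q) {..<D}.
    tensor D ts i x' y' * ((\<Prod>j<D. A $$ (x' j, x j)) * (\<Prod>j<D. C $$ (y j, y' j))))"
proof -
  let ?Z = "coord_set (2 * p) (2 * q) d"
  define E :: "nat \<Rightarrow> nat \<Rightarrow> 'k mat" where "E j = unit_tuple (2 * p) (2 * q) d (i j, x j, y j)" for j
  have EX: "E j \<in> mat_tuples (2 * p) (2 * q) d" for j by (simp add: E_def unit_tuple_closed)
  have BC: "mat_inverse B = Some C" by (rule mat_inverse_eqI[OF SpD(1)[OF B] C])
  have act: "coord (tuple_action d (A, B) (E j)) (i', a, b)
      = of_bool (i' = i j) * (A $$ (a, x j) * C $$ (y j, b))"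
    if e: "(i', a, b) \<in> ?Z" and j: "j < D" for i' a b j
  proof -
    have xj: "x j < 2 * p" and yj: "y j < 2 * q" using x y j by auto
    have "coord (tuple_action d (A, B) (E j)) (i', a, b)
      = (\<Sum>x'<2 * p. \<Sum>y'<2 * q. A $$ (a, x') * coord (E j) (i', x', y') * C $$ (y', b))"
      by (rule coord_tuple_action[OF SpD(1)[OF A] BC C(1) EX e])
    also have "\<dots> = (\<Sum>x'<2 * p. \<Sum>y'<2 * q. of_bool (x' = x j) * (of_bool (y' = y j)
        * (of_bool (i' = i j) * (A $$ (a, x') * C $$ (y', b)))))"
    proof (intro sum.cong refl)
      fix x' y' assume "x' \<in> {..<2 * p}" "y' \<in> {..<2 * q}"
      with e have "(i', x', y') \<in> ?Z" by simp
      then have "coord (E j) (i', x', y') = of_bool (x' = x j) * (of_bool (y' = y j) * of_bool (i' = i j))"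
        unfolding E_def by (subst coord_unit_tuple) auto
      then show "A $$ (a, x') * coord (E j) (i', x', y') * C $$ (y', b)
        = of_bool (x' = x j) * (of_bool (y' = y j) * (of_bool (i' = i j) * (A $$ (a, x') * C $$ (y', b))))"
        by (simp only: mult_ac)
    qed
    also have "\<dots> = of_bool (i' = i j) * (A $$ (a, x j) * C $$ (y j, b))"
      using xj yj by (simp only: sum_distrib_left[symmetric] sum_of_bool_eq finite_lessThan lessThan_iff)
    finally show ?thesis .
  qed
  have "tensor D ts i x y = polar D ts (\<lambda>j. coord (E j))"
    unfolding tensor_def
  proof (rule polar_cong)
    fix c es e k assume "(c, es) \<in> set ts" "e \<in> set es"
    then have "e \<in> ?Z" by (rule terms_overD[OF ts])
    then show "of_bool (e = (i k, x k, y k)) = coord (E k) e"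
      unfolding E_def by (rule coord_unit_tuple[symmetric])
  qed
  also have "\<dots> = polar D ts (\<lambda>j. coord (tuple_action d (A, B) (E j)))"
    using polar_tuple_action[where Ms = E, OF ts D inv A B EX] by (rule sym)
  also have "\<dots> = (\<Sum>i'\<in>{..<D} \<rightarrow>\<^sub>E {1..d}. \<Sum>x'\<in>words (2 * p) {..<D}. \<Sum>y'\<in>words (2 * q) {..<D}.
     tensor D ts i' x' y' * (\<Prod>j<D. coord (tuple_action d (A, B) (E j)) (i' j, x' j, y' j)))"
    by (rule polar_eq_sum_tensor[OF ts])
  also have "\<dots> = (\<Sum>i'\<in>{..<D} \<rightarrow>\<^sub>E {1..d}. of_bool (i' = i) * (\<Sum>x'\<in>words (2 * p) {..<D}. \<Sum>y'\<in>words (2 * q) {..<D}.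
     tensor D ts i' x' y' * ((\<Prod>j<D. A $$ (x' j, x j)) * (\<Prod>j<D. C $$ (y j, y' j)))))"
    unfolding sum_distrib_left
  proof (intro sum.cong refl)
    fix i' x' y' assume i': "i' \<in> {..<D} \<rightarrow>\<^sub>E {1..d}" and x': "x' \<in> words (2 * p) {..<D}"
      and y': "y' \<in> words (2 * q) {..<D}"
    have "(\<Prod>j<D. coord (tuple_action d (A, B) (E j)) (i' j, x' j, y' j))
      = (\<Prod>j<D. of_bool (i' j = i j) * (A $$ (x' j, x j) * C $$ (y j, y' j)))"
    proof (rule prod.cong[OF refl])
      fix j assume j': "j \<in> {..<D}"
      have j: "j < D" using j' by simp
      have "(i' j, x' j, y' j) \<in> ?Z"
        using PiE_mem[OF i' j'] words_less[OF x' j'] words_less[OF y' j'] by blast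
      then show "coord (tuple_action d (A, B) (E j)) (i' j, x' j, y' j)
        = of_bool (i' j = i j) * (A $$ (x' j, x j) * C $$ (y j, y' j))"
        using j by (rule act)
    qed
    also have "\<dots> = of_bool (i' = i) * ((\<Prod>j<D. A $$ (x' j, x j)) * (\<Prod>j<D. C $$ (y j, y' j)))"
      by (simp only: prod.distrib prod_of_bool_eq[OF finite_lessThan i' i])
    finally show "tensor D ts i' x' y' * (\<Prod>j<D. coord (tuple_action d (A, B) (E j)) (i' j, x' j, y' j))
      = of_bool (i' = i) * (tensor D ts i' x' y' * ((\<Prod>j<D. A $$ (x' j, x j)) * (\<Prod>j<D. C $$ (y j, y' j))))"
      by (simp only: mult.left_commute)
  qed
  also have "\<dots> = (\<Sum>x'\<in>words (2 * p) {..<D}. \<Sum>y'\<in>words (2 * q) {..<D}.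
    tensor D ts i x' y' * ((\<Prod>j<D. A $$ (x' j, x j)) * (\<Prod>j<D. C $$ (y j, y' j))))"
    by (rule sum_of_bool_eq[OF _ i]) (simp add: finite_PiE)
  finally show ?thesis .
qed

lemma prod_one_mat:
  assumes "x \<in> words N A" "y \<in> words N A" "finite A"
  shows "(\<Prod>j\<in>A. 1\<^sub>m N $$ (x j, y j)) = (of_bool (x = y) :: 'k::field)"
proof -
  have "(\<Prod>j\<in>A. 1\<^sub>m N $$ (x j, y j)) = (\<Prod>j\<in>A. of_bool (x j = y j) :: 'k)"
    using assms by (intro prod.cong refl) auto
  also have "\<dots> = of_bool (x = y)"
    using assms by (intro prod_of_bool_eq) (auto simp: words_def)
  finally show ?thesis .
qed

text \<open>For each index word \<open>i\<close> separately, letting transvections of one group act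
  with the identity of the other makes the tensor infinitesimally invariant in \<open>x\<close> and
  in \<open>y\<close>.\<close>

lemma polar_diag_in_trace_algebra:
  fixes ts :: "('k::field_char_0 \<times> (nat \<times> nat \<times> nat) list) list"
  assumes ts: "terms_over ts (coord_set (2 * p) (2 * q) d)"
    and D: "\<And>c es. (c, es) \<in> set ts \<Longrightarrow> length es \<le> D"
    and inv: "invariant_terms p q d ts"
  shows "(\<lambda>M. polar D ts (\<lambda>j. coord M)) \<in> trace_algebra p q d"
proof -
  let ?V = "words (2 * p) {..<D}" and ?W = "words (2 * q) {..<D}"
  have one: "1\<^sub>m (2 * r) \<in> carrier_mat (2 * r) (2 * r)"
    "1\<^sub>m (2 * r) * 1\<^sub>m (2 * r) = (1\<^sub>m (2 * r) :: 'k mat)" for r by simp_all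
  have inv1: "infinitesimally_invariant (2 * p) (sform p) {..<D} (\<lambda>x. tensor D ts i x y)"
    if i: "i \<in> {..<D} \<rightarrow>\<^sub>E {1..d}" and y: "y \<in> ?W" for i y
  proof (rule infinitesimally_invariant_if_transvection_invariant)
    fix v :: "nat \<Rightarrow> 'k" and s x assume x: "x \<in> ?V"
    have "tensor D ts i x y = (\<Sum>x'\<in>?V. \<Sum>y'\<in>?W. tensor D ts i x' y'
        * ((\<Prod>j<D. transvection_mat p v s $$ (x' j, x j)) * (\<Prod>j<D. 1\<^sub>m (2 * q) $$ (y j, y' j))))"
      by (rule tensor_invariant[OF ts D inv transvection_mat_in_Sp one_in_Sp one i x y])
    also have "\<dots> = (\<Sum>x'\<in>?V. \<Sum>y'\<in>?W. of_bool (y' = y) * (tensor D ts i x' y'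
        * (\<Prod>j<D. transvection_mat p v s $$ (x' j, x j))))"
    proof (intro sum.cong refl)
      fix x' y' assume y': "y' \<in> ?W"
      show "tensor D ts i x' y' * ((\<Prod>j<D. transvection_mat p v s $$ (x' j, x j)) * (\<Prod>j<D. 1\<^sub>m (2 * q) $$ (y j, y' j)))
        = of_bool (y' = y) * (tensor D ts i x' y' * (\<Prod>j<D. transvection_mat p v s $$ (x' j, x j)))"
        unfolding prod_one_mat[OF y y' finite_lessThan] by (cases "y' = y") simp_all
    qed
    also have "\<dots> = (\<Sum>x'\<in>?V. tensor D ts i x' y * (\<Prod>j<D. transvection_mat p v s $$ (x' j, x j)))"
      using y by (simp only: sum_of_bool_eq finite_words finite_lessThan)
    also have "\<dots> = (\<Sum>x'\<in>?V. tensor D ts i x' y * (\<Prod>j<D. transvection (2 * p) (sform p) v s (x' j) (x j)))"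
      using x by (intro sum.cong refl arg_cong2[where f = "(*)"] prod.cong) (simp add: transvection_mat_def)
    finally show "(\<Sum>x'\<in>?V. tensor D ts i x' y * (\<Prod>j<D. transvection (2 * p) (sform p) v s (x' j) (x j)))
      = tensor D ts i x y" by simp
  qed simp
  have inv2: "infinitesimally_invariant (2 * q) (sform q) {..<D} (tensor D ts i x)"
    if i: "i \<in> {..<D} \<rightarrow>\<^sub>E {1..d}" and x: "x \<in> ?V" for i x
  proof (rule infinitesimally_invariant_if_transvection_invariant)
    fix v :: "nat \<Rightarrow> 'k" and s y assume y: "y \<in> ?W"
    \<comment> \<open>The inverse of \<open>B\<close> enters with its indices in the order
      \<open>(y j, y' j)\<close>. With transposes, \<open>?C\<close> at these indices is the
      transvection at \<open>(y' j, y j)\<close>.\<close>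
    let ?B = "transpose_mat (transvection_mat q v (- s)) :: 'k mat"
    let ?C = "transpose_mat (transvection_mat q v s) :: 'k mat"
    have C: "?C \<in> carrier_mat (2 * q) (2 * q)" by simp
    have BC: "?B * ?C = 1\<^sub>m (2 * q)"
      using transpose_mult[OF transvection_mat_carrier transvection_mat_carrier, of q v s v "- s"]
      by (simp add: transvection_mat_inverse)
    have "tensor D ts i x y = (\<Sum>x'\<in>?V. \<Sum>y'\<in>?W. tensor D ts i x' y'
        * ((\<Prod>j<D. 1\<^sub>m (2 * p) $$ (x' j, x j)) * (\<Prod>j<D. ?C $$ (y j, y' j))))"
      by (rule tensor_invariant[OF ts D inv one_in_Sp Sp_transpose[OF transvection_mat_in_Sp] C BC i x y])
    also have "\<dots> = (\<Sum>x'\<in>?V. of_bool (x' = x) * (\<Sum>y'\<in>?W. tensor D ts i x' y' * (\<Prod>j<D. ?C $$ (y j, y' j))))"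
      unfolding sum_distrib_left
    proof (intro sum.cong refl)
      fix x' y' assume x': "x' \<in> ?V"
      show "tensor D ts i x' y' * ((\<Prod>j<D. 1\<^sub>m (2 * p) $$ (x' j, x j)) * (\<Prod>j<D. ?C $$ (y j, y' j)))
        = of_bool (x' = x) * (tensor D ts i x' y' * (\<Prod>j<D. ?C $$ (y j, y' j)))"
        unfolding prod_one_mat[OF x' x finite_lessThan] by (simp only: mult.left_commute)
    qed
    also have "\<dots> = (\<Sum>y'\<in>?W. tensor D ts i x y' * (\<Prod>j<D. ?C $$ (y j, y' j)))"
      using x by (simp only: sum_of_bool_eq finite_words finite_lessThan)
    also have "\<dots> = (\<Sum>y'\<in>?W. tensor D ts i x y' * (\<Prod>j<D. transvection (2 * q) (sform q) v s (y' j) (y j)))"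
      using y by (intro sum.cong refl arg_cong2[where f = "(*)"] prod.cong) (simp add: transvection_mat_def)
    finally show "(\<Sum>y'\<in>?W. tensor D ts i x y' * (\<Prod>j<D. transvection (2 * q) (sform q) v s (y' j) (y j)))
      = tensor D ts i x y" by simp
  qed simp
  have "(\<lambda>M. \<Sum>i\<in>{..<D} \<rightarrow>\<^sub>E {1..d}. \<Sum>x\<in>?V. \<Sum>y\<in>?W.
      tensor D ts i x y * (\<Prod>j<D. M (i j) $$ (x j, y j))) \<in> trace_algebra p q d"
  proof (rule algebra_on_sum)
    fix i assume i: "i \<in> {..<D} \<rightarrow>\<^sub>E {1..d}"
    then have "i ` {..<D} \<subseteq> {1..d}" by blast
    then show "(\<lambda>M. \<Sum>x\<in>?V. \<Sum>y\<in>?W. tensor D ts i x y * (\<Prod>j<D. M (i j) $$ (x j, y j))) \<in> trace_algebra p q d"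
      by (rule sum_invariant_in_trace_algebra[OF finite_lessThan _ inv1[OF i] inv2[OF i]])
  qed
  then show ?thesis
    by (rule algebra_on_cong) (simp only: polar_eq_sum_tensor[OF ts] coord_def fst_conv snd_conv)
qed

section \<open>Descent on the degree\<close>

lemma eval_terms_partition:
  "eval_terms ts h = eval_terms (filter P ts) h + eval_terms (filter (\<lambda>t. \<not> P t) ts) h"
  by (induction ts) (auto simp: algebra_simps)

text \<open>The part of top degree D is 1/D! times its polarisation at equal arguments, hence
  invariant and in the trace algebra. Subtracting it leaves an invariant polynomial of smaller
  degree. The strict bound makes \<open>D = 0\<close> the case of the empty list.\<close>

lemma invariant_terms_in_trace_algebra:
  fixes ts :: "('k::field_char_0 \<times> (nat \<times> nat \<times> nat) list) list"
  assumes "terms_over ts (coord_set (2 * p) (2 * q) d)"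
    and "\<And>c es. (c, es) \<in> set ts \<Longrightarrow> length es < D"
    and "invariant_terms p q d ts"
  shows "(\<lambda>M. eval_terms ts (coord M)) \<in> trace_algebra p q d"
  using assms
proof (induction D arbitrary: ts)
  case 0
  then have "ts = []" by (cases ts) auto
  then show ?case by (simp add: algebra_on_const)
next
  case (Suc D)
  note ts = Suc.prems(1) and inv = Suc.prems(3)
  have D: "length es \<le> D" if "(c, es) \<in> set ts" for c es
    using Suc.prems(2)[OF that] by simp
  define P where "P = (\<lambda>(c::'k, es :: (nat \<times> nat \<times> nat) list). length es = D)"
  let ?top = "filter P ts" and ?low = "filter (\<lambda>t. \<not> P t) ts"
  define K :: 'k where "K = inverse (of_nat (card (perms D)))"
  have "(of_nat (card (perms D)) :: 'k) \<noteq> 0"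
    using card_perms_pos[of D] by (simp only: of_nat_eq_0_iff)
  then have K: "K * of_nat (card (perms D)) = 1"
    unfolding K_def by (rule left_inverse)
  have top: "eval_terms ?top h = K * polar D ts (\<lambda>j. h)" for h
    unfolding polar_diag P_def mult.assoc[symmetric] K by simp
  have low: "eval_terms ?low h = eval_terms ts h - K * polar D ts (\<lambda>j. h)" for h
    using eval_terms_partition[of ts h P] top[of h] by simp
  have "invariant_terms p q d ?low"
    unfolding invariant_terms_def
  proof (intro ballI)
    fix A B :: "'k mat" and M :: "nat \<Rightarrow> 'k mat" assume AB: "A \<in> Sp p" "B \<in> Sp q" and M: "M \<in> mat_tuples (2 * p) (2 * q) d"
    have "polar D ts (\<lambda>j. coord (tuple_action d (A, B) M)) = polar D ts (\<lambda>j. coord M)"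
      by (rule polar_tuple_action[where Ms = "\<lambda>_. M", OF ts D inv AB M])
    then show "eval_terms ?low (coord (tuple_action d (A, B) M)) = eval_terms ?low (coord M)"
      unfolding low using inv AB M by (simp add: invariant_terms_def)
  qed
  moreover have "terms_over ?low (coord_set (2 * p) (2 * q) d)"
    using ts by (auto simp: terms_over_def)
  moreover have "length es < D" if "(c, es) \<in> set ?low" for c es
    using that D[of c es] by (auto simp: P_def)
  ultimately have low_in: "(\<lambda>M. eval_terms ?low (coord M)) \<in> trace_algebra p q d"
    using Suc.IH by blast
  have "(\<lambda>M. K * polar D ts (\<lambda>j. coord M) + eval_terms ?low (coord M)) \<in> trace_algebra p q d"
    by (intro algebra_on_add algebra_on_mult algebra_on_const low_in polar_diag_in_trace_algebra ts inv D)
  then show ?case by (simp add: low)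
qed

theorem invariants_subset_trace_algebra:
  "(symp_invariants p q d :: ((nat \<Rightarrow> 'k::field_char_0 mat) \<Rightarrow> 'k) set)
    \<subseteq> generated_algebra (mat_tuples (2 * p) (2 * q) d)
     {trace_function p q w | w. w \<noteq> [] \<and> set w \<subseteq> {1..d} \<times> {1..d}}"
proof
  fix f :: "(nat \<Rightarrow> 'k mat) \<Rightarrow> 'k"
  let ?X = "mat_tuples (2 * p) (2 * q) d :: (nat \<Rightarrow> 'k mat) set"
  assume f: "f \<in> symp_invariants p q d"
  then have "f \<in> polynomial_functions (2 * p) (2 * q) d" by (simp add: symp_invariants_def)
  from polynomial_function_eq_eval_terms[OF this] obtain ts where
    ts: "terms_over ts (coord_set (2 * p) (2 * q) d)" and fe: "f = (\<lambda>M\<in>?X. eval_terms ts (coord M))"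
    unfolding terms_over_def by blast
  have fX: "f M = eval_terms ts (coord M)" if "M \<in> ?X" for M using that by (simp add: fe)
  have "invariant_terms p q d ts"
    unfolding invariant_terms_def
  proof (intro ballI)
    fix A B :: "'k mat" and M :: "nat \<Rightarrow> 'k mat" assume AB: "A \<in> Sp p" "B \<in> Sp q" and M: "M \<in> ?X"
    have "f (tuple_action d (A, B) M) = f M"
      using f AB M by (auto simp: symp_invariants_def)
    then show "eval_terms ts (coord (tuple_action d (A, B) M)) = eval_terms ts (coord M)"
      using fX tuple_action_Sp_closed[OF AB M] M by simp
  qed
  \<comment> \<open>The sum of the degrees of all terms serves as a common bound.\<close>
  moreover have "length es < Suc (sum_list (map (\<lambda>(c, es). length es) ts))" if "(c, es) \<in> set ts" for c es
    using that by (auto intro!: le_imp_less_Suc member_le_sum_list image_eqI[of _ _ "(c, es)"])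
  ultimately have "(\<lambda>M. eval_terms ts (coord M)) \<in> trace_algebra p q d"
    using invariant_terms_in_trace_algebra[OF ts] by blast
  then show "f \<in> generated_algebra ?X {trace_function p q w | w. w \<noteq> [] \<and> set w \<subseteq> {1..d} \<times> {1..d}}"
    by (simp add: algebra_on_def fe)
qed

theorem mainTheorem5:
  fixes p q d :: nat
  assumes "p \<ge> 1" and "q \<ge> 1" and "d \<ge> 1"
  shows "(symp_invariants p q d
            :: ((nat \<Rightarrow> 'k :: {alg_closed_field, field_char_0} mat) \<Rightarrow> 'k) set)
    = generated_algebra (mat_tuples (2 * p) (2 * q) d)
        {trace_function p q w | w. w \<noteq> [] \<and> set w \<subseteq> {1..d} \<times> {1..d}}"
  using trace_algebra_subset_invariants[of p q d] invariants_subset_trace_algebra[of p q d]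
  by (rule subset_antisym[rotated])

end
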